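(* Let $\Delta$ be a complete simplicial fan in a lattice $N$ of rank $n$, let $1\le k\le n$, and let $x\in H_T^{2k}(\Delta)_{\mathbb{Q}}$. Then for any $\xi\in H_T^2(\Delta)_{\mathbb{Q}}$, $$p_*(e^{\xi}x)=\sum_{J\in\Sigma^{(k)}}\mu(x,J)\,p_*(e^{\xi}x_J)\qquad\text{in } \mathrm{Rat}(G_{n-k+1}(N_{\mathbb{Q}}))_0,$$ where the left-hand side, a rational number, is regarded as a constant rational function.
   Context: Let $N$ be a lattice (free abelian group) of rank $n$, $M=\mathrm{Hom}(N,\mathbb{Z})$, with pairing $\langle\ ,\ \rangle$; subscripts $\mathbb{Q},\mathbb{R}$ denote tensoring with $\mathbb{Q},\mathbb{R}$. Fan. For a simplicial fan $\Delta$ of rational cones in $N_{\mathbb{R}}$, let $\Sigma^{(1)}$ be its set of rays and $\Sigma$ the simplicial complex on the vertex set $\Sigma^{(1)}$ whose simplices $J$ are the sets of rays that are the edges of a cone $C(J)$ of $\Delta$ (the empty set $o$ is included, with $C(o)=0$). $\Sigma^{(k)}$ is the set of $J\in\Sigma$ with $|J|=k$, i.e. of $k$-dimensional cones. For $i\in\Sigma^{(1)}$, $v_i$ is the primitive vector of $N$ generating the ray $i$. For $J\in\Sigma$: $N_{J,\mathcal V}$ is the sublattice generated by $\{v_j\}_{j\in J}$, $N_J$ is the minimal primitive (saturated) sublattice of $N$ containing it, $H_J=N_J/N_{J,\mathcal V}$ (a finite group), and $\{u_j^J\}_{j\in J}$ is the basis of $N_{J,\mathcal V}^*$ dual to $\{v_j\}_{j\in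 J}$. For $I\in\Sigma^{(n)}$, the $u_i^I$ are regarded as elements of $M_{\mathbb{Q}}$. Equivariant cohomology. $H_T^*(pt)$ is the symmetric algebra of $M$, with $M=H_T^2(pt)$ in degree 2. $H_T^*(\Delta)$ is the Stanley–Reisner ring $\mathbb{Z}[x_i\mid i\in\Sigma^{(1)}]/(\prod_{i\in K}x_i\mid K\notin\Sigma)$ with $\deg x_i=2$, an $H_T^*(pt)$-algebra via $u\mapsto\sum_{i}\langle u,v_i\rangle x_i$ for $u\in M$. Put $x_J=\prod_{j\in J}x_j$. For $I\in\Sigma^{(n)}$, $\iota_I^*:H_T^*(\Delta)_{\mathbb{Q}}\to H_T^*(pt)_{\mathbb{Q}}$ is the ring homomorphism with $\iota_I^*(x_i)=u_i^I$ for $i\in I$ and $\iota_I^*(x_i)=0$ for $i\notin I$. Define $$\pi_*(x)=\sum_{I\in\Sigma^{(n)}}\frac{\iota_I^*(x)}{|H_I|\prod_{i\in I}u_i^I};$$ since $\Delta$ is complete, $\pi_*$ takes values in $H_T^*(pt)_{\mathbb{Q}}$; it lowers degree by $2n$. $p_*:H_T^*(\Delta)_{\mathbb{Q}}\to\mathbb{Q}$ is $\pi_*$ followed by projection to $H_T^0(pt)_{\mathbb{Q}}=\mathbb{Q}$, and it extends to power series such as $e^{\xi}x$, $e^\xi=\sum_m\xi^m/m!$ (only the component of degree $2n$ contributes). The functions $\mu(x,J)$. For $J\in\Sigma^{(k)}$ let $M_J\subset M$ be the annihilator of $N_J$, choose an orientation of $M_J$, and put $\omega_J=u_1\wedge\cdots\wedge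 u_{n-k}\in\bigwedge^{n-k}M$ for an oriented basis $u_1,\dots,u_{n-k}$ of $M_J$. Define $f^J(x_i)=\iota_I^*(x_i)\wedge\omega_J\in\bigwedge^{n-k+1}M_{\mathbb{Q}}$, where $I\in\Sigma^{(n)}$ is any simplex containing $J$ (the result is independent of $I$), and extend $f^J$ to a ring homomorphism $f^J:H_T^*(\Delta)_{\mathbb{Q}}\to S^*(\bigwedge^{n-k+1}M_{\mathbb{Q}})$ to the symmetric algebra. For $x\in H_T^{2k}(\Delta)_{\mathbb{Q}}$, the quotient $f^J(x)/f^J(x_J)$ is homogeneous of degree $0$, independent of the orientation chosen, and is viewed as an element of $\mathrm{Rat}(\mathbb{P}(\bigwedge^{n-k+1}N_{\mathbb{Q}}))_0$, the rational functions of degree $0$ on $\mathbb{P}(\bigwedge^{n-k+1}N_{\mathbb{Q}})$. Let $G_{n-k+1}(N_{\mathbb{Q}})$ be the Grassmannian of $(n-k+1)$-planes in $N_{\mathbb{Q}}$, $\mathrm{Rat}(G_{n-k+1}(N_{\mathbb{Q}}))_0$ its field of rational functions (of degree $0$), and $\nu:G_{n-k+1}(N_{\mathbb{Q}})\to\mathbb{P}(\bigwedge^{n-k+1}N_{\mathbb{Q}})$ the Plücker embedding. Then $\mu(x,J)=\nu^*\big(f^J(x)/f^J(x_J)\big)\in\mathrm{Rat}(G_{n-k+1}(N_{\mathbb{Q}}))_0$. *)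

theory Defs
  imports
    "HOL-Analysis.Analysis"
    "HOL-Algebra.QuotRing"
    "HOL-Algebra.Generated_Groups"
    "HOL-Computational_Algebra.Polynomial_Factorial"
    "HOL-Library.Poly_Mapping"
    "HOL-Library.List_Lexorder"
    "HOL-Library.Groups_Big_Fun"
    "Jordan_Normal_Form.Determinant"
begin

(* Conventions.  The lattice N of rank n is int^'n with n = CARD('n); N_Q = rat^'n and
   N_R = real^'n.  The dual M is again int^'n (M_Q = rat^'n), paired with N by the
   standard bilinear form.  The linear order on 'n serves two purposes: it selects the
   standard basis of the exterior powers and makes the polynomial rings below integral
   domains for the type class system.  All cohomological degrees are halved. *)

section \<open>Lattices\<close>

type_synonym 'n lvec = "int ^ 'n"

definition vec_of :: "'n lvec \<Rightarrow> 'a::ring_1 ^ 'n" where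
  "vec_of v = (\<chi> a. of_int (vec_nth v a))"

definition pairing :: "'a::comm_semiring_1 ^ 'n \<Rightarrow> 'a ^ 'n \<Rightarrow> 'a" where
  "pairing u v = (\<Sum>a\<in>UNIV. vec_nth u a * vec_nth v a)"

definition lattice_group :: "'n::finite lvec monoid" where
  "lattice_group = \<lparr>carrier = UNIV, monoid.mult = (+), one = 0\<rparr>"

definition saturated :: "'n::finite lvec set \<Rightarrow> bool" where
  "saturated L \<longleftrightarrow> (\<forall>m v. m \<noteq> 0 \<and> m *s v \<in> L \<longrightarrow> v \<in> L)"

definition lattice_basis :: "'n::finite lvec set \<Rightarrow> 'n lvec list \<Rightarrow> bool" where
  "lattice_basis L us \<longleftrightarrow> generate lattice_group (set us) = L \<and>
     (\<forall>c. (\<Sum>a<length us. c a *s us ! a) = 0 \<longrightarrow> (\<forall>a<length us. c a = 0))"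

section \<open>Fans\<close>

type_synonym 'n cone = "(real ^ 'n) set"

definition rational_cone :: "'n::finite cone \<Rightarrow> bool" where
  "rational_cone \<sigma> \<longleftrightarrow> (\<exists>S :: 'n lvec set. finite S \<and> \<sigma> = convex_cone hull (vec_of ` S))"

(* The predicate face_of admits the empty face, which is not a cone. *)
definition fan :: "'n::finite cone set \<Rightarrow> bool" where
  "fan \<Delta> \<longleftrightarrow> finite \<Delta> \<and>
     (\<forall>\<sigma>\<in>\<Delta>. rational_cone \<sigma> \<and> \<sigma> \<inter> uminus ` \<sigma> = {0}) \<and>
     (\<forall>\<sigma>\<in>\<Delta>. \<forall>\<tau>. \<tau> face_of \<sigma> \<and> \<tau> \<noteq> {} \<longrightarrow> \<tau> \<in> \<Delta>) \<and>
     (\<forall>\<sigma>\<in>\<Delta>. \<forall>\<tau>\<in>\<Delta>. (\<sigma> \<inter> \<tau>) face_of \<sigma> \<and> (\<sigma> \<inter> \<tau>) face_of \<tau>)"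

definition simplicial_fan :: "'n::finite cone set \<Rightarrow> bool" where
  "simplicial_fan \<Delta> \<longleftrightarrow> fan \<Delta> \<and> (\<forall>\<sigma>\<in>\<Delta>. \<exists>B. independent B \<and> \<sigma> = convex_cone hull B)"

definition complete_fan :: "'n::finite cone set \<Rightarrow> bool" where
  "complete_fan \<Delta> \<longleftrightarrow> fan \<Delta> \<and> \<Union>\<Delta> = UNIV"

definition rays :: "'n::finite cone set \<Rightarrow> 'n cone set" where
  "rays \<Delta> = {\<rho>\<in>\<Delta>. dim \<rho> = 1}"

definition simplices :: "'n::finite cone set \<Rightarrow> 'n cone set set" where
  "simplices \<Delta> = {J. \<exists>\<sigma>\<in>\<Delta>. J = {\<rho>\<in>rays \<Delta>. \<rho> face_of \<sigma>}}"

definition simplices_of_card :: "'n::finite cone set \<Rightarrow> nat \<Rightarrow> 'n cone set set" where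
  "simplices_of_card \<Delta> k = {J\<in>simplices \<Delta>. card J = k}"

definition prim_vec :: "'n::finite cone \<Rightarrow> 'n lvec" where
  "prim_vec \<rho> = (THE v. vec_of v \<in> \<rho> \<and> Gcd (range (vec_nth v)) = 1)"

definition ray_lattice :: "'n::finite cone set \<Rightarrow> 'n lvec set" where
  "ray_lattice J = generate lattice_group (prim_vec ` J)"

definition sat_lattice :: "'n::finite cone set \<Rightarrow> 'n lvec set" where
  "sat_lattice J = (\<lambda>L. subgroup L lattice_group \<and> saturated L) hull (ray_lattice J)"

definition H_group :: "'n::finite cone set \<Rightarrow> 'n lvec set monoid" where
  "H_group J = lattice_group\<lparr>carrier := sat_lattice J\<rparr> Mod ray_lattice J"

definition ann_lattice :: "'n::finite cone set \<Rightarrow> 'n lvec set" where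
  "ann_lattice J = {u. \<forall>v\<in>sat_lattice J. pairing u v = 0}"

(* The vector u_i^I of M_Q; uniqueness holds for I of cardinality n. *)
definition dual_vec :: "'n cone set \<Rightarrow> 'n cone \<Rightarrow> rat ^ 'n" where
  "dual_vec I i = (THE u. \<forall>j\<in>I. pairing u (vec_of (prim_vec j)) = (if j = i then 1 else 0))"

section \<open>Polynomials with rational coefficients\<close>

type_synonym 'v qpoly = "('v \<Rightarrow>\<^sub>0 nat) \<Rightarrow>\<^sub>0 rat"

definition Const :: "rat \<Rightarrow> 'v qpoly" where
  "Const c = Poly_Mapping.single 0 c"

definition Var :: "'v \<Rightarrow> 'v qpoly" where
  "Var v = Poly_Mapping.single (Poly_Mapping.single v 1) 1"

definition vars :: "'v qpoly \<Rightarrow> 'v set" where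
  "vars p = (\<Union>m\<in>Poly_Mapping.keys p. Poly_Mapping.keys m)"

definition homogeneous :: "nat \<Rightarrow> 'v qpoly \<Rightarrow> bool" where
  "homogeneous d p \<longleftrightarrow>
     (\<forall>m\<in>Poly_Mapping.keys p. (\<Sum>v\<in>Poly_Mapping.keys m. Poly_Mapping.lookup m v) = d)"

(* The extension of h on variables to a ring homomorphism, where c is the structure map
   of a commutative Q-algebra. *)
definition poly_hom :: "(rat \<Rightarrow> 'a::comm_ring_1) \<Rightarrow> ('v \<Rightarrow> 'a) \<Rightarrow> 'v qpoly \<Rightarrow> 'a" where
  "poly_hom c h p = (\<Sum>m\<in>Poly_Mapping.keys p. c (Poly_Mapping.lookup p m) *
     (\<Prod>v\<in>Poly_Mapping.keys m. h v ^ Poly_Mapping.lookup m v))"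

section \<open>Equivariant cohomology\<close>

definition ray_poly_ring :: "'n::finite cone set \<Rightarrow> 'n cone qpoly ring" where
  "ray_poly_ring \<Delta> = \<lparr>carrier = {p. vars p \<subseteq> rays \<Delta>}, monoid.mult = (*), one = 1,
     ring.zero = 0, ring.add = (+)\<rparr>"

definition SR_ideal :: "'n::finite cone set \<Rightarrow> 'n cone qpoly set" where
  "SR_ideal \<Delta> = Idl\<^bsub>ray_poly_ring \<Delta>\<^esub> {\<Prod>i\<in>K. Var i |K. K \<subseteq> rays \<Delta> \<and> K \<notin> simplices \<Delta>}"

(* H_T(\<Delta>) tensored with Q. *)
definition HT :: "'n::finite cone set \<Rightarrow> 'n cone qpoly set ring" where
  "HT \<Delta> = ray_poly_ring \<Delta> Quot SR_ideal \<Delta>"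

definition HT_class ::
  "'n::finite cone set \<Rightarrow> 'n cone qpoly \<Rightarrow> 'n cone qpoly set" where
  "HT_class \<Delta> p = SR_ideal \<Delta> +>\<^bsub>ray_poly_ring \<Delta>\<^esub> p"

(* HT_deg k is the component of degree 2k. *)
definition HT_deg :: "'n::finite cone set \<Rightarrow> nat \<Rightarrow> 'n cone qpoly set set" where
  "HT_deg \<Delta> k = HT_class \<Delta> ` {p \<in> carrier (ray_poly_ring \<Delta>). homogeneous k p}"

definition x_face ::
  "'n::finite cone set \<Rightarrow> 'n cone set \<Rightarrow> 'n cone qpoly set" where
  "x_face \<Delta> J = HT_class \<Delta> (\<Prod>j\<in>J. Var j)"

(* H_T(pt)_Q = Sym(M_Q) is the polynomial ring on the standard basis of M. *)
definition lin_form :: "rat ^ 'n \<Rightarrow> 'n qpoly" where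
  "lin_form u = (\<Sum>a\<in>UNIV. Const (vec_nth u a) * Var a)"

(* The restriction of x_i to the fixed point of I, as a vector of M_Q. *)
definition iota_vec :: "'n cone set \<Rightarrow> 'n cone \<Rightarrow> rat ^ 'n" where
  "iota_vec I i = (if i \<in> I then dual_vec I i else 0)"

(* Homomorphisms out of the quotient ring are evaluated on an arbitrary representative of
   the class; the image of the class is a singleton. *)
definition iota :: "'n::finite cone set \<Rightarrow> 'n cone qpoly set \<Rightarrow> 'n qpoly" where
  "iota I y = the_elem (poly_hom Const (\<lambda>i. lin_form (iota_vec I i)) ` y)"

definition pi_star :: "'n::{finite,linorder} cone set \<Rightarrow> 'n cone qpoly set
    \<Rightarrow> 'n qpoly fract" where
  "pi_star \<Delta> y = (\<Sum>I\<in>simplices_of_card \<Delta> CARD('n).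
     to_fract (iota I y) /
     (of_nat (order (H_group I)) * (\<Prod>i\<in>I. to_fract (lin_form (dual_vec I i)))))"

definition p_star :: "'n::{finite,linorder} cone set \<Rightarrow> 'n cone qpoly set
    \<Rightarrow> rat" where
  "p_star \<Delta> y = Poly_Mapping.lookup (THE q. to_fract q = pi_star \<Delta> y) 0"

(* p_*(e^\<xi> x), evaluated term by term on the power series.  For homogeneous \<xi> of positive
   degree and homogeneous x only one term can be nonzero; Sum_any is the sum over the
   nonzero terms. *)
definition p_star_exp :: "'n::{finite,linorder} cone set
    \<Rightarrow> 'n cone qpoly set \<Rightarrow> 'n cone qpoly set \<Rightarrow> rat" where
  "p_star_exp \<Delta> \<xi> x = Sum_any (\<lambda>m::nat. p_star \<Delta>
     (HT_class \<Delta> (Const (1 / fact m)) \<otimes>\<^bsub>HT \<Delta>\<^esub> (\<xi> [^]\<^bsub>HT \<Delta>\<^esub> m) \<otimes>\<^bsub>HT \<Delta>\<^esub> x))"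

section \<open>Exterior powers and the Grassmannian\<close>

(* The standard basis of the r-th exterior power of M_Q or N_Q is indexed by the strictly
   increasing lists of length r. *)
definition ext_index :: "nat \<Rightarrow> 'n::linorder list set" where
  "ext_index r = {S. length S = r \<and> sorted_wrt (<) S}"

(* wedge us is the coordinate vector of the exterior product of the entries of us. *)
definition wedge :: "(rat ^ 'n) list \<Rightarrow> 'n list \<Rightarrow> rat" where
  "wedge us S = Determinant.det (Matrix.mat (length us) (length us)
     (\<lambda>(a, b). vec_nth (us ! a) (S ! b)))"

(* The exterior product of vectors of M_Q as a linear element of the symmetric algebra on
   the exterior power, that is, as a linear form on the exterior power of N_Q. *)
definition wedge_form :: "(rat ^ 'n::{finite,linorder}) list \<Rightarrow> 'n list qpoly" where
  "wedge_form us = (\<Sum>S\<in>ext_index (length us). Const (wedge us S) * Var S)"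

definition grassmannian :: "nat \<Rightarrow> (rat ^ 'n) set set" where
  "grassmannian r = {W. vec.subspace W \<and> vec.dim W = r}"

(* The point of P(Wedge^r N_Q) attached to W, as a line in coordinates. *)
definition plucker :: "(rat ^ 'n) set \<Rightarrow> ('n list \<Rightarrow> rat) set" where
  "plucker W = {\<lambda>S. c * wedge ws S |c ws.
     distinct ws \<and> vec.independent (set ws) \<and> vec.span (set ws) = W}"

(* The Grassmannian is a rational variety over the infinite field Q, so its rational points
   are dense and vanishing at these points amounts to vanishing on the variety. *)
definition vanishes_on_grassmannian :: "nat \<Rightarrow> 'n::{finite,linorder} list qpoly \<Rightarrow> bool" where
  "vanishes_on_grassmannian r P \<longleftrightarrow>
     (\<forall>W\<in>grassmannian r. \<forall>w\<in>plucker W. poly_hom id w P = 0)"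

definition ext_forms :: "nat \<Rightarrow> nat \<Rightarrow> 'n::linorder list qpoly set" where
  "ext_forms r d = {P. vars P \<subseteq> ext_index r \<and> homogeneous d P}"

(* The rational functions of degree 0 on P(Wedge^r N_Q) defined at the generic point of the
   embedded Grassmannian: the local ring of the projective space along the Grassmannian. *)
definition plucker_local_ring :: "nat \<Rightarrow> 'n::{finite,linorder} list qpoly fract ring" where
  "plucker_local_ring r = \<lparr>carrier = {Fraction_Field.Fract P Q |P Q d.
       P \<in> ext_forms r d \<and> Q \<in> ext_forms r d \<and> \<not> vanishes_on_grassmannian r Q},
     monoid.mult = (*), one = 1, ring.zero = 0, ring.add = (+)\<rparr>"

definition plucker_max_ideal :: "nat \<Rightarrow> 'n::{finite,linorder} list qpoly fract set" where
  "plucker_max_ideal r = {Fraction_Field.Fract P Q |P Q d.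
     P \<in> ext_forms r d \<and> Q \<in> ext_forms r d \<and>
     vanishes_on_grassmannian r P \<and> \<not> vanishes_on_grassmannian r Q}"

(* The function field of the Grassmannian is the residue field of this local ring, and
   restriction along the Pluecker embedding is the residue map. *)
definition Rat_G :: "nat \<Rightarrow> 'n::{finite,linorder} list qpoly fract set ring" where
  "Rat_G r = plucker_local_ring r Quot plucker_max_ideal r"

definition plucker_pullback :: "nat \<Rightarrow> 'n::{finite,linorder} list qpoly fract
    \<Rightarrow> 'n list qpoly fract set" where
  "plucker_pullback r f = plucker_max_ideal r +>\<^bsub>plucker_local_ring r\<^esub> f"

definition Rat_G_const :: "nat \<Rightarrow> rat \<Rightarrow> 'n::{finite,linorder} list qpoly fract set" where
  "Rat_G_const r c = plucker_pullback r (to_fract (Const c))"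

section \<open>The functions \<open>\<mu>(x, J)\<close>\<close>

(* An ordered basis us of M_J stands for the orientation together with \<omega>_J, so that
   the exterior product of u with \<omega>_J is that of the list u # us. *)
definition f_hom :: "'n::{finite,linorder} cone set \<Rightarrow> 'n lvec list
    \<Rightarrow> 'n cone qpoly set \<Rightarrow> 'n list qpoly" where
  "f_hom I us y = the_elem
     (poly_hom Const (\<lambda>i. wedge_form (iota_vec I i # map vec_of us)) ` y)"

(* The two choices below do not affect the value. *)
definition mu :: "'n::{finite,linorder} cone set \<Rightarrow> 'n cone qpoly set
    \<Rightarrow> 'n cone set \<Rightarrow> 'n list qpoly fract set" where
  "mu \<Delta> x J =
     (let I = (SOME I. I \<in> simplices_of_card \<Delta> CARD('n) \<and> J \<subseteq> I);
          us = (SOME us. lattice_basis (ann_lattice J) us)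
      in plucker_pullback (CARD('n) - card J + 1)
           (to_fract (f_hom I us x) / to_fract (f_hom I us (x_face \<Delta> J))))"

end

theory Submission
  imports Defs
begin

text \<open>
  All maps out of the cohomology ring are evaluated on polynomials in the ray variables \<open>x\<^sub>i\<close>; the
  Stanley--Reisner relations enter only through the observation that these maps kill them. Write
  \<open>n\<close> for the rank, \<open>v\<^sub>i\<close> for the primitive generators and \<open>theta u = (\<Sum>i. \<langle>u,v\<^sub>i\<rangle> x\<^sub>i)\<close> for the image of
  \<open>u \<in> M\<close> in the cohomology of the fan.

  The identity is proved at one plane \<open>E\<close> of dimension \<open>n - k + 1\<close> at a time, for generic \<open>E\<close>.
  Three facts carry it.

  \<^item> The top pairing \<open>p \<mapsto> p\<^sub>*(e\<^sup>\<xi> p)\<close> kills every multiple of \<open>theta u\<close> (\<open>top_theta\<close>). Indeed the push-forward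
  is linear over the polynomial functions (\<open>push_theta\<close>) and takes polynomial values
  (\<open>push_integral\<close>), and a polynomial multiple of the linear form \<open>u\<close> has no constant term.

  \<^item> If \<open>E\<close> meets the span of every simplex with fewer than \<open>k\<close> elements only in \<open>0\<close>, then modulo the
  \<open>theta u\<close> with \<open>u\<close> orthogonal to \<open>E\<close> every class of degree \<open>k\<close> is a combination of the squarefree
  \<open>x\<^sub>J\<close> with \<open>k\<close> factors (\<open>homogeneous_reduction\<close>): a repeated variable is traded, by means of a suitable
  \<open>u\<close>, for variables outside the support of the monomial.

  \<^item> Wedging with \<open>\<omega>\<^sub>J\<close> and evaluating at \<open>E\<close> is a linear functional on \<open>M\<close> that kills both the
  annihilator of \<open>J\<close> and that of \<open>E\<close>. So \<open>x \<mapsto> f\<^sup>J(x)(E)\<close> is a ring homomorphism that kills \<open>theta u\<close> for \<open>u\<close>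
  orthogonal to \<open>E\<close> and kills \<open>x\<^bsub>J'\<^esub>\<close> for all other \<open>J'\<close> of the same size. Applied to
  \<open>x \<equiv> (\<Sum>J. c\<^sub>J x\<^sub>J)\<close> it yields \<open>c\<^sub>J = \<mu>(x, J)(E)\<close>, and the top pairing then yields the identity at \<open>E\<close>
  (\<open>pointwise_identity\<close>).

  By the Cauchy--Binet formula the denominators \<open>f\<^sup>J(x\<^sub>J)\<close> are nonzero at \<open>E\<close> exactly when \<open>E\<close> is
  transversal in the sense above. Since the vanishing ideal of the Grassmannian is prime
  (\<open>vanishing_ideal_prime\<close>), the identity at the generic planes is an identity in the function field
  (\<open>localization_identity\<close>).

  That the push-forward takes polynomial values also follows from the reduction, with \<open>E = 0\<close>: it suffices to know
  the push-forward of \<open>x\<^sub>J\<close> for all simplices \<open>J\<close>. It is \<open>1/|H\<^sub>J|\<close> if \<open>J\<close> has \<open>n\<close> elements, and otherwise it is zero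
  (\<open>push_small_simplex\<close>). For the latter take \<open>u \<noteq> 0\<close> orthogonal to the generators of \<open>J\<close>; then \<open>u\<close> times the
  push-forward of \<open>x\<^sub>J\<close> is the sum of \<open>\<langle>u,v\<^sub>i\<rangle>\<close> times the push-forward of \<open>x\<^bsub>J \<union> {i}\<^esub>\<close>. By descending induction only
  walls need an argument, and there completeness gives two neighbouring cones, on opposite sides of
  the wall, whose lattice indices are proportional to their heights above it (\<open>wall_balance\<close>).
\<close>

lemmas cart_eq_iff = Finite_Cartesian_Product.vec_eq_iff

section \<open>Polynomials with rational coefficients\<close>

abbreviation "keys \<equiv> Poly_Mapping.keys"
abbreviation "lookup \<equiv> Poly_Mapping.lookup"
abbreviation "single \<equiv> Poly_Mapping.single"

definition monom_deg :: "('v \<Rightarrow>\<^sub>0 nat) \<Rightarrow> nat" where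
  "monom_deg m = (\<Sum>v\<in>keys m. lookup m v)"

abbreviation Monom :: "('v \<Rightarrow>\<^sub>0 nat) \<Rightarrow> 'v qpoly" where
  "Monom m \<equiv> single m 1"

lemma homogeneous_iff: "homogeneous d p \<longleftrightarrow> (\<forall>m\<in>keys p. monom_deg m = d)"
  by (simp add: homogeneous_def monom_deg_def)

lemma monom_deg_superset:
  assumes "finite A" "keys m \<subseteq> A"
  shows "monom_deg m = (\<Sum>v\<in>A. lookup m v)"
  unfolding monom_deg_def
  by (rule sum.mono_neutral_left) (use assms in \<open>auto simp: in_keys_iff\<close>)

lemma monom_deg_add: "monom_deg (m + m') = monom_deg m + monom_deg m'"
proof -
  let ?A = "keys m \<union> keys m'"
  have "keys (m + m') \<subseteq> ?A" by (rule Poly_Mapping.keys_add)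
  then show ?thesis
    by (simp add: monom_deg_superset[where A = ?A] lookup_add sum.distrib)
qed

lemma monom_deg_0 [simp]: "monom_deg 0 = 0"
  by (simp add: monom_deg_def)

lemma monom_deg_single [simp]: "monom_deg (single v k) = k"
  by (cases "k = 0") (simp_all add: monom_deg_def)

lemma homogeneous_0 [simp]: "homogeneous d 0"
  by (simp add: homogeneous_iff)

lemma homogeneous_add: "homogeneous d p \<Longrightarrow> homogeneous d q \<Longrightarrow> homogeneous d (p + q)"
  using Poly_Mapping.keys_add[of p q] by (fastforce simp: homogeneous_iff)

lemma homogeneous_diff: "homogeneous d p \<Longrightarrow> homogeneous d q \<Longrightarrow> homogeneous d (p - q)"
proof -
  assume h: "homogeneous d p" "homogeneous d q"
  have "keys (p - q) \<subseteq> keys p \<union> keys q"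
    by (auto simp: in_keys_iff lookup_minus)
  with h show ?thesis by (fastforce simp: homogeneous_iff)
qed

lemma homogeneous_mult: "homogeneous d p \<Longrightarrow> homogeneous e q \<Longrightarrow> homogeneous (d + e) (p * q)"
  using Poly_Mapping.keys_mult[of p q] by (fastforce simp: homogeneous_iff monom_deg_add)

lemma homogeneous_sum: "(\<And>i. i \<in> A \<Longrightarrow> homogeneous d (f i)) \<Longrightarrow> homogeneous d (sum f A)"
  by (induction A rule: infinite_finite_induct) (auto intro: homogeneous_add)

lemma homogeneous_Const [simp]: "homogeneous 0 (Const c)"
  by (auto simp: homogeneous_iff Const_def split: if_splits)

lemma homogeneous_Var [simp]: "homogeneous 1 (Var v)"
  by (auto simp: homogeneous_iff Var_def)

lemma homogeneous_1 [simp]: "homogeneous 0 1"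
  by (simp add: homogeneous_iff)

lemma homogeneous_Const_mult: "homogeneous d p \<Longrightarrow> homogeneous d (Const c * p)"
  using homogeneous_mult[OF homogeneous_Const] by fastforce

lemma homogeneous_prod: "(\<And>i. i \<in> A \<Longrightarrow> homogeneous d (f i)) \<Longrightarrow> homogeneous (d * card A) (prod f A)"
proof (induction A rule: infinite_finite_induct)
  case (insert x F)
  then show ?case using homogeneous_mult[of d "f x" "d * card F" "prod f F"] by simp
qed auto

lemma homogeneous_power: "homogeneous d p \<Longrightarrow> homogeneous (d * k) (p ^ k)"
proof (induction k)
  case (Suc k)
  then show ?case using homogeneous_mult[of d p "d * k" "p ^ k"] by simp
qed auto

lemma vars_0 [simp]: "vars 0 = {}" by (simp add: vars_def)
lemma vars_1 [simp]: "vars 1 = {}" by (simp add: vars_def)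
lemma vars_Const [simp]: "vars (Const c) = {}" by (auto simp: vars_def Const_def split: if_splits)
lemma vars_Var [simp]: "vars (Var v) = {v}" by (auto simp: vars_def Var_def)
lemma vars_add: "vars (p + q) \<subseteq> vars p \<union> vars q"
  using Poly_Mapping.keys_add[of p q] unfolding vars_def by blast

lemma vars_uminus [simp]: "vars (- p) = vars p"
proof -
  have "keys (- p) = keys p" by (auto simp: in_keys_iff)
  then show ?thesis by (simp add: vars_def)
qed

lemma vars_diff: "vars (p - q) \<subseteq> vars p \<union> vars q"
  using vars_add[of p "- q"] by simp

lemma vars_mult: "vars (p * q) \<subseteq> vars p \<union> vars q"
proof
  fix v assume "v \<in> vars (p * q)"
  then obtain m where m: "m \<in> keys (p * q)" "v \<in> keys m"
    by (auto simp: vars_def)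
  then obtain a b where "a \<in> keys p" "b \<in> keys q" "m = a + b"
    using Poly_Mapping.keys_mult[of p q] by blast
  then show "v \<in> vars p \<union> vars q"
    using m(2) Poly_Mapping.keys_add[of a b] by (auto simp: vars_def)
qed

lemma vars_sum_subset: "(\<And>i. i \<in> A \<Longrightarrow> vars (f i) \<subseteq> V) \<Longrightarrow> vars (sum f A) \<subseteq> V"
proof (induction A rule: infinite_finite_induct)
  case (insert i A)
  then show ?case using vars_add[of "f i" "sum f A"] by simp blast
qed auto

lemma vars_prod_subset: "(\<And>i. i \<in> A \<Longrightarrow> vars (f i) \<subseteq> V) \<Longrightarrow> vars (prod f A) \<subseteq> V"
proof (induction A rule: infinite_finite_induct)
  case (insert i A)
  then show ?case using vars_mult[of "f i" "prod f A"] by simp blast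
qed auto

lemma vars_power_subset: "vars p \<subseteq> V \<Longrightarrow> vars (p ^ k) \<subseteq> V"
  using vars_prod_subset[of "{..<k}" "\<lambda>_. p" V] by simp

lemma Const_0 [simp]: "Const 0 = 0" by (simp add: Const_def)
lemma Const_1 [simp]: "Const 1 = 1" by (simp add: Const_def)
lemma Const_add: "Const (a + b) = Const a + Const b" by (simp add: Const_def single_add)
lemma Const_mult: "Const (a * b) = Const a * Const b" by (simp add: Const_def mult_single)
lemma Const_of_nat: "Const (of_nat k) = of_nat k"
  by (simp add: Const_def)

lemma Const_sum: "Const (sum f A) = (\<Sum>i\<in>A. Const (f i))"
  by (induction A rule: infinite_finite_induct) (auto simp: Const_add)

lemma lookup_Const_mult: "lookup (Const c * p) m = c * lookup p m"
proof -
  have "Const c * p = Poly_Mapping.map ((*) c) p"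
    by (simp add: Const_def mult_map_scale_conv_mult)
  then show ?thesis by (simp add: map.rep_eq when_def)
qed

lemma qpoly_eq_sum_monoms:
  "p = (\<Sum>m\<in>keys p. Const (lookup p m) * Monom m)"
proof (rule poly_mapping_eqI)
  fix k
  have "(\<Sum>m\<in>keys p. lookup (Const (lookup p m) * Monom m) k)
      = (\<Sum>m\<in>keys p. if m = k then lookup p k else 0)"
    by (rule sum.cong) (auto simp: lookup_Const_mult lookup_single)
  also have "\<dots> = lookup p k"
    by (simp add: in_keys_iff)
  finally show "lookup p k = lookup (\<Sum>m\<in>keys p. Const (lookup p m) * Monom m) k"
    by (simp add: lookup_sum)
qed

lemma Monom_add: "Monom (m + m') = Monom m * Monom m'"
  by (simp add: mult_single)

text \<open>Every polynomial is a sum of scaled monomials, so an additive property need only be checked there.\<close>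

lemma qpoly_induct [case_names monom add]:
  assumes monom: "\<And>c m. P (Const c * Monom m)" and add: "\<And>p q. P p \<Longrightarrow> P q \<Longrightarrow> P (p + q)"
  shows "P p"
proof -
  have z: "P 0" using monom[of 0] by simp
  have "P (\<Sum>m\<in>A. Const (f m) * Monom m)" for A f
    by (induction A rule: infinite_finite_induct) (auto intro: z monom add)
  then show ?thesis by (subst qpoly_eq_sum_monoms)
qed

lemma monom_eq_sum: "m = (\<Sum>v\<in>keys m. single v (lookup m v))"
proof (rule poly_mapping_eqI)
  fix k
  have "(\<Sum>v\<in>keys m. lookup (single v (lookup m v)) k)
      = (\<Sum>v\<in>keys m. if v = k then lookup m k else 0)"
    by (rule sum.cong) (auto simp: lookup_single)
  also have "\<dots> = lookup m k"
    by (simp add: in_keys_iff)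
  finally show "lookup m k = lookup (\<Sum>v\<in>keys m. single v (lookup m v)) k"
    by (simp add: lookup_sum)
qed

lemma Monom_sum: "Monom (sum f A) = (\<Prod>v\<in>A. Monom (f v))"
  by (induction A rule: infinite_finite_induct) (auto simp: Monom_add)

lemma Monom_squarefree:
  assumes "\<And>v. lookup m v \<le> 1"
  shows "Monom m = (\<Prod>v\<in>keys m. Var v)"
proof -
  have "Monom m = (\<Prod>v\<in>keys m. Monom (single v (lookup m v)))"
    by (subst monom_eq_sum[of m]) (simp add: Monom_sum)
  also have "\<dots> = (\<Prod>v\<in>keys m. Var v)"
  proof (rule prod.cong)
    fix v assume "v \<in> keys m"
    then have "lookup m v = 1"
      using assms[of v] by (auto simp: in_keys_iff)
    then show "Monom (single v (lookup m v)) = Var v"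
      by (simp add: Var_def)
  qed simp
  finally show ?thesis .
qed

text \<open>The functions \<^const>\<open>poly_hom\<close> with structure map \<open>c\<close> are ring homomorphisms as soon as \<open>c\<close>
  is one. Only two targets occur: polynomial rings (\<open>c = Const\<close>) and the rationals (\<open>c = id\<close>).\<close>

locale rat_algebra =
  fixes c :: "rat \<Rightarrow> 'a::comm_ring_1"
  assumes c_add: "c (a + b) = c a + c b" and c_mult: "c (a * b) = c a * c b" and c_1 [simp]: "c 1 = 1"
begin

lemma c_0 [simp]: "c 0 = 0"
  using c_add[of 0 0] by simp

definition eval_monom :: "('v \<Rightarrow> 'a) \<Rightarrow> ('v \<Rightarrow>\<^sub>0 nat) \<Rightarrow> 'a" where
  "eval_monom h m = (\<Prod>v\<in>keys m. h v ^ lookup m v)"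

lemma eval_monom_superset:
  assumes "finite A" "keys m \<subseteq> A"
  shows "eval_monom h m = (\<Prod>v\<in>A. h v ^ lookup m v)"
  unfolding eval_monom_def
  by (rule prod.mono_neutral_left) (use assms in \<open>auto simp: in_keys_iff\<close>)

lemma eval_monom_add: "eval_monom h (m + m') = eval_monom h m * eval_monom h m'"
proof -
  let ?A = "keys m \<union> keys m'"
  have "keys (m + m') \<subseteq> ?A" by (rule Poly_Mapping.keys_add)
  then show ?thesis
    by (simp add: eval_monom_superset[where A = ?A] lookup_add prod.distrib power_add)
qed

lemma poly_hom_superset:
  assumes "finite A" "keys p \<subseteq> A"
  shows "poly_hom c h p = (\<Sum>m\<in>A. c (lookup p m) * eval_monom h m)"
  unfolding poly_hom_def eval_monom_def[symmetric]
  by (rule sum.mono_neutral_left) (use assms in \<open>auto simp: in_keys_iff\<close>)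

lemma hom_add: "poly_hom c h (p + q) = poly_hom c h p + poly_hom c h q"
proof -
  let ?A = "keys p \<union> keys q"
  have "keys (p + q) \<subseteq> ?A" by (rule Poly_Mapping.keys_add)
  then show ?thesis
    by (simp add: poly_hom_superset[where A = ?A] lookup_add sum.distrib c_add algebra_simps)
qed

lemma hom_0 [simp]: "poly_hom c h 0 = 0"
  by (simp add: poly_hom_def)

lemma hom_uminus: "poly_hom c h (- p) = - poly_hom c h p"
  using hom_add[of h p "- p"] by (simp add: eq_neg_iff_add_eq_0 add.commute)

lemma hom_diff: "poly_hom c h (p - q) = poly_hom c h p - poly_hom c h q"
  using hom_add[of h p "- q"] by (simp add: hom_uminus)

lemma hom_sum: "poly_hom c h (sum f A) = (\<Sum>i\<in>A. poly_hom c h (f i))"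
  by (induction A rule: infinite_finite_induct) (auto simp: hom_add)

lemma hom_single: "poly_hom c h (single m a) = c a * eval_monom h m"
  using poly_hom_superset[of "{m}" "single m a" h] by simp

lemma hom_Const [simp]: "poly_hom c h (Const a) = c a"
  by (simp add: Const_def hom_single eval_monom_def)

lemma hom_1 [simp]: "poly_hom c h 1 = 1"
  using hom_Const[of h 1] by simp

lemma hom_Var [simp]: "poly_hom c h (Var v) = h v"
  by (simp add: Var_def hom_single eval_monom_def)

lemma hom_mult: "poly_hom c h (p * q) = poly_hom c h p * poly_hom c h q"
proof (induction p rule: qpoly_induct)
  case (monom a m)
  show ?case
  proof (induction q rule: qpoly_induct)
    case (monom b m')
    then show ?case
      by (simp add: Const_def mult_single hom_single eval_monom_add c_mult algebra_simps)
  next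
    case (add p q) then show ?case by (simp only: distrib_left hom_add)
  qed
next
  case (add p q) then show ?case by (simp only: distrib_right hom_add)
qed

lemma hom_prod: "poly_hom c h (prod f A) = (\<Prod>i\<in>A. poly_hom c h (f i))"
  by (induction A rule: infinite_finite_induct) (auto simp: hom_mult)

lemma hom_power: "poly_hom c h (p ^ k) = poly_hom c h p ^ k"
  by (induction k) (auto simp: hom_mult)

lemma hom_Monom: "poly_hom c h (Monom m) = (\<Prod>v\<in>keys m. h v ^ lookup m v)"
  by (simp add: hom_single eval_monom_def)

end

interpretation Const_hom: rat_algebra Const
  by unfold_locales (auto simp: Const_add Const_mult)

interpretation id_hom: rat_algebra id
  by unfold_locales auto

lemma (in rat_algebra) hom_comp:
  "poly_hom c g (poly_hom Const h p) = poly_hom c (\<lambda>v. poly_hom c g (h v)) p"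
proof (induction p rule: qpoly_induct)
  case (monom a m)
  then show ?case
    by (simp add: Const_hom.hom_mult hom_mult Const_hom.hom_Monom hom_Monom hom_prod hom_power)
qed (simp add: Const_hom.hom_add hom_add)

lemma homogeneous_poly_hom:
  assumes "\<And>v. homogeneous 1 (h v)" "homogeneous d p"
  shows "homogeneous d (poly_hom Const h p)"
  unfolding poly_hom_def
proof (rule homogeneous_sum)
  fix m assume m: "m \<in> keys p"
  have "homogeneous (\<Sum>v\<in>A. lookup m v) (\<Prod>v\<in>A. h v ^ lookup m v)" if "finite A" for A
    using that
  proof induction
    case (insert x F)
    then show ?case
      using homogeneous_mult[OF homogeneous_power[OF assms(1), of "lookup m x" x] insert(3)] by simp
  qed simp
  from this[of "keys m"] m assms(2)
  have "homogeneous d (\<Prod>v\<in>keys m. h v ^ lookup m v)"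
    by (simp add: homogeneous_iff monom_deg_def)
  then show "homogeneous d (Const (lookup p m) * (\<Prod>v\<in>keys m. h v ^ lookup m v))"
    by (rule homogeneous_Const_mult)
qed

lemma vars_poly_hom:
  assumes "\<And>v. vars (h v) \<subseteq> V"
  shows "vars (poly_hom Const h p) \<subseteq> V"
  unfolding poly_hom_def
proof (rule vars_sum_subset)
  fix m
  have "vars (\<Prod>v\<in>keys m. h v ^ lookup m v) \<subseteq> V"
    by (rule vars_prod_subset) (rule vars_power_subset, rule assms)
  then show "vars (Const (lookup p m) * (\<Prod>v\<in>keys m. h v ^ lookup m v)) \<subseteq> V"
    using vars_mult[of "Const (lookup p m)"] by fastforce
qed

section \<open>The Cauchy--Binet formula and exterior products\<close>

lemma finite_ext_index [simp]: "finite (ext_index r :: 'n::{finite,linorder} list set)"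
proof (rule finite_subset)
  show "(ext_index r :: 'n list set) \<subseteq> {xs. set xs \<subseteq> UNIV \<and> length xs = r}"
    by (auto simp: ext_index_def)
qed (rule finite_lists_length_eq, simp)

lemma wedge_eq_sum:
  "wedge us S = (\<Sum>p | p permutes {0..<length us}. signof p * (\<Prod>i = 0..<length us. vec_nth (us ! i) (S ! p i)))"
proof -
  have "wedge us S = (\<Sum>p | p permutes {0..<length us}. signof p * (\<Prod>i = 0..<length us.
      Matrix.mat (length us) (length us) (\<lambda>(a, b). vec_nth (us ! a) (S ! b)) $$ (i, p i)))"
    unfolding wedge_def by (rule det_def') simp
  also have "\<dots> = (\<Sum>p | p permutes {0..<length us}. signof p * (\<Prod>i = 0..<length us. vec_nth (us ! i) (S ! p i)))"
    by (intro sum.cong refl arg_cong2[where f = "(*)"] prod.cong)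
      (auto simp: permutes_in_image)
  finally show ?thesis .
qed

definition gram :: "(rat ^ 'n) list \<Rightarrow> (rat ^ 'n) list \<Rightarrow> rat mat" where
  "gram us ws = Matrix.mat (length us) (length us) (\<lambda>(a, b). pairing (us ! a) (ws ! b))"

lemma gram_carrier [simp]: "gram us ws \<in> carrier_mat (length us) (length us)"
  by (simp add: gram_def)

lemma wedge_eq_det_columns:
  "wedge us S = det (Matrix.mat (length us) (length us) (\<lambda>(a, b). vec_nth (us ! b) (S ! a)))"
proof -
  let ?A = "Matrix.mat (length us) (length us) (\<lambda>(a, b). vec_nth (us ! a) (S ! b))"
  have "det (Matrix.mat (length us) (length us) (\<lambda>(a, b). vec_nth (us ! b) (S ! a))) = det (transpose_mat ?A)"
    by (rule arg_cong[where f = det]) (auto intro!: eq_matI)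
  also have "\<dots> = wedge us S"
    unfolding wedge_def by (rule det_transpose[of _ "length us"]) simp
  finally show ?thesis ..
qed

text \<open>Permuting the columns of the minor permutes the rows of its transpose.\<close>

lemma wedge_permuted:
  assumes "p permutes {0..<length us}" "length S = length us"
  shows "wedge us (map (\<lambda>i. S ! p i) [0..<length us]) = signof p * wedge us S"
proof -
  let ?r = "length us"
  let ?A = "Matrix.mat ?r ?r (\<lambda>(a, b). vec_nth (us ! b) (S ! a))"
  have "wedge us (map (\<lambda>i. S ! p i) [0..<?r]) = det (Matrix.mat ?r ?r (\<lambda>(i, j). ?A $$ (p i, j)))"
    unfolding wedge_eq_det_columns
    using assms(1) by (intro arg_cong[where f = det]) (auto intro!: eq_matI simp: permutes_in_image)
  also have "\<dots> = signof p * det ?A"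
    by (rule det_permute_rows) (use assms in auto)
  finally show ?thesis by (simp add: wedge_eq_det_columns)
qed

lemma wedge_repeated_index:
  assumes "\<not> distinct S" "length S = length us"
  shows "wedge us S = 0"
proof -
  let ?r = "length us"
  let ?A = "Matrix.mat ?r ?r (\<lambda>(a, b). vec_nth (us ! b) (S ! a))"
  have "wedge us S = det ?A" by (rule wedge_eq_det_columns)
  moreover obtain i j where "i < ?r" "j < ?r" "i \<noteq> j" "S ! i = S ! j"
    using assms by (auto simp: distinct_conv_nth)
  then have "det ?A = 0"
    by (intro det_identical_rows[of ?A ?r i j]) (auto intro!: eq_vecI)
  ultimately show ?thesis by simp
qed

text \<open>Sorting a list of distinct indices records it as a strictly increasing list together with a
  permutation; this is how the sum over all lists in the Leibniz formula for a Gram determinant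
  collapses to the sum over the standard basis of the exterior power.\<close>

lemma bij_betw_sorted_times_permutes:
  fixes r :: nat
  shows "bij_betw (\<lambda>(S, p). map (\<lambda>i. S ! p i) [0..<r])
    ((ext_index r :: 'n::{finite,linorder} list set) \<times> {p. p permutes {0..<r}})
    {L. length L = r \<and> distinct L}"
proof (rule bij_betwI')
  fix x y :: "'n list \<times> (nat \<Rightarrow> nat)"
  assume x: "x \<in> ext_index r \<times> {p. p permutes {0..<r}}" and y: "y \<in> ext_index r \<times> {p. p permutes {0..<r}}"
  obtain S p where xe: "x = (S, p)" by force
  obtain T q where ye: "y = (T, q)" by force
  from x y xe ye have S: "length S = r" "sorted_wrt (<) S" "p permutes {0..<r}"
    and T: "length T = r" "sorted_wrt (<) T" "q permutes {0..<r}"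
    by (auto simp: ext_index_def)
  have set: "set (map (\<lambda>i. U ! \<sigma> i) [0..<r]) = set U" if "length U = r" "\<sigma> permutes {0..<r}" for U :: "'n list" and \<sigma>
  proof -
    have "set (map (\<lambda>i. U ! \<sigma> i) [0..<r]) = (\<lambda>i. U ! i) ` (\<sigma> ` {0..<r})" by auto
    also have "\<dots> = set U" using that by (auto simp: permutes_image set_conv_nth)
    finally show ?thesis .
  qed
  show "((case x of (S, p) \<Rightarrow> map (\<lambda>i. S ! p i) [0..<r]) = (case y of (S, p) \<Rightarrow> map (\<lambda>i. S ! p i) [0..<r])) = (x = y)"
  proof
    assume "(case x of (S, p) \<Rightarrow> map (\<lambda>i. S ! p i) [0..<r]) = (case y of (S, p) \<Rightarrow> map (\<lambda>i. S ! p i) [0..<r])"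
    then have eq: "map (\<lambda>i. S ! p i) [0..<r] = map (\<lambda>i. T ! q i) [0..<r]" by (simp add: xe ye)
    then have "set S = set T" using set[of S p] set[of T q] S T by simp
    then have ST: "S = T" using S(2) T(2) by (simp add: strict_sorted_equal)
    have "p = q"
    proof
      fix i
      show "p i = q i"
      proof (cases "i < r")
        case True
        have "map (\<lambda>i. S ! p i) [0..<r] ! i = map (\<lambda>i. T ! q i) [0..<r] ! i" by (simp only: eq)
        then have "S ! p i = S ! q i" using True ST by simp
        moreover have "p i < r" "q i < r"
          using True permutes_in_image[OF S(3), of i] permutes_in_image[OF T(3), of i] by simp_all
        moreover have "distinct S" using S(2) by (simp add: strict_sorted_iff)
        ultimately show ?thesis using S(1) by (simp add: nth_eq_iff_index_eq)
      next
        case False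
        then show ?thesis using S(3) T(3) by (simp add: permutes_def)
      qed
    qed
    with ST show "x = y" by (simp add: xe ye)
  qed auto
next
  fix x :: "'n list \<times> (nat \<Rightarrow> nat)"
  assume x: "x \<in> ext_index r \<times> {p. p permutes {0..<r}}"
  obtain S p where xe: "x = (S, p)" by force
  from x xe have S: "length S = r" "sorted_wrt (<) S" "p permutes {0..<r}"
    by (auto simp: ext_index_def)
  have "distinct S" using S(2) by (simp add: strict_sorted_iff)
  moreover have "p i < r" if "i < r" for i
    using that permutes_in_image[OF S(3), of i] by simp
  ultimately have "inj_on (\<lambda>i. S ! p i) {0..<r}"
    using S(1) permutes_inj[OF S(3)] by (auto simp: inj_on_def nth_eq_iff_index_eq)
  then show "(case x of (S, p) \<Rightarrow> map (\<lambda>i. S ! p i) [0..<r]) \<in> {L. length L = r \<and> distinct L}"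
    by (simp add: xe distinct_map)
next
  fix L :: "'n list" assume "L \<in> {L. length L = r \<and> distinct L}"
  then have L: "length L = r" "distinct L" by auto
  define S where "S = sorted_list_of_set (set L)"
  have S: "sorted_wrt (<) S" "set S = set L" "length S = r"
    using L by (auto simp: S_def distinct_card)
  have dS: "distinct S" by (simp add: S_def)
  define p where "p = (\<lambda>i. if i < r then (THE j. j < r \<and> S ! j = L ! i) else i)"
  have pi: "p i < r \<and> S ! p i = L ! i" if "i < r" for i
  proof -
    have "L ! i \<in> set S" using that L S by auto
    then obtain j where "j < r" "S ! j = L ! i" using S(3) by (auto simp: in_set_conv_nth)
    moreover have "j' = j" if "j' < r" "S ! j' = L ! i" for j'
      using that \<open>j < r\<close> \<open>S ! j = L ! i\<close> S(3) nth_eq_iff_index_eq[OF dS, of j' j] by simp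
    ultimately have "\<exists>!j. j < r \<and> S ! j = L ! i" by blast
    from theI'[OF this] show ?thesis using that by (simp add: p_def)
  qed
  have "inj_on p {0..<r}"
  proof (rule inj_onI)
    fix i j assume ij: "i \<in> {0..<r}" "j \<in> {0..<r}" "p i = p j"
    then have "L ! i = L ! j" using pi[of i] pi[of j] by auto
    then show "i = j" using ij L by (simp add: nth_eq_iff_index_eq)
  qed
  moreover have "p ` {0..<r} \<subseteq> {0..<r}" using pi by auto
  ultimately have "bij_betw p {0..<r} {0..<r}"
    by (simp add: bij_betw_def endo_inj_surj)
  then have "p permutes {0..<r}"
    by (rule bij_imp_permutes) (auto simp: p_def)
  moreover have "map (\<lambda>i. S ! p i) [0..<r] = L"
    using L pi by (auto intro!: nth_equalityI)
  ultimately show "\<exists>x\<in>ext_index r \<times> {p. p permutes {0..<r}}. L = (case x of (S, p) \<Rightarrow> map (\<lambda>i. S ! p i) [0..<r])"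
    using S by (intro bexI[of _ "(S, p)"]) (auto simp: ext_index_def)
qed

lemma sum_over_lists_prod:
  fixes f :: "nat \<Rightarrow> 'n::finite \<Rightarrow> 'a::comm_ring_1"
  shows "(\<Prod>i<r. \<Sum>a\<in>UNIV. f i a) = (\<Sum>L | length L = r. \<Prod>i<r. f i (L ! i))"
proof (induction r)
  case 0 then show ?case by simp
next
  case (Suc r)
  have bij: "bij_betw (\<lambda>(L, a). L @ [a]) ({L :: 'n list. length L = r} \<times> UNIV) {L. length L = Suc r}"
    by (rule bij_betwI[where g = "\<lambda>L. (butlast L, last L)"]) (auto simp: length_Suc_conv_rev)
  have "(\<Sum>L :: 'n list | length L = Suc r. \<Prod>i<Suc r. f i (L ! i))
      = (\<Sum>(L, a)\<in>{L :: 'n list. length L = r} \<times> UNIV. \<Prod>i<Suc r. f i ((L @ [a]) ! i))"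
    by (subst sum.reindex_bij_betw[OF bij, symmetric]) (simp add: case_prod_beta)
  also have "\<dots> = (\<Sum>(L, a)\<in>{L :: 'n list. length L = r} \<times> UNIV. (\<Prod>i<r. f i (L ! i)) * f r a)"
    by (intro sum.cong refl) (auto simp: nth_append intro!: prod.cong)
  also have "\<dots> = (\<Sum>L :: 'n list | length L = r. \<Prod>i<r. f i (L ! i)) * (\<Sum>a\<in>UNIV. f r a)"
    by (simp add: sum.cartesian_product[symmetric] sum_product)
  finally show ?case using Suc by simp
qed

text \<open>Expand every entry of the Gram matrix as a sum over coordinates. This turns the determinant into
  a sum, over all lists \<open>L\<close> of coordinates, of the \<open>L\<close>-minor of \<open>us\<close> times a product of entries of
  \<open>ws\<close>. Lists with a repetition contribute zero, and the lists that are permutations of one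
  increasing list \<open>S\<close> add up to the product of the two \<open>S\<close>-minors.\<close>

theorem cauchy_binet:
  fixes us ws :: "(rat ^ 'n::{finite,linorder}) list"
  assumes "length us = length ws"
  shows "(\<Sum>S\<in>ext_index (length us). wedge us S * wedge ws S) = det (gram us ws)"
proof -
  let ?r = "length us"
  let ?P = "{p. p permutes {0..<?r}}"
  let ?g = "\<lambda>L. (\<Prod>i<?r. vec_nth (ws ! i) (L ! i)) * wedge us L"
  have "det (gram us ws) = det (transpose_mat (gram us ws))"
    by (simp add: det_transpose[OF gram_carrier])
  also have "\<dots> = (\<Sum>p\<in>?P. signof p * (\<Prod>i = 0..<?r. transpose_mat (gram us ws) $$ (i, p i)))"
    by (rule det_def') simp
  also have "\<dots> = (\<Sum>p\<in>?P. signof p * (\<Prod>i = 0..<?r. pairing (us ! p i) (ws ! i)))"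
    by (intro sum.cong refl arg_cong2[where f = "(*)"] prod.cong)
      (auto simp: permutes_in_image gram_def)
  also have "\<dots> = (\<Sum>p\<in>?P. signof p * (\<Sum>L | length L = ?r. \<Prod>i<?r. vec_nth (us ! p i) (L ! i) * vec_nth (ws ! i) (L ! i)))"
    unfolding pairing_def lessThan_atLeast0[symmetric] by (subst sum_over_lists_prod) simp
  also have "\<dots> = (\<Sum>L :: 'n list | length L = ?r. \<Sum>p\<in>?P. signof p * (\<Prod>i<?r. vec_nth (us ! p i) (L ! i) * vec_nth (ws ! i) (L ! i)))"
    by (simp add: sum_distrib_left) (rule sum.swap)
  also have "\<dots> = (\<Sum>L :: 'n list | length L = ?r. ?g L)"
  proof (rule sum.cong[OF refl])
    fix L :: "'n list" assume "L \<in> {L. length L = ?r}"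
    let ?A = "Matrix.mat ?r ?r (\<lambda>(a, b). vec_nth (us ! a) (L ! b))"
    have "wedge us L = det (transpose_mat ?A)" unfolding wedge_def by (subst det_transpose[of ?A ?r]) simp_all
    also have "\<dots> = (\<Sum>p\<in>?P. signof p * (\<Prod>i = 0..<?r. transpose_mat ?A $$ (i, p i)))"
      by (rule det_def') simp
    also have "\<dots> = (\<Sum>p\<in>?P. signof p * (\<Prod>i<?r. vec_nth (us ! p i) (L ! i)))"
      unfolding lessThan_atLeast0
      by (intro sum.cong refl arg_cong2[where f = "(*)"] prod.cong) (auto simp: permutes_in_image)
    finally show "(\<Sum>p\<in>?P. signof p * (\<Prod>i<?r. vec_nth (us ! p i) (L ! i) * vec_nth (ws ! i) (L ! i))) = ?g L"
      by (simp add: prod.distrib sum_distrib_left mult_ac)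
  qed
  also have "\<dots> = (\<Sum>L :: 'n list | length L = ?r \<and> distinct L. ?g L)"
  proof (rule sum.mono_neutral_right)
    show "finite {L :: 'n list. length L = ?r}"
      using finite_lists_length_eq[of "UNIV :: 'n set" ?r] by simp
  qed (auto simp: wedge_repeated_index)
  also have "\<dots> = (\<Sum>(S, p)\<in>ext_index ?r \<times> ?P. ?g (map (\<lambda>i. S ! p i) [0..<?r]))"
    by (subst sum.reindex_bij_betw[OF bij_betw_sorted_times_permutes, symmetric]) (simp add: case_prod_beta)
  also have "\<dots> = (\<Sum>S\<in>ext_index ?r. \<Sum>p\<in>?P. (\<Prod>i<?r. vec_nth (ws ! i) (S ! p i)) * (signof p * wedge us S))"
    unfolding sum.cartesian_product[symmetric]
    by (intro sum.cong refl) (auto simp: wedge_permuted ext_index_def)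
  also have "\<dots> = (\<Sum>S\<in>ext_index ?r. wedge us S * wedge ws S)"
    by (intro sum.cong refl)
      (simp add: wedge_eq_sum[of ws] assms[symmetric] sum_distrib_left lessThan_atLeast0 mult_ac)
  finally show ?thesis ..
qed

lemma wedge_add_hd: "wedge ((u + v) # us) S = wedge (u # us) S + wedge (v # us) S"
  unfolding wedge_eq_sum
  by (simp add: sum.distrib[symmetric] prod.atLeast0_lessThan_Suc_shift distrib_left distrib_right del: prod.op_ivl_Suc)

lemma wedge_scale_hd: "wedge ((c *s u) # us) S = c * wedge (u # us) S"
  unfolding wedge_eq_sum
  by (simp add: sum_distrib_left prod.atLeast0_lessThan_Suc_shift mult_ac del: prod.op_ivl_Suc)

lemma wedge_zero_hd: "wedge (0 # us) S = 0"
  using wedge_scale_hd[of 0 0 us S] by simp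

lemma wedge_repeated_hd:
  assumes "u \<in> set us"
  shows "wedge (u # us) S = 0"
proof -
  obtain j where j: "j < length us" "us ! j = u" using assms by (auto simp: in_set_conv_nth)
  show ?thesis unfolding wedge_def
    by (rule det_identical_rows[where i = 0 and j = "Suc j"]) (use j in \<open>auto intro!: eq_vecI\<close>)
qed

lemma wedge_hd_in_span:
  assumes "u \<in> vec.span (set us)"
  shows "wedge (u # us) S = 0"
  using assms
proof (induction rule: vec.span_induct_alt)
  case base then show ?case by (rule wedge_zero_hd)
next
  case (step c x y)
  then show ?case by (simp add: wedge_add_hd wedge_scale_hd wedge_repeated_hd)
qed

section \<open>The pairing, independence and Gram determinants\<close>

lemma pairing_add_left: "pairing (u + v) w = pairing u w + pairing v w"
  by (simp add: pairing_def distrib_right sum.distrib)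
lemma pairing_add_right: "pairing w (u + v) = pairing w u + pairing w v"
  by (simp add: pairing_def distrib_left sum.distrib)
lemma pairing_scale_left: "pairing (c *s u) w = c * pairing u w"
  by (simp add: pairing_def sum_distrib_left mult_ac)
lemma pairing_scale_right: "pairing w (c *s u) = c * pairing w u"
  by (simp add: pairing_def sum_distrib_left mult_ac)
lemma pairing_zero_left [simp]: "pairing 0 w = 0" by (simp add: pairing_def)
lemma pairing_zero_right [simp]: "pairing w 0 = 0" by (simp add: pairing_def)
lemma pairing_sum_left: "pairing (\<Sum>i\<in>A. f i) w = (\<Sum>i\<in>A. pairing (f i) w)"
  by (induction A rule: infinite_finite_induct) (auto simp: pairing_add_left)
lemma pairing_sum_right: "pairing w (\<Sum>i\<in>A. f i) = (\<Sum>i\<in>A. pairing w (f i))"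
  by (induction A rule: infinite_finite_induct) (auto simp: pairing_add_right)
lemma pairing_self_eq_0_iff: "pairing u u = 0 \<longleftrightarrow> (u :: rat ^ 'n) = 0"
proof
  assume "pairing u u = 0"
  then have "(\<Sum>a\<in>UNIV. vec_nth u a * vec_nth u a) = 0" by (simp add: pairing_def)
  then have "\<forall>a\<in>UNIV. vec_nth u a * vec_nth u a = 0"
    by (subst (asm) sum_nonneg_eq_0_iff) auto
  then show "u = 0" by (simp add: cart_eq_iff)
qed simp

lemma independent_image_iff:
  fixes f :: "'i \<Rightarrow> rat ^ 'n"
  assumes "finite A" "inj_on f A"
  shows "vec.independent (f ` A) \<longleftrightarrow> (\<forall>c. (\<Sum>i\<in>A. c i *s f i) = 0 \<longrightarrow> (\<forall>i\<in>A. c i = 0))"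
proof
  assume ind: "vec.independent (f ` A)"
  show "\<forall>c. (\<Sum>i\<in>A. c i *s f i) = 0 \<longrightarrow> (\<forall>i\<in>A. c i = 0)"
  proof (intro allI impI ballI)
    fix c i assume c: "(\<Sum>i\<in>A. c i *s f i) = 0" and i: "i \<in> A"
    define g where "g = (\<lambda>v. c (the_inv_into A f v))"
    have g: "g (f j) = c j" if "j \<in> A" for j using that by (simp add: g_def the_inv_into_f_f[OF assms(2)])
    have "(\<Sum>v\<in>f ` A. g v *s v) = (\<Sum>i\<in>A. c i *s f i)"
      by (subst sum.reindex[OF assms(2)]) (simp add: g)
    then have z: "(\<Sum>v\<in>f ` A. g v *s v) = 0" using c by simp
    have "\<forall>v\<in>f ` A. g v = 0"
      using spec[OF mp[OF mp[OF spec[OF ind[unfolded vec.independent_explicit_finite_subsets], of "f ` A"]]], of g]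
        z assms(1) by simp
    then show "c i = 0" using i g by auto
  qed
next
  assume c: "\<forall>c. (\<Sum>i\<in>A. c i *s f i) = 0 \<longrightarrow> (\<forall>i\<in>A. c i = 0)"
  show "vec.independent (f ` A)"
  proof (subst vec.independent_explicit_finite_subsets, intro allI impI ballI)
    fix S g v assume S: "S \<subseteq> f ` A" "finite S" "(\<Sum>v\<in>S. g v *s v) = 0" "v \<in> S"
    define h where "h = (\<lambda>i. if f i \<in> S then g (f i) else 0)"
    have "(\<Sum>i\<in>A. h i *s f i) = (\<Sum>v\<in>f ` A. (if v \<in> S then g v else 0) *s v)"
      by (subst sum.reindex[OF assms(2)]) (simp add: h_def)
    also have "\<dots> = (\<Sum>v\<in>S. (if v \<in> S then g v else 0) *s v)"
      by (rule sum.mono_neutral_right) (use S assms in auto)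
    also have "\<dots> = 0" using S(3) by simp
    finally have "\<forall>i\<in>A. h i = 0" using c by blast
    moreover obtain i where "i \<in> A" "v = f i" using S by blast
    ultimately show "g v = 0" using S(4) by (force simp: h_def)
  qed
qed

text \<open>A repetition is itself a nontrivial relation, so for lists distinctness and independence
  together are the absence of relations between the entries.\<close>

lemma independent_list_iff:
  fixes ws :: "(rat ^ 'n) list"
  shows "distinct ws \<and> vec.independent (set ws) \<longleftrightarrow>
    (\<forall>f. (\<Sum>b<length ws. f b *s ws ! b) = 0 \<longrightarrow> (\<forall>b<length ws. f b = 0))" (is "_ \<longleftrightarrow> ?nz")
proof -
  have im: "(!) ws ` {..<length ws} = set ws" by (auto simp: set_conv_nth)
  have iff: "vec.independent (set ws) \<longleftrightarrow> ?nz" if "distinct ws"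
    using independent_image_iff[of "{..<length ws}" "(!) ws"] that unfolding im by (simp add: inj_on_nth Ball_def)
  have "distinct ws" if nz: ?nz
  proof (rule ccontr)
    assume "\<not> distinct ws"
    then obtain i j where ij: "i < length ws" "j < length ws" "i \<noteq> j" "ws ! i = ws ! j"
      by (auto simp: distinct_conv_nth)
    let ?f = "\<lambda>b. if b = i then 1 else if b = j then -1 else (0::rat)"
    have "(\<Sum>b<length ws. ?f b *s ws ! b) = (\<Sum>b\<in>{i, j}. ?f b *s ws ! b)"
      by (rule sum.mono_neutral_right) (use ij in auto)
    also have "\<dots> = 0" using ij by (simp add: cart_eq_iff)
    finally show False using spec[OF nz, of ?f] ij by auto
  qed
  with iff show ?thesis by blast
qed

text \<open>A vector in the span of \<open>ws\<close> that is orthogonal to all of \<open>us\<close> is a kernel vector of the Gram matrix.\<close>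

lemma det_gram_eq_0:
  assumes "length us = length ws" "f b0 \<noteq> 0" "b0 < length ws"
    and "\<And>u. u \<in> set us \<Longrightarrow> pairing u (\<Sum>b<length ws. f b *s ws ! b) = 0"
  shows "det (gram us ws) = 0"
proof -
  let ?r = "length us"
  let ?v = "Matrix.vec ?r f"
  have "?v \<noteq> 0\<^sub>v ?r" using assms by (auto simp: Matrix.vec_eq_iff)
  moreover have "gram us ws *\<^sub>v ?v = 0\<^sub>v ?r"
  proof (rule eq_vecI)
    fix i assume i: "i < dim_vec (0\<^sub>v ?r :: rat Matrix.vec)"
    then have "vec_index (gram us ws *\<^sub>v ?v) i = (\<Sum>b = 0..<?r. pairing (us ! i) (ws ! b) * f b)"
      by (simp add: gram_def scalar_prod_def)
    also have "\<dots> = pairing (us ! i) (\<Sum>b<length ws. f b *s ws ! b)"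
      by (simp add: pairing_sum_right pairing_scale_right assms(1) lessThan_atLeast0 mult.commute)
    also have "\<dots> = 0" using i assms(4)[of "us ! i"] by simp
    finally show "vec_index (gram us ws *\<^sub>v ?v) i = vec_index (0\<^sub>v ?r) i" using i by simp
  qed (simp add: gram_def)
  ultimately show ?thesis
    using det_0_iff_vec_prod_zero_field[OF gram_carrier, of us ws] vec_carrier[of ?r f] by blast
qed

text \<open>The standard pairing is positive definite over the rationals: a kernel vector of the Gram
  matrix of \<open>ws\<close> gives a vector in the span of \<open>ws\<close> that is orthogonal to itself.\<close>

lemma det_gram_self_nonzero:
  fixes ws :: "(rat ^ 'n) list"
  assumes "distinct ws" "vec.independent (set ws)"
  shows "det (gram ws ws) \<noteq> 0"
proof
  let ?r = "length ws"
  assume "det (gram ws ws) = 0"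
  then obtain v where v: "v \<in> carrier_vec ?r" "v \<noteq> 0\<^sub>v ?r" "gram ws ws *\<^sub>v v = 0\<^sub>v ?r"
    using det_0_iff_vec_prod_zero_field[OF gram_carrier, of ws ws] by auto
  let ?x = "\<Sum>b<?r. vec_index v b *s ws ! b"
  have p: "pairing (ws ! i) ?x = 0" if "i < ?r" for i
  proof -
    have "pairing (ws ! i) ?x = (\<Sum>b = 0..<?r. pairing (ws ! i) (ws ! b) * vec_index v b)"
      by (simp add: pairing_sum_right pairing_scale_right lessThan_atLeast0 mult.commute)
    also have "\<dots> = vec_index (gram ws ws *\<^sub>v v) i" using that v(1) by (simp add: gram_def scalar_prod_def)
    finally show ?thesis using v(3) that by simp
  qed
  have "pairing ?x ?x = (\<Sum>b<?r. vec_index v b * pairing (ws ! b) ?x)"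
    by (subst pairing_sum_left) (simp add: pairing_scale_left)
  also have "\<dots> = 0" using p by simp
  finally have "?x = 0" by (simp add: pairing_self_eq_0_iff)
  then have "vec_index v b = 0" if "b < ?r" for b
    using assms that independent_list_iff[of ws] by blast
  then have "v = 0\<^sub>v ?r" using v(1) by (intro eq_vecI) auto
  with v(2) show False by simp
qed

lemma wedge_nonzero_imp_independent:
  fixes ws :: "(rat ^ 'n::{finite,linorder}) list"
  assumes "wedge ws S \<noteq> 0"
  shows "distinct ws \<and> vec.independent (set ws)"
proof -
  let ?r = "length ws"
  let ?A = "Matrix.mat ?r ?r (\<lambda>(a, b). vec_nth (ws ! b) (S ! a))"
  have A: "?A \<in> carrier_mat ?r ?r" by simp
  have nz: "f b = 0" if "(\<Sum>b<?r. f b *s ws ! b) = 0" "b < ?r" for f b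
  proof (rule ccontr)
    assume "f b \<noteq> 0"
    then have "Matrix.vec ?r f \<noteq> 0\<^sub>v ?r" using that(2) by (auto simp: Matrix.vec_eq_iff)
    moreover have "?A *\<^sub>v Matrix.vec ?r f = 0\<^sub>v ?r"
    proof (rule eq_vecI)
      fix i assume i: "i < dim_vec (0\<^sub>v ?r :: rat Matrix.vec)"
      then have "vec_index (?A *\<^sub>v Matrix.vec ?r f) i = (\<Sum>b = 0..<?r. vec_nth (ws ! b) (S ! i) * f b)"
        by (simp add: scalar_prod_def)
      also have "\<dots> = vec_nth (\<Sum>b<?r. f b *s ws ! b) (S ! i)"
        by (simp add: sum_component lessThan_atLeast0 mult.commute)
      finally show "vec_index (?A *\<^sub>v Matrix.vec ?r f) i = vec_index (0\<^sub>v ?r) i" using i that(1) by simp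
    qed simp
    ultimately have "det ?A = 0" using det_0_iff_vec_prod_zero_field[OF A] vec_carrier[of ?r f] by blast
    then show False using assms by (simp add: wedge_eq_det_columns)
  qed
  then show ?thesis unfolding independent_list_iff by blast
qed

lemma independent_imp_wedge_nonzero:
  fixes ws :: "(rat ^ 'n::{finite,linorder}) list"
  assumes "distinct ws" "vec.independent (set ws)"
  obtains S where "S \<in> ext_index (length ws)" "wedge ws S \<noteq> 0"
proof -
  have "(\<Sum>S\<in>ext_index (length ws). wedge ws S * wedge ws S) \<noteq> 0"
    using det_gram_self_nonzero[OF assms] by (simp add: cauchy_binet)
  then obtain S where "S \<in> ext_index (length ws)" "wedge ws S * wedge ws S \<noteq> 0"
    by (meson sum.neutral)
  with that show ?thesis by auto
qed

section \<open>The vanishing ideal of the Grassmannian\<close>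

text \<open>The linear form on the exterior power of \<open>N\<close> defined by \<open>us\<close>, evaluated at the point with
  coordinates \<open>w\<close>.\<close>

definition wedge_pair :: "nat \<Rightarrow> (rat ^ 'n::{finite,linorder}) list \<Rightarrow> ('n list \<Rightarrow> rat) \<Rightarrow> rat" where
  "wedge_pair r us w = (\<Sum>S\<in>ext_index r. wedge us S * w S)"

lemma eval_wedge_form: "poly_hom id w (wedge_form us) = wedge_pair (length us) us w"
  by (simp add: wedge_form_def id_hom.hom_sum id_hom.hom_mult wedge_pair_def)

lemma vanishes_iff_frames:
  "vanishes_on_grassmannian r P \<longleftrightarrow>
    (\<forall>ws c. length ws = r \<and> distinct ws \<and> vec.independent (set ws) \<longrightarrow> poly_hom id (\<lambda>S. c * wedge ws S) P = 0)"
proof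
  assume v: "vanishes_on_grassmannian r P"
  show "\<forall>ws c. length ws = r \<and> distinct ws \<and> vec.independent (set ws) \<longrightarrow> poly_hom id (\<lambda>S. c * wedge ws S) P = 0"
  proof (intro allI impI)
    fix ws :: "(rat ^ 'a::{finite,linorder}) list" and c
    assume a: "length ws = r \<and> distinct ws \<and> vec.independent (set ws)"
    then have "vec.span (set ws) \<in> grassmannian r"
      by (simp add: grassmannian_def vec.dim_eq_card_independent distinct_card)
    moreover have "(\<lambda>S. c * wedge ws S) \<in> plucker (vec.span (set ws))"
      using a by (auto simp: plucker_def)
    ultimately show "poly_hom id (\<lambda>S. c * wedge ws S) P = 0"
      using v by (simp add: vanishes_on_grassmannian_def)
  qed
next
  assume v: "\<forall>ws c. length ws = r \<and> distinct ws \<and> vec.independent (set ws) \<longrightarrow> poly_hom id (\<lambda>S. c * wedge ws S) P = 0"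
  show "vanishes_on_grassmannian r P"
    unfolding vanishes_on_grassmannian_def
  proof (intro ballI)
    fix W :: "(rat ^ 'a::{finite,linorder}) set" and w assume W: "W \<in> grassmannian r" and w: "w \<in> plucker W"
    from w obtain c ws where ws: "distinct ws" "vec.independent (set ws)" "vec.span (set ws) = W"
      and [simp]: "w = (\<lambda>S. c * wedge ws S)"
      by (auto simp: plucker_def)
    have "length ws = r"
      using W ws by (auto simp: grassmannian_def vec.dim_eq_card_independent distinct_card)
    then show "poly_hom id w P = 0" using v ws by simp
  qed
qed

lemma eval_scale_homogeneous:
  assumes "homogeneous d P"
  shows "poly_hom id (\<lambda>S. c * w S) P = c ^ d * poly_hom id w P"
  unfolding poly_hom_def sum_distrib_left
proof (rule sum.cong[OF refl])
  fix m assume "m \<in> keys P"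
  then have "(\<Sum>v\<in>keys m. lookup m v) = d"
    using assms by (simp add: homogeneous_def)
  then show "id (lookup P m) * (\<Prod>v\<in>keys m. (c * w v) ^ lookup m v) =
      c ^ d * (id (lookup P m) * (\<Prod>v\<in>keys m. w v ^ lookup m v))"
    by (simp add: power_mult_distrib prod.distrib flip: power_sum)
qed

text \<open>Evaluated at the plane spanned by \<open>us\<close> itself, the form is the Gram determinant of \<open>us\<close>.\<close>

lemma wedge_form_not_vanishing:
  assumes "distinct us" "vec.independent (set us)"
  shows "\<not> vanishes_on_grassmannian (length us) (wedge_form us)"
proof
  assume "vanishes_on_grassmannian (length us) (wedge_form us)"
  then have "poly_hom id (\<lambda>S. 1 * wedge us S) (wedge_form us) = 0"
    using assms unfolding vanishes_iff_frames by blast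
  then have "det (gram us us) = 0"
    by (simp add: eval_wedge_form wedge_pair_def cauchy_binet)
  with det_gram_self_nonzero[OF assms] show False by simp
qed

text \<open>Two planes are joined by a line of frames. Restricting a form to it gives a polynomial in one
  variable, which has only finitely many roots unless it is zero.\<close>

lemma poly_along_line:
  fixes ws vs :: "(rat ^ 'n::{finite,linorder}) list"
  assumes "length ws = r" "length vs = r"
  shows "\<exists>f. \<forall>t. poly_hom id (wedge (map (\<lambda>a. (1 - t) *s ws ! a + t *s vs ! a) [0..<r])) P = poly f t"
proof -
  define line where "line = (\<lambda>t. map (\<lambda>a. (1 - t) *s ws ! a + t *s vs ! a) [0..<r])"
  have "\<exists>g. \<forall>t. wedge (line t) S = poly g t" for S
  proof -
    define g where "g = (\<Sum>p | p permutes {0..<r}. [:signof p:] * (\<Prod>i = 0..<r.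
       [:vec_nth (ws ! i) (S ! p i), vec_nth (vs ! i) (S ! p i) - vec_nth (ws ! i) (S ! p i):]))"
    have "wedge (line t) S = poly g t" for t
      unfolding wedge_eq_sum g_def
      by (simp add: line_def poly_sum poly_prod algebra_simps)
    then show ?thesis by blast
  qed
  then obtain g where g: "\<And>S t. wedge (line t) S = poly (g S) t" by metis
  have "\<exists>f. \<forall>t. poly_hom id (wedge (line t)) P = poly f t"
  proof (induction P rule: qpoly_induct)
    case (monom c m)
    have "poly_hom id (wedge (line t)) (Const c * Monom m) =
        poly ([:c:] * (\<Prod>v\<in>keys m. g v ^ lookup m v)) t" for t
      by (simp add: id_hom.hom_mult id_hom.hom_Monom poly_prod poly_power g)
    then show ?case by blast
  next
    case (add p q)
    then obtain f f' where "\<forall>t. poly_hom id (wedge (line t)) p = poly f t" "\<forall>t. poly_hom id (wedge (line t)) q = poly f' t"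
      by blast
    then have "\<forall>t. poly_hom id (wedge (line t)) (p + q) = poly (f + f') t"
      by (simp add: id_hom.hom_add)
    then show ?case by blast
  qed
  then show ?thesis by (simp add: line_def)
qed

text \<open>If neither form vanishes identically, join a plane where the first does not vanish to one where
  the second does not. On the line of frames between them both forms are nonzero polynomials in
  the parameter, so some parameter avoids the roots of both.\<close>

theorem vanishing_ideal_prime:
  fixes P Q :: "'n::{finite,linorder} list qpoly"
  assumes "homogeneous d P" "homogeneous e Q"
    and "\<not> vanishes_on_grassmannian r P" "\<not> vanishes_on_grassmannian r Q"
  shows "\<not> vanishes_on_grassmannian r (P * Q)"
proof -
  have frame: "\<exists>ws. length ws = r \<and> distinct ws \<and> vec.independent (set ws) \<and> poly_hom id (wedge ws) R \<noteq> 0"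
    if "homogeneous d' R" "\<not> vanishes_on_grassmannian r R" for d' and R :: "'n list qpoly"
    using that(2) by (auto simp: vanishes_iff_frames eval_scale_homogeneous[OF that(1)])
  obtain ws where ws: "length ws = r" "distinct ws" "vec.independent (set ws)" "poly_hom id (wedge ws) P \<noteq> 0"
    using frame[OF assms(1,3)] by blast
  obtain vs where vs: "length vs = r" "distinct vs" "vec.independent (set vs)" "poly_hom id (wedge vs) Q \<noteq> 0"
    using frame[OF assms(2,4)] by blast
  obtain S where S: "wedge ws S \<noteq> 0"
    using independent_imp_wedge_nonzero[OF ws(2,3)] by blast
  define line where "line = (\<lambda>t. map (\<lambda>a. (1 - t) *s ws ! a + t *s vs ! a) [0..<r])"
  have line0: "line 0 = ws" using ws(1) by (auto simp: line_def intro!: nth_equalityI)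
  have line1: "line 1 = vs" using vs(1) by (auto simp: line_def intro!: nth_equalityI)
  obtain f where f: "\<And>t. poly_hom id (wedge (line t)) P = poly f t"
    using poly_along_line[OF ws(1) vs(1), of P] unfolding line_def by blast
  obtain g where g: "\<And>t. poly_hom id (wedge (line t)) Q = poly g t"
    using poly_along_line[OF ws(1) vs(1), of Q] unfolding line_def by blast
  \<comment> \<open>A third polynomial keeps one Pluecker coordinate nonzero, so that the frame stays independent.\<close>
  obtain h where h: "\<And>t. wedge (line t) S = poly h t"
    using poly_along_line[OF ws(1) vs(1), of "Var S"] unfolding line_def by auto
  have "f \<noteq> 0" using f[of 0] ws(4) line0 by auto
  moreover have "g \<noteq> 0" using g[of 1] vs(4) line1 by auto
  moreover have "h \<noteq> 0" using h[of 0] S line0 by auto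
  ultimately have "f * g * h \<noteq> 0" by simp
  then have "finite {t. poly (f * g * h) t = 0}" by (rule poly_roots_finite)
  then obtain t where t: "poly (f * g * h) t \<noteq> 0"
    using infinite_UNIV_char_0[where 'a = rat] by (metis (mono_tags, lifting) UNIV_I ex_new_if_finite mem_Collect_eq)
  have "wedge (line t) S \<noteq> 0" using t h by simp
  then have "distinct (line t) \<and> vec.independent (set (line t))"
    by (rule wedge_nonzero_imp_independent)
  moreover have "length (line t) = r" by (simp add: line_def)
  moreover have "poly_hom id (\<lambda>S. 1 * wedge (line t) S) (P * Q) \<noteq> 0"
    using t f g by (simp add: id_hom.hom_mult)
  ultimately show ?thesis unfolding vanishes_iff_frames by blast
qed

section \<open>Complete simplicial fans\<close>

text \<open>The sum \<open>a + b\<close> is the midpoint of \<open>2a\<close> and \<open>2b\<close>, and faces of cones are cones.\<close>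

lemma face_of_cone_summand:
  assumes "F face_of C" "convex_cone C" "a \<in> C" "b \<in> C" "a + b \<in> F"
  shows "a \<in> F"
proof -
  have conic: "conic F"
    using face_of_conic[OF _ assms(1)] assms(2) by (simp add: convex_cone_def)
  have "2 *\<^sub>R a \<in> F"
  proof (cases "a = b")
    case True
    then show ?thesis using assms(5) by (simp add: scaleR_2)
  next
    case False
    have "a + b \<in> open_segment (2 *\<^sub>R a) (2 *\<^sub>R b)"
      unfolding in_segment using False by (auto intro!: exI[of _ "1/2"])
    moreover have "2 *\<^sub>R a \<in> C" "2 *\<^sub>R b \<in> C"
      using assms(2-4) by (auto intro: convex_cone_scaleR)
    ultimately show ?thesis using assms(1,5) unfolding face_of_def by blast
  qed
  from conicD[OF conic this, of "1/2"] show ?thesis by simp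
qed

lemma convex_cone_hull_sum:
  assumes "\<And>b. b \<in> A \<Longrightarrow> f b \<in> convex_cone hull B"
  shows "(\<Sum>b\<in>A. f b) \<in> convex_cone hull B"
  using assms
  by (induction A rule: infinite_finite_induct) (auto simp: convex_cone_hull_contains_0 intro: convex_cone_hull_add)

text \<open>In a simplicial cone, faces are cut out by the vanishing of some of the coordinates with respect
  to the generators.\<close>

lemma in_simplicial_face_iff:
  fixes B :: "'a::real_vector set"
  assumes "independent B" "finite B" "C \<subseteq> B"
  shows "x \<in> convex_cone hull C \<longleftrightarrow>
    x \<in> span B \<and> (\<forall>b\<in>B. 0 \<le> representation B x b) \<and> (\<forall>b\<in>B - C. representation B x b = 0)"
proof
  let ?S = "{x \<in> span B. (\<forall>b\<in>B. 0 \<le> representation B x b) \<and> (\<forall>b\<in>B - C. representation B x b = 0)}"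
  have "C \<subseteq> ?S"
    using assms by (auto simp: representation_basis intro: span_base)
  moreover have "convex_cone ?S"
    unfolding convex_cone_iff using assms(1)
    by (auto simp: span_zero span_add span_scale representation_zero representation_add representation_scale)
  ultimately have "convex_cone hull C \<subseteq> ?S" by (rule hull_minimal)
  then show "x \<in> convex_cone hull C \<Longrightarrow> x \<in> span B \<and> (\<forall>b\<in>B. 0 \<le> representation B x b) \<and> (\<forall>b\<in>B - C. representation B x b = 0)"
    by blast
next
  assume x: "x \<in> span B \<and> (\<forall>b\<in>B. 0 \<le> representation B x b) \<and> (\<forall>b\<in>B - C. representation B x b = 0)"
  have "x = (\<Sum>b\<in>B. representation B x b *\<^sub>R b)"
    using sum_representation_eq[of B x B] assms x by simp
  also have "\<dots> = (\<Sum>b\<in>C. representation B x b *\<^sub>R b)"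
    by (rule sum.mono_neutral_right) (use assms x in auto)
  also have "\<dots> \<in> convex_cone hull C"
  proof (rule convex_cone_hull_sum)
    fix b assume "b \<in> C"
    then show "representation B x b *\<^sub>R b \<in> convex_cone hull C"
      using x assms(3) by (auto intro: convex_cone_hull_mul hull_inc)
  qed
  finally show "x \<in> convex_cone hull C" .
qed

lemma simplicial_face:
  fixes B :: "'a::real_vector set"
  assumes "independent B" "finite B" "C \<subseteq> B"
  shows "(convex_cone hull C) face_of (convex_cone hull B)"
  unfolding face_of_def
proof (intro conjI ballI impI)
  show "convex_cone hull C \<subseteq> convex_cone hull B" by (rule hull_mono) fact
  show "convex (convex_cone hull C)" by (rule convex_convex_cone_hull)
  fix a b x assume ab: "a \<in> convex_cone hull B" "b \<in> convex_cone hull B"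
    and x: "x \<in> convex_cone hull C" "x \<in> open_segment a b"
  obtain u where u: "0 < u" "u < 1" "x = (1 - u) *\<^sub>R a + u *\<^sub>R b"
    using x(2) by (auto simp: in_segment)
  note iff = in_simplicial_face_iff[OF assms(1,2)]
  have a: "a \<in> span B" "\<forall>i\<in>B. 0 \<le> representation B a i" and b: "b \<in> span B" "\<forall>i\<in>B. 0 \<le> representation B b i"
    using ab iff[of B] by auto
  have "representation B a i = 0 \<and> representation B b i = 0" if "i \<in> B - C" for i
  proof -
    have "representation B x i = 0" using x(1) iff[OF assms(3)] that by auto
    moreover have "representation B x i = (1 - u) * representation B a i + u * representation B b i"
      using a(1) b(1) assms(1) u(3) by (simp add: representation_add representation_scale span_scale)
    moreover have "0 \<le> representation B a i" "0 \<le> representation B b i" using a b that by auto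
    ultimately show ?thesis using u(1,2)
      by (metis add_nonneg_eq_0_iff diff_gt_0_iff_gt less_eq_real_def mult_eq_0_iff mult_nonneg_nonneg order_less_irrefl)
  qed
  then show "a \<in> convex_cone hull C" "b \<in> convex_cone hull C"
    using iff[OF assms(3)] a b by auto
qed

lemma span_convex_cone_hull: "span (convex_cone hull B) = span (B :: 'a::real_vector set)"
proof
  have "convex_cone hull B \<subseteq> span B"
    by (rule hull_minimal) (auto simp: span_superset convex_cone_span)
  then show "span (convex_cone hull B) \<subseteq> span B"
    by (metis span_mono span_span)
  show "span B \<subseteq> span (convex_cone hull B)"
    by (rule span_mono) (rule hull_subset)
qed

lemma dim_convex_cone_hull: "dim (convex_cone hull B) = dim (B :: 'a::euclidean_space set)"
  by (metis dim_span span_convex_cone_hull)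

lemma in_ray_iff: "x \<in> convex_cone hull {b} \<longleftrightarrow> (\<exists>t\<ge>0. x = t *\<^sub>R (b :: 'a::real_vector))"
proof
  have "convex_cone hull {b} \<subseteq> {x. \<exists>t\<ge>0. x = t *\<^sub>R b}"
  proof (rule hull_minimal)
    show "convex_cone {x. \<exists>t\<ge>0. x = t *\<^sub>R b}"
      unfolding convex_cone_iff
    proof (intro conjI ballI allI impI)
      fix x y assume "x \<in> {x. \<exists>t\<ge>0. x = t *\<^sub>R b}" "y \<in> {x. \<exists>t\<ge>0. x = t *\<^sub>R b}"
      then obtain s t where "s \<ge> 0" "t \<ge> 0" "x = s *\<^sub>R b" "y = t *\<^sub>R b" by auto
      then show "x + y \<in> {x. \<exists>t\<ge>0. x = t *\<^sub>R b}" by (auto intro!: exI[of _ "s + t"] simp: scaleR_add_left)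
    next
      fix x and c :: real assume "x \<in> {x. \<exists>t\<ge>0. x = t *\<^sub>R b}" "0 \<le> c"
      then obtain s where "s \<ge> 0" "x = s *\<^sub>R b" by auto
      then show "c *\<^sub>R x \<in> {x. \<exists>t\<ge>0. x = t *\<^sub>R b}"
        using \<open>0 \<le> c\<close> by (auto intro!: exI[of _ "c * s"])
    qed (auto intro: exI[of _ 0])
  qed (auto intro!: exI[of _ 1])
  then show "x \<in> convex_cone hull {b} \<Longrightarrow> \<exists>t\<ge>0. x = t *\<^sub>R b" by blast
qed (auto intro: convex_cone_hull_mul hull_inc)

lemma ray_scale:
  assumes "t > 0"
  shows "convex_cone hull {t *\<^sub>R b} = convex_cone hull {b :: 'a::real_vector}"
proof (intro equalityI hull_minimal convex_cone_convex_cone_hull)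
  show "{t *\<^sub>R b} \<subseteq> convex_cone hull {b}" using assms unfolding in_ray_iff by (auto intro: convex_cone_hull_mul hull_inc)
  show "{b} \<subseteq> convex_cone hull {t *\<^sub>R b}" unfolding insert_subset in_ray_iff using assms by (auto intro!: exI[of _ "1 / t"])
qed

lemma primitive_vector_exists:
  fixes s :: "'n::finite lvec"
  assumes "s \<noteq> 0"
  obtains v :: "'n lvec" and g :: int where "g > 0" "s = g *s v" "Gcd (range (vec_nth v)) = 1"
proof -
  define g where "g = Gcd (range (vec_nth s))"
  obtain a where a: "vec_nth s a \<noteq> 0" using assms by (auto simp: cart_eq_iff)
  have dvd: "g dvd vec_nth s b" for b unfolding g_def by (rule Gcd_dvd) simp
  have "g \<noteq> 0" using dvd[of a] a by auto
  moreover have "g \<ge> 0" by (simp add: g_def)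
  ultimately have g: "g > 0" by simp
  define v :: "'n lvec" where "v = (\<chi> b. vec_nth s b div g)"
  have sv: "s = g *s v" using dvd by (simp add: v_def cart_eq_iff)
  have eq: "range (vec_nth s) = (*) g ` range (vec_nth v)" by (subst sv) auto
  have "g = Gcd (range (vec_nth s))" by (rule g_def)
  also have "\<dots> = Gcd ((*) g ` range (vec_nth v))" by (rule arg_cong[OF eq])
  also have "\<dots> = normalize (g * Gcd (range (vec_nth v)))" by (rule Gcd_mult)
  finally have "g = g * Gcd (range (vec_nth v))"
    using g by (simp add: abs_mult)
  then have "Gcd (range (vec_nth v)) = 1" using g by simp
  with g sv that show ?thesis by blast
qed

lemma vec_of_nth [simp]: "vec_nth (vec_of v) a = of_int (vec_nth v a)"
  by (simp add: vec_of_def)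

lemma vec_of_eq_0_iff [simp]: "(vec_of v :: 'a::ring_char_0 ^ 'n::finite) = 0 \<longleftrightarrow> v = 0"
  by (simp add: cart_eq_iff)

text \<open>Two integral vectors on a ray are proportional; comparing the gcd of their coordinates shows that
  primitive ones agree. This makes the description in the definition of \<^const>\<open>prim_vec\<close> denote.\<close>

lemma primitive_vector_unique:
  fixes v w :: "'n::finite lvec" and b :: "real ^ 'n"
  assumes "b \<noteq> 0" and v: "vec_of v \<in> convex_cone hull {b}" "Gcd (range (vec_nth v)) = 1"
    and w: "vec_of w \<in> convex_cone hull {b}" "Gcd (range (vec_nth w)) = 1"
  shows "v = w"
proof -
  have nz: "x \<noteq> 0" if "Gcd (range (vec_nth x)) = 1" for x :: "'n lvec"
  proof
    assume "x = 0"
    then have "range (vec_nth x) = {0}" by auto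
    with that show False by simp
  qed
  obtain t1 where t1: "t1 \<ge> 0" "vec_of v = t1 *\<^sub>R b" using v(1) by (auto simp: in_ray_iff)
  obtain t2 where t2: "t2 \<ge> 0" "vec_of w = t2 *\<^sub>R b" using w(1) by (auto simp: in_ray_iff)
  have "t1 \<noteq> 0"
  proof
    assume "t1 = 0"
    then have "vec_of v = (0 :: real ^ 'n)" using t1 by simp
    with nz[OF v(2)] show False by simp
  qed
  have "t2 \<noteq> 0"
  proof
    assume "t2 = 0"
    then have "vec_of w = (0 :: real ^ 'n)" using t2 by simp
    with nz[OF w(2)] show False by simp
  qed
  obtain a where a: "vec_nth b a \<noteq> 0" using assms(1) by (auto simp: cart_eq_iff)
  have vc: "real_of_int (vec_nth v c) = t1 * vec_nth b c" for c
    using arg_cong[OF t1(2), of "\<lambda>x. vec_nth x c"] by simp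
  have wc: "real_of_int (vec_nth w c) = t2 * vec_nth b c" for c
    using arg_cong[OF t2(2), of "\<lambda>x. vec_nth x c"] by simp
  have cross: "vec_nth w a * vec_nth v c = vec_nth v a * vec_nth w c" for c
  proof -
    have "real_of_int (vec_nth w a * vec_nth v c) = real_of_int (vec_nth v a * vec_nth w c)"
      by (simp add: vc wc)
    then show ?thesis by linarith
  qed
  have "(\<lambda>c. vec_nth w a * vec_nth v c) = (\<lambda>c. vec_nth v a * vec_nth w c)"
    using cross by (rule ext)
  then have "(*) (vec_nth w a) ` range (vec_nth v) = (*) (vec_nth v a) ` range (vec_nth w)"
    unfolding image_image by (rule arg_cong)
  then have "Gcd ((*) (vec_nth w a) ` range (vec_nth v)) = Gcd ((*) (vec_nth v a) ` range (vec_nth w))" by simp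
  then have abs: "\<bar>vec_nth w a\<bar> = \<bar>vec_nth v a\<bar>" using v(2) w(2) by (simp add: Gcd_mult)
  have "real_of_int (vec_nth w a) * real_of_int (vec_nth v a) = (t1 * t2) * (vec_nth b a)\<^sup>2"
    by (simp add: vc wc power2_eq_square)
  also have "\<dots> > 0" using t1 t2 \<open>t1 \<noteq> 0\<close> \<open>t2 \<noteq> 0\<close> a by simp
  finally have "vec_nth w a * vec_nth v a > 0" by (metis of_int_0_less_iff of_int_mult)
  with abs have "vec_nth w a = vec_nth v a" by (auto simp: abs_if zero_less_mult_iff split: if_splits)
  moreover have "vec_nth v a \<noteq> 0" using \<open>vec_nth w a * vec_nth v a > 0\<close> by auto
  ultimately have "vec_nth v c = vec_nth w c" for c using cross[of c] by simp
  then show ?thesis by (simp add: cart_eq_iff)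
qed

text \<open>The facts about the fan that are used later are collected here: simplices are closed
  under subsets (\<open>simplices_subset\<close>), their primitive generators are independent (\<open>simplexD\<close>),
  every simplex lies in a full one (\<open>simplex_in_full_simplex\<close>), and at a wall there is exactly one
  full cone on each side (\<open>wall_neighbour_exists\<close>, \<open>wall_neighbour_unique\<close>).\<close>

locale complete_simplicial_fan =
  fixes \<Delta> :: "'n::finite cone set"
  assumes simplicial: "simplicial_fan \<Delta>" and complete: "complete_fan \<Delta>"
begin

lemma fan: "fan \<Delta>" using complete by (simp add: complete_fan_def)
lemma finite_fan: "finite \<Delta>" using fan by (simp add: fan_def)
lemma fan_face: "\<sigma> \<in> \<Delta> \<Longrightarrow> \<tau> face_of \<sigma> \<Longrightarrow> \<tau> \<noteq> {} \<Longrightarrow> \<tau> \<in> \<Delta>"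
  using fan unfolding fan_def by blast
lemma fan_Int: "\<sigma> \<in> \<Delta> \<Longrightarrow> \<tau> \<in> \<Delta> \<Longrightarrow> (\<sigma> \<inter> \<tau>) face_of \<sigma> \<and> (\<sigma> \<inter> \<tau>) face_of \<tau>"
  using fan unfolding fan_def by blast

lemma fan_cone:
  assumes "\<sigma> \<in> \<Delta>" obtains B where "independent B" "finite B" "\<sigma> = convex_cone hull B"
  using assms simplicial unfolding simplicial_fan_def by (metis independent_bound_general)

lemma fan_closed: "\<sigma> \<in> \<Delta> \<Longrightarrow> closed \<sigma>"
  by (metis fan_cone closed_convex_cone_hull)

lemma fan_convex_cone: "\<sigma> \<in> \<Delta> \<Longrightarrow> convex_cone \<sigma>"
  by (metis fan_cone convex_cone_convex_cone_hull)

lemma ray_generator: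
  assumes "\<rho> \<in> rays \<Delta>"
  obtains b where "b \<noteq> 0" "\<rho> = convex_cone hull {b}"
proof -
  have \<rho>: "\<rho> \<in> \<Delta>" "dim \<rho> = 1" using assms by (auto simp: rays_def)
  obtain B where B: "independent B" "finite B" "\<rho> = convex_cone hull B" using fan_cone[OF \<rho>(1)] .
  then have "card B = 1" using \<rho>(2) by (simp add: dim_convex_cone_hull dim_eq_card_independent)
  then obtain b where "B = {b}" by (auto simp: card_1_singleton_iff)
  with B that show ?thesis by auto
qed

definition gen :: "'n cone \<Rightarrow> real ^ 'n" where
  "gen \<rho> = vec_of (prim_vec \<rho>)"

lemma ray_gen:
  assumes "\<rho> \<in> rays \<Delta>"
  shows "gen \<rho> \<noteq> 0" "\<rho> = convex_cone hull {gen \<rho>}"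
proof -
  obtain b where b: "b \<noteq> 0" "\<rho> = convex_cone hull {b}" using ray_generator[OF assms] .
  have "rational_cone \<rho>" using assms fan by (simp add: rays_def fan_def)
  then obtain S :: "'n lvec set" where S: "finite S" "\<rho> = convex_cone hull (vec_of ` S)"
    by (auto simp: rational_cone_def)
  have "\<exists>s\<in>S. s \<noteq> 0"
  proof (rule ccontr)
    assume "\<not> (\<exists>s\<in>S. s \<noteq> 0)"
    then have "vec_of ` S \<subseteq> {0 :: real ^ 'n}" by auto
    then have "\<rho> \<subseteq> {0}" unfolding S(2) by (rule hull_minimal) simp
    moreover have "b \<in> \<rho>" unfolding b(2) by (simp add: hull_inc)
    ultimately show False using b(1) by auto
  qed
  then obtain s where s: "s \<in> S" "s \<noteq> 0" by blast
  obtain v g where v: "g > 0" "s = g *s v" "Gcd (range (vec_nth v)) = 1"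
    using primitive_vector_exists[OF s(2)] .
  have "vec_of s \<in> \<rho>" unfolding S(2) using s(1) by (simp add: hull_inc)
  then have "(1 / real_of_int g) *\<^sub>R vec_of s \<in> \<rho>" unfolding b(2) using v(1) by (intro convex_cone_hull_mul) auto
  moreover have "(1 / real_of_int g) *\<^sub>R vec_of s = (vec_of v :: real ^ 'n)"
    using v(1) by (simp add: v(2) cart_eq_iff)
  ultimately have vr: "vec_of v \<in> \<rho>" by simp
  have "\<exists>!v. vec_of v \<in> \<rho> \<and> Gcd (range (vec_nth v)) = 1"
    using vr v(3) primitive_vector_unique[OF b(1)] b(2) by (intro ex1I[of _ v]) auto
  from theI'[OF this] have p: "vec_of (prim_vec \<rho>) \<in> \<rho>" "Gcd (range (vec_nth (prim_vec \<rho>))) = 1"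
    by (auto simp: prim_vec_def)
  have "prim_vec \<rho> \<noteq> 0"
  proof
    assume "prim_vec \<rho> = 0"
    then have "range (vec_nth (prim_vec \<rho>)) = {0}" by auto
    with p(2) show False by simp
  qed
  then show nz: "gen \<rho> \<noteq> 0" by (simp add: gen_def)
  obtain t where "t \<ge> 0" "gen \<rho> = t *\<^sub>R b" using p(1) b(2) by (auto simp: gen_def in_ray_iff)
  with nz have "t > 0" by (cases "t = 0") auto
  then show "\<rho> = convex_cone hull {gen \<rho>}" using \<open>gen \<rho> = t *\<^sub>R b\<close> b(2) ray_scale by metis
qed

lemma ray_in_fan: "\<rho> \<in> rays \<Delta> \<Longrightarrow> \<rho> \<in> \<Delta>" by (simp add: rays_def)

lemma finite_rays: "finite (rays \<Delta>)"
  using finite_fan by (simp add: rays_def)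

text \<open>A ray that is a face of \<open>\<sigma>\<close> is generated by some \<open>c = \<Sum> c\<^sub>b b\<close> with nonnegative coefficients;
  a summand with \<open>c\<^sub>b > 0\<close> must again lie in the ray, so the ray is the one through \<open>b\<close>.\<close>

lemma rays_of_cone:
  assumes "\<sigma> \<in> \<Delta>" "independent B" "finite B" "\<sigma> = convex_cone hull B"
  shows "{\<rho>\<in>rays \<Delta>. \<rho> face_of \<sigma>} = (\<lambda>b. convex_cone hull {b}) ` B"
proof (intro equalityI subsetI)
  fix \<rho> assume "\<rho> \<in> (\<lambda>b. convex_cone hull {b}) ` B"
  then obtain b where b: "b \<in> B" "\<rho> = convex_cone hull {b}" by auto
  have f: "\<rho> face_of \<sigma>" unfolding b assms(4) by (rule simplicial_face) (use assms b in auto)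
  have "\<rho> \<noteq> {}" unfolding b by (rule convex_cone_hull_nonempty)
  with f have "\<rho> \<in> \<Delta>" using fan_face assms(1) by blast
  moreover have "b \<noteq> 0" using assms(2) b(1) dependent_zero by blast
  then have "dim \<rho> = 1" unfolding b(2) dim_convex_cone_hull
    by (simp add: dim_eq_card_independent)
  ultimately show "\<rho> \<in> {\<rho>\<in>rays \<Delta>. \<rho> face_of \<sigma>}" using f by (simp add: rays_def)
next
  fix \<rho> assume "\<rho> \<in> {\<rho>\<in>rays \<Delta>. \<rho> face_of \<sigma>}"
  then have \<rho>: "\<rho> \<in> rays \<Delta>" "\<rho> face_of \<sigma>" by auto
  obtain c where c: "c \<noteq> 0" "\<rho> = convex_cone hull {c}" using ray_generator[OF \<rho>(1)] .
  have "c \<in> \<rho>" unfolding c(2) by (simp add: hull_inc)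
  then have "c \<in> convex_cone hull B" using face_of_imp_subset[OF \<rho>(2)] assms(4) by auto
  then have cr: "c \<in> span B" "\<forall>b\<in>B. 0 \<le> representation B c b"
    using in_simplicial_face_iff[OF assms(2,3), of B c] by auto
  have csum: "c = (\<Sum>b\<in>B. representation B c b *\<^sub>R b)"
    using sum_representation_eq[of B c B] assms cr by simp
  have "\<exists>b\<in>B. representation B c b \<noteq> 0"
  proof (rule ccontr)
    assume "\<not> (\<exists>b\<in>B. representation B c b \<noteq> 0)"
    then have "c = 0" using csum by simp
    with c(1) show False by simp
  qed
  then obtain b where b: "b \<in> B" "representation B c b \<noteq> 0" by auto
  let ?r = "representation B c b"
  have in_hull: "representation B c b' *\<^sub>R b' \<in> \<sigma>" if "b' \<in> B" for b'
    unfolding assms(4) using that cr(2) by (auto intro: convex_cone_hull_mul hull_inc)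
  have "c = ?r *\<^sub>R b + (\<Sum>b\<in>B - {b}. representation B c b *\<^sub>R b)"
    by (subst csum) (rule sum.remove[OF assms(3) b(1)])
  then have "?r *\<^sub>R b + (\<Sum>b\<in>B - {b}. representation B c b *\<^sub>R b) \<in> \<rho>" using \<open>c \<in> \<rho>\<close> by simp
  moreover have "(\<Sum>b\<in>B - {b}. representation B c b *\<^sub>R b) \<in> \<sigma>"
    unfolding assms(4) by (rule convex_cone_hull_sum) (use in_hull assms(4) in auto)
  ultimately have "?r *\<^sub>R b \<in> \<rho>"
    using face_of_cone_summand[OF \<rho>(2) fan_convex_cone[OF assms(1)] in_hull[OF b(1)]] by blast
  then obtain t where t: "t \<ge> 0" "?r *\<^sub>R b = t *\<^sub>R c" using c(2) by (auto simp: in_ray_iff)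
  have "b \<noteq> 0" using assms(2) b(1) dependent_zero by blast
  then have "t > 0" using t b(2) by (cases "t = 0") auto
  moreover have "?r > 0" using b cr(2) by force
  ultimately have "convex_cone hull {b} = convex_cone hull {c}"
    using t(2) by (metis ray_scale)
  then show "\<rho> \<in> (\<lambda>b. convex_cone hull {b}) ` B" using b(1) c(2) by auto
qed

text \<open>The cone is given by some independent generators; the primitive generators of its rays are
  positive multiples of these.\<close>

lemma cone_rays:
  assumes "\<sigma> \<in> \<Delta>" and J: "J = {\<rho>\<in>rays \<Delta>. \<rho> face_of \<sigma>}"
  shows "finite J" "inj_on gen J" "independent (gen ` J)" "\<sigma> = convex_cone hull (gen ` J)"
proof -
  obtain B where B: "independent B" "finite B" "\<sigma> = convex_cone hull B" using fan_cone[OF assms(1)] .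
  have JB: "J = (\<lambda>b. convex_cone hull {b}) ` B" using rays_of_cone[OF assms(1) B] J by simp
  let ?f = "\<lambda>b. gen (convex_cone hull {b})"
  have f: "\<exists>t>0. ?f b = t *\<^sub>R b" if "b \<in> B" for b
  proof -
    have r: "convex_cone hull {b} \<in> rays \<Delta>" using JB J that by auto
    have "?f b \<in> convex_cone hull {b}" using ray_gen(2)[OF r] by (metis hull_inc singletonI)
    then obtain t where t: "t \<ge> 0" "?f b = t *\<^sub>R b" by (auto simp: in_ray_iff)
    with ray_gen(1)[OF r] have "t > 0" by (cases "t = 0") auto
    with t show ?thesis by auto
  qed
  have gJ: "gen ` J = ?f ` B" unfolding JB by auto
  show fin: "finite J" using B JB by simp
  have "B \<subseteq> span (gen ` J)"
  proof
    fix b assume b: "b \<in> B"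
    then obtain t where t: "t > 0" "?f b = t *\<^sub>R b" using f by blast
    have "?f b \<in> span (gen ` J)" unfolding gJ using b by (intro span_base) auto
    then have "(1/t) *\<^sub>R ?f b \<in> span (gen ` J)" by (rule span_scale)
    then show "b \<in> span (gen ` J)" using t by simp
  qed
  moreover have "gen ` J \<subseteq> span B"
  proof
    fix x assume "x \<in> gen ` J"
    then obtain b where "b \<in> B" "x = ?f b" unfolding gJ by blast
    with f obtain t where "x = t *\<^sub>R b" by blast
    with \<open>b \<in> B\<close> show "x \<in> span B" by (simp add: span_base span_scale)
  qed
  ultimately have sp: "span (gen ` J) = span B" by (simp add: span_eq)
  have dB: "dim (span B) = card B" using B by (simp add: dim_eq_card_independent)
  have c1: "card (gen ` J) \<le> card B" unfolding gJ using B(2) by (rule card_image_le)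
  show ind: "independent (gen ` J)"
    by (rule card_le_dim_spanning[of _ "span B"]) (use sp dB c1 fin span_superset[of "gen ` J"] in auto)
  have "card B \<le> card (gen ` J)"
    using dim_eq_card_independent[OF ind] dB sp by (metis dim_span order_refl)
  then have "inj_on ?f B" using c1 gJ B(2) by (intro eq_card_imp_inj_on) auto
  then show "inj_on gen J" unfolding JB by (auto simp: inj_on_def)
  show "\<sigma> = convex_cone hull (gen ` J)"
  proof (rule equalityI)
    show "\<sigma> \<subseteq> convex_cone hull (gen ` J)" unfolding B(3)
    proof (rule hull_minimal)
      show "B \<subseteq> convex_cone hull (gen ` J)"
      proof
        fix b assume b: "b \<in> B"
        then obtain t where t: "t > 0" "?f b = t *\<^sub>R b" using f by blast
        have "?f b \<in> convex_cone hull (gen ` J)" unfolding gJ using b by (intro hull_inc) auto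
        then have "(1/t) *\<^sub>R ?f b \<in> convex_cone hull (gen ` J)" using t(1) by (intro convex_cone_hull_mul) auto
        then show "b \<in> convex_cone hull (gen ` J)" using t by simp
      qed
    qed (rule convex_cone_convex_cone_hull)
    show "convex_cone hull (gen ` J) \<subseteq> \<sigma>" unfolding B(3)
    proof (rule hull_minimal)
      show "gen ` J \<subseteq> convex_cone hull B"
      proof
        fix x assume "x \<in> gen ` J"
        then obtain b where b: "b \<in> B" "x = ?f b" unfolding gJ by blast
        with f obtain t where "t > 0" "x = t *\<^sub>R b" by blast
        moreover have "t *\<^sub>R b \<in> convex_cone hull B"
          using b(1) \<open>t > 0\<close> by (intro convex_cone_hull_mul hull_inc) auto
        ultimately show "x \<in> convex_cone hull B" by simp
      qed
    qed (rule convex_cone_convex_cone_hull)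
  qed
qed

lemma simplexD:
  assumes "J \<in> simplices \<Delta>"
  shows "finite J" "J \<subseteq> rays \<Delta>" "inj_on gen J" "independent (gen ` J)"
    "convex_cone hull (gen ` J) \<in> \<Delta>" "{\<rho>\<in>rays \<Delta>. \<rho> face_of convex_cone hull (gen ` J)} = J"
proof -
  obtain \<sigma> where \<sigma>: "\<sigma> \<in> \<Delta>" and J: "J = {\<rho>\<in>rays \<Delta>. \<rho> face_of \<sigma>}"
    using assms by (auto simp: simplices_def)
  note c = cone_rays[OF \<sigma> J]
  show "finite J" "inj_on gen J" "independent (gen ` J)" by (fact c)+
  show "J \<subseteq> rays \<Delta>" unfolding J by blast
  show "convex_cone hull (gen ` J) \<in> \<Delta>" "{\<rho>\<in>rays \<Delta>. \<rho> face_of convex_cone hull (gen ` J)} = J"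
    unfolding c(4)[symmetric] using \<sigma> J by blast+
qed

lemma simplices_subset:
  assumes "J \<in> simplices \<Delta>" "K \<subseteq> J"
  shows "K \<in> simplices \<Delta>"
proof -
  note J = simplexD[OF assms(1)]
  have ind: "independent (gen ` K)" using J(4) assms(2) by (meson image_mono independent_mono)
  have fin: "finite (gen ` K)" using J(1) assms(2) finite_subset by blast
  have "(convex_cone hull (gen ` K)) face_of (convex_cone hull (gen ` J))"
    by (rule simplicial_face) (use J assms(2) in auto)
  then have inD: "convex_cone hull (gen ` K) \<in> \<Delta>"
    using fan_face J(5) convex_cone_hull_nonempty by blast
  have "{\<rho>\<in>rays \<Delta>. \<rho> face_of convex_cone hull (gen ` K)} = (\<lambda>b. convex_cone hull {b}) ` (gen ` K)"
    by (rule rays_of_cone[OF inD ind fin refl])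
  also have "\<dots> = K"
  proof -
    have "convex_cone hull {gen \<rho>} = \<rho>" if "\<rho> \<in> K" for \<rho>
      using ray_gen(2)[of \<rho>] that assms(2) J(2) by auto
    then show ?thesis by (simp add: image_image)
  qed
  finally show ?thesis using inD unfolding simplices_def by blast
qed

lemma finite_simplices: "finite (simplices \<Delta>)"
proof -
  have "simplices \<Delta> \<subseteq> Pow (rays \<Delta>)" using simplexD(2) by blast
  then show ?thesis using finite_rays finite_subset by blast
qed

text \<open>A generator in \<open>\<tau>\<close> puts the whole ray into \<open>\<tau>\<close>, and the intersection of two cones of a fan is
  a face of both.\<close>

lemma ray_face_of:
  assumes "\<rho> \<in> rays \<Delta>" "\<tau> \<in> \<Delta>" "gen \<rho> \<in> \<tau>"
  shows "\<rho> face_of \<tau>"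
proof -
  have "convex_cone hull {gen \<rho>} \<subseteq> \<tau>"
    by (rule hull_minimal) (use assms fan_convex_cone in auto)
  then have "\<rho> \<inter> \<tau> = \<rho>" using ray_gen(2)[OF assms(1)] by auto
  then show ?thesis using fan_Int[OF ray_in_fan[OF assms(1)] assms(2)] by simp
qed

text \<open>Choose the direction \<open>q\<close> outside the finitely many proper subspaces spanned by cones that are not
  full dimensional. Since finitely many cones cover everything, one of them contains \<open>p + q/m\<close>
  for infinitely many \<open>m\<close>; it is closed, so it contains \<open>p\<close>, and its span contains \<open>q\<close>.\<close>

lemma full_cone_in_direction:
  assumes "open U" "U \<noteq> {}"
  obtains q t \<tau> where "q \<in> U" "t > 0" "\<tau> \<in> \<Delta>" "p \<in> \<tau>" "p + t *\<^sub>R q \<in> \<tau>" "span \<tau> = UNIV"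
proof -
  define L where "L = (\<Union>\<tau>\<in>{\<tau>\<in>\<Delta>. dim \<tau> < DIM(real ^ 'n)}. span \<tau>)"
  have "negligible L" unfolding L_def
    by (rule negligible_Union) (use finite_fan in \<open>auto intro!: negligible_lowdim\<close>)
  then have "\<not> U \<subseteq> L" using assms open_not_negligible negligible_subset by blast
  then obtain q where q: "q \<in> U" "q \<notin> L" by blast
  have "\<forall>m::nat. \<exists>\<tau>\<in>\<Delta>. p + (1 / (real m + 1)) *\<^sub>R q \<in> \<tau>"
    using complete unfolding complete_fan_def by blast
  then have "\<forall>m\<in>UNIV. \<exists>\<tau>\<in>\<Delta>. p + (1 / (real m + 1)) *\<^sub>R q \<in> \<tau>" by simp
  from pigeonhole_infinite_rel[OF infinite_UNIV_nat finite_fan this]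
  obtain \<tau> where \<tau>: "\<tau> \<in> \<Delta>" "infinite {m\<in>UNIV. p + (1 / (real m + 1)) *\<^sub>R q \<in> \<tau>}" by auto
  have "p \<in> closure \<tau>"
    unfolding closure_approachable
  proof (intro allI impI)
    fix e :: real assume e: "e > 0"
    obtain N :: nat where N: "norm q / e < real N" using reals_Archimedean2 by blast
    obtain m where m: "m > N" "p + (1 / (real m + 1)) *\<^sub>R q \<in> \<tau>"
      using \<tau>(2) unfolding infinite_nat_iff_unbounded by auto
    have "norm q / e < real m + 1" using N m(1) by linarith
    then have "norm q < e * (real m + 1)" using e by (simp add: pos_divide_less_eq mult.commute)
    then have "dist (p + (1 / (real m + 1)) *\<^sub>R q) p < e"
      by (simp add: dist_norm pos_divide_less_eq)
    with m(2) show "\<exists>y\<in>\<tau>. dist y p < e" by blast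
  qed
  then have p: "p \<in> \<tau>" using fan_closed[OF \<tau>(1)] by simp
  obtain m where m: "p + (1 / (real m + 1)) *\<^sub>R q \<in> \<tau>" using \<tau>(2) not_finite_existsD by blast
  let ?t = "1 / (real m + 1)"
  have "(p + ?t *\<^sub>R q) - p \<in> span \<tau>" using p m by (intro span_diff span_base)
  then have "(real m + 1) *\<^sub>R ((p + ?t *\<^sub>R q) - p) \<in> span \<tau>" by (rule span_scale)
  then have "q \<in> span \<tau>" by simp
  then have "\<not> dim \<tau> < DIM(real ^ 'n)" using q(2) \<tau>(1) by (auto simp: L_def)
  then have "dim \<tau> = DIM(real ^ 'n)" using dim_subset_UNIV[of \<tau>] by simp
  then have "span \<tau> = UNIV" using dim_eq_full by blast
  then show ?thesis using that[of q ?t \<tau>] q \<tau> p m by simp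
qed

text \<open>Apply the preceding lemma at the interior point \<open>\<Sum> gen j\<close> of the cone of \<open>J\<close>. The full cone found
  there meets the cone of \<open>J\<close> in a face containing this interior point, hence in all of it.\<close>

lemma full_simplex_in_direction:
  assumes J: "J \<in> simplices \<Delta>" and U: "open U" "U \<noteq> {}"
  obtains I q t where "I \<in> simplices_of_card \<Delta> CARD('n)" "J \<subseteq> I" "q \<in> U" "t > 0"
    "(\<Sum>j\<in>J. gen j) + t *\<^sub>R q \<in> convex_cone hull (gen ` I)"
proof -
  let ?p = "\<Sum>j\<in>J. gen j"
  note JD = simplexD[OF J]
  obtain q t \<tau> where q: "q \<in> U" "t > 0" "\<tau> \<in> \<Delta>" "?p \<in> \<tau>" "?p + t *\<^sub>R q \<in> \<tau>" "span \<tau> = UNIV"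
    using full_cone_in_direction[OF U] .
  define I where "I = {\<rho>\<in>rays \<Delta>. \<rho> face_of \<tau>}"
  note I = cone_rays[OF q(3) I_def]
  have "card I = card (gen ` I)" using I(2) by (simp add: card_image)
  also have "\<dots> = dim (span (gen ` I))" using I(3) by (simp add: dim_eq_card_independent)
  also have "span (gen ` I) = UNIV" using q(6) I(4) span_convex_cone_hull by metis
  finally have "card I = CARD('n)" by simp
  moreover have "I \<in> simplices \<Delta>" using q(3) I_def by (auto simp: simplices_def)
  moreover have "J \<subseteq> I"
  proof
    fix j assume j: "j \<in> J"
    let ?\<sigma> = "convex_cone hull (gen ` J)"
    have gs: "gen i \<in> ?\<sigma>" if "i \<in> J" for i using that by (simp add: hull_inc)
    have p: "?p = gen j + (\<Sum>i\<in>J - {j}. gen i)" using JD(1) j by (rule sum.remove)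
    have rest: "(\<Sum>i\<in>J - {j}. gen i) \<in> ?\<sigma>" by (rule convex_cone_hull_sum) (use gs in auto)
    have "?p \<in> ?\<sigma>" by (rule convex_cone_hull_sum) (use gs in auto)
    then have "gen j + (\<Sum>i\<in>J - {j}. gen i) \<in> ?\<sigma> \<inter> \<tau>" using q(4) p by simp
    then have "gen j \<in> ?\<sigma> \<inter> \<tau>"
      using face_of_cone_summand[OF _ convex_cone_convex_cone_hull gs[OF j] rest] fan_Int[OF JD(5) q(3)] by blast
    then show "j \<in> I" unfolding I_def using ray_face_of q(3) JD(2) j by auto
  qed
  ultimately show ?thesis using that[of I q t] q I(4) by (auto simp: simplices_of_card_def)
qed

lemma simplex_in_full_simplex:
  assumes "J \<in> simplices \<Delta>"
  obtains I where "I \<in> simplices_of_card \<Delta> CARD('n)" "J \<subseteq> I"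
  using full_simplex_in_direction[OF assms, of UNIV] by auto

lemma full_simplex_span: "I \<in> simplices \<Delta> \<Longrightarrow> card I = CARD('n) \<Longrightarrow> span (gen ` I) = UNIV"
proof -
  assume I: "I \<in> simplices \<Delta>" "card I = CARD('n)"
  note ID = simplexD[OF I(1)]
  have "dim (gen ` I) = card (gen ` I)" using ID(4) by (simp add: dim_eq_card_independent)
  also have "\<dots> = DIM(real ^ 'n)" using ID(3) I(2) by (simp add: card_image)
  finally show ?thesis using dim_eq_full by blast
qed

lemma wall_neighbour_exists:
  assumes J: "J \<in> simplices \<Delta>" "card J + 1 = CARD('n)"
    and u: "u \<noteq> 0" "\<And>j. j \<in> J \<Longrightarrow> u \<bullet> gen j = 0"
  shows "\<exists>i. i \<notin> J \<and> insert i J \<in> simplices \<Delta> \<and> u \<bullet> gen i > 0"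
proof -
  have op: "open {q. u \<bullet> q > 0}" by (rule open_halfspace_gt)
  have ne: "{q. u \<bullet> q > 0} \<noteq> {}" using u(1) by (auto intro!: exI[of _ u])
  obtain I q t where I: "I \<in> simplices_of_card \<Delta> CARD('n)" "J \<subseteq> I" "q \<in> {q. u \<bullet> q > 0}" "t > 0"
    "(\<Sum>j\<in>J. gen j) + t *\<^sub>R q \<in> convex_cone hull (gen ` I)"
    using full_simplex_in_direction[OF J(1) op ne] .
  have Is: "I \<in> simplices \<Delta>" "card I = CARD('n)" using I(1) by (auto simp: simplices_of_card_def)
  have finI: "finite I" using simplexD(1)[OF Is(1)] .
  have "card (I - J) = 1" using I(2) Is(2) J(2) finI by (simp add: card_Diff_subset finite_subset)
  then obtain i where i: "I - J = {i}" by (auto simp: card_1_singleton_iff)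
  then have Ii: "I = insert i J" "i \<notin> J" using I(2) by auto
  have "u \<bullet> gen i > 0"
  proof (rule ccontr)
    assume "\<not> u \<bullet> gen i > 0"
    then have "gen ` I \<subseteq> {x. u \<bullet> x \<le> 0}" using Ii u(2) by auto
    then have "convex_cone hull (gen ` I) \<subseteq> {x. u \<bullet> x \<le> 0}"
      by (rule hull_minimal) (rule convex_cone_halfspace_le)
    then have "u \<bullet> ((\<Sum>j\<in>J. gen j) + t *\<^sub>R q) \<le> 0" using I(5) by blast
    moreover have "u \<bullet> ((\<Sum>j\<in>J. gen j) + t *\<^sub>R q) = t * (u \<bullet> q)"
      using u(2) by (simp add: inner_add_right inner_sum_right)
    ultimately show False using I(3,4) by (simp add: mult_le_0_iff)
  qed
  with Ii Is show ?thesis by auto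
qed

text \<open>A large multiple of the interior point makes all coefficients nonnegative.\<close>

lemma span_shift_into_cone:
  assumes "finite J" "y \<in> span (gen ` J)"
  shows "\<exists>M. y + M *\<^sub>R (\<Sum>j\<in>J. gen j) \<in> convex_cone hull (gen ` J)"
  using assms(2)
proof (induction rule: span_induct_alt)
  case base
  show ?case by (rule exI[of _ 0]) (simp add: convex_cone_hull_contains_0)
next
  case (step c x y)
  let ?C = "convex_cone hull (gen ` J)" and ?p = "\<Sum>j\<in>J. gen j"
  obtain M where M: "y + M *\<^sub>R ?p \<in> ?C" using step by blast
  obtain j where j: "j \<in> J" "x = gen j" using step by auto
  have gs: "gen i \<in> ?C" if "i \<in> J" for i using that by (simp add: hull_inc)
  have p: "?p = gen j + (\<Sum>i\<in>J - {j}. gen i)" using assms(1) j(1) by (rule sum.remove)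
  have rest: "(\<Sum>i\<in>J - {j}. gen i) \<in> ?C" by (rule convex_cone_hull_sum) (use gs in auto)
  have "(c + \<bar>c\<bar>) *\<^sub>R gen j + \<bar>c\<bar> *\<^sub>R (\<Sum>i\<in>J - {j}. gen i) \<in> ?C"
    using gs[OF j(1)] rest by (intro convex_cone_hull_add convex_cone_hull_mul) auto
  then have "((c + \<bar>c\<bar>) *\<^sub>R gen j + \<bar>c\<bar> *\<^sub>R (\<Sum>i\<in>J - {j}. gen i)) + (y + M *\<^sub>R ?p) \<in> ?C"
    using M by (rule convex_cone_hull_add)
  also have "((c + \<bar>c\<bar>) *\<^sub>R gen j + \<bar>c\<bar> *\<^sub>R (\<Sum>i\<in>J - {j}. gen i)) + (y + M *\<^sub>R ?p) = (c *\<^sub>R x + y) + (M + \<bar>c\<bar>) *\<^sub>R ?p"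
    by (simp add: p j(2) algebra_simps)
  finally show ?case by blast
qed

text \<open>If \<open>i\<close> and \<open>i'\<close> lie on the same side of the wall, then \<open>gen i'\<close>, shifted far enough along the wall,
  has a positive \<open>gen i\<close>-coordinate in the cone of \<open>insert i J\<close>. This point lies in both cones, so
  the summand along \<open>gen i\<close> lies in their common face.\<close>

lemma wall_neighbour_unique:
  assumes J: "card J + 1 = CARD('n)"
    and u: "\<And>j. j \<in> J \<Longrightarrow> u \<bullet> gen j = 0"
    and i: "i \<notin> J" "insert i J \<in> simplices \<Delta>" "u \<bullet> gen i > 0"
    and i': "i' \<notin> J" "insert i' J \<in> simplices \<Delta>" "u \<bullet> gen i' > 0"
  shows "i = i'"
proof -
  let ?C = "\<lambda>i. convex_cone hull (gen ` insert i J)"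
  note D = simplexD[OF i(2)] and D' = simplexD[OF i'(2)]
  have finJ: "finite J" using D(1) by simp
  let ?p = "\<Sum>j\<in>J. gen j"
  have "span (gen ` insert i J) = UNIV" using full_simplex_span[OF i(2)] i(1) J finJ by simp
  then have "gen i' \<in> span (insert (gen i) (gen ` J))" by simp
  then obtain a where a: "gen i' - a *\<^sub>R gen i \<in> span (gen ` J)" using span_breakdown_eq by blast
  have "span (gen ` J) \<subseteq> {x. u \<bullet> x = 0}"
    by (rule span_minimal) (use u in \<open>auto simp: subspace_hyperplane\<close>)
  then have "u \<bullet> (gen i' - a *\<^sub>R gen i) = 0" using a by blast
  then have "u \<bullet> gen i' = a * (u \<bullet> gen i)" by (simp add: inner_diff_right)
  then have apos: "a > 0" using i(3) i'(3) by (metis zero_less_mult_pos2)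
  obtain M where M: "(gen i' - a *\<^sub>R gen i) + M *\<^sub>R ?p \<in> convex_cone hull (gen ` J)"
    using span_shift_into_cone[OF finJ a] by blast
  define N where "N = max M 0"
  have p_in: "?p \<in> convex_cone hull (gen ` J)" by (rule convex_cone_hull_sum) (simp add: hull_inc)
  have sub: "convex_cone hull (gen ` J) \<subseteq> ?C k" for k by (rule hull_mono) auto
  have "((gen i' - a *\<^sub>R gen i) + M *\<^sub>R ?p) + (N - M) *\<^sub>R ?p \<in> convex_cone hull (gen ` J)"
    by (rule convex_cone_hull_add[OF M]) (rule convex_cone_hull_mul, use p_in in \<open>auto simp: N_def\<close>)
  then have y: "(gen i' - a *\<^sub>R gen i) + N *\<^sub>R ?p \<in> ?C i" using sub by (auto simp: algebra_simps)
  have ai: "a *\<^sub>R gen i \<in> ?C i" using apos by (intro convex_cone_hull_mul hull_inc) auto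
  have "gen i' + N *\<^sub>R ?p \<in> ?C i'"
  proof (rule convex_cone_hull_add)
    show "gen i' \<in> ?C i'" by (simp add: hull_inc)
    show "N *\<^sub>R ?p \<in> ?C i'"
      by (rule convex_cone_hull_mul) (use p_in sub[of i'] in \<open>auto simp: N_def\<close>)
  qed
  moreover have "a *\<^sub>R gen i + ((gen i' - a *\<^sub>R gen i) + N *\<^sub>R ?p) \<in> ?C i"
    using ai y by (rule convex_cone_hull_add)
  ultimately have "a *\<^sub>R gen i + ((gen i' - a *\<^sub>R gen i) + N *\<^sub>R ?p) \<in> ?C i \<inter> ?C i'" by simp
  then have "a *\<^sub>R gen i \<in> ?C i \<inter> ?C i'"
    using face_of_cone_summand[OF _ convex_cone_convex_cone_hull ai y] fan_Int[OF D(5) D'(5)] by blast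
  then have "a *\<^sub>R gen i \<in> ?C i'" by (rule IntD2)
  then have "(1/a) *\<^sub>R (a *\<^sub>R gen i) \<in> ?C i'" by (rule convex_cone_hull_mul) (use apos in simp)
  then have "gen i \<in> ?C i'" using apos by simp
  then have "i face_of ?C i'" using ray_face_of D(2) D'(5) by auto
  then have "i \<in> insert i' J" using D'(6) D(2) by auto
  then show ?thesis using i(1) by simp
qed

end

section \<open>Sublattices\<close>

lemma group_lattice: "group (lattice_group :: 'n::finite lvec monoid)"
proof (rule groupI)
  fix x :: "'n lvec"
  show "\<exists>y\<in>carrier lattice_group. y \<otimes>\<^bsub>lattice_group\<^esub> x = \<one>\<^bsub>lattice_group\<^esub>"
    by (rule bexI[of _ "- x"]) (simp_all add: lattice_group_def)
qed (simp_all add: lattice_group_def add.assoc)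

lemma carrier_lattice [simp]: "carrier lattice_group = UNIV"
  and mult_lattice [simp]: "x \<otimes>\<^bsub>lattice_group\<^esub> y = x + y"
  and one_lattice [simp]: "\<one>\<^bsub>lattice_group\<^esub> = 0"
  by (simp_all add: lattice_group_def)

lemma inv_lattice [simp]: "inv\<^bsub>lattice_group\<^esub> x = - x"
  by (rule group.inv_equality[OF group_lattice]) simp_all

lemma subgroup_lattice_iff:
  "subgroup L lattice_group \<longleftrightarrow> 0 \<in> L \<and> (\<forall>x\<in>L. \<forall>y\<in>L. x + y \<in> L) \<and> (\<forall>x\<in>L. - x \<in> L)"
  unfolding subgroup_def by auto

lemma subgroup_generate: "subgroup (generate lattice_group S) lattice_group"
  by (rule group.generate_is_subgroup[OF group_lattice]) simp

lemma generate_minimal: "S \<subseteq> L \<Longrightarrow> subgroup L lattice_group \<Longrightarrow> generate lattice_group S \<subseteq> L"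
  by (rule group.generate_subgroup_incl[OF group_lattice])

lemma subgroup_diff: "subgroup L lattice_group \<Longrightarrow> x \<in> L \<Longrightarrow> y \<in> L \<Longrightarrow> x - y \<in> L"
  unfolding subgroup_lattice_iff by (metis add_uminus_conv_diff)

lemma subgroup_scale:
  assumes "subgroup L lattice_group" "x \<in> L"
  shows "m *s x \<in> L"
proof -
  have nat: "int k *s x \<in> L" for k
  proof (induction k)
    case 0 then show ?case using assms by (simp add: subgroup_lattice_iff)
  next
    case (Suc k)
    then show ?case using assms by (simp add: subgroup_lattice_iff vector_sadd_rdistrib)
  qed
  show ?thesis
  proof (cases "m \<ge> 0")
    case True then show ?thesis using nat[of "nat m"] by simp
  next
    case False
    have "- (int (nat (- m)) *s x) \<in> L"
      using nat[of "nat (- m)"] assms(1) unfolding subgroup_lattice_iff by blast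
    moreover have "- (int (nat (- m)) *s x) = m *s x"
      using False by (simp add: cart_eq_iff)
    ultimately show ?thesis by simp
  qed
qed

lemma subgroup_sum: "subgroup L lattice_group \<Longrightarrow> (\<And>i. i \<in> A \<Longrightarrow> f i \<in> L) \<Longrightarrow> sum f A \<in> L"
  by (induction A rule: infinite_finite_induct) (auto simp: subgroup_lattice_iff)

lemma subgroup_add_multiples:
  assumes L: "subgroup L lattice_group"
  shows "subgroup {x + m *s v |x m. x \<in> L} lattice_group" (is "subgroup ?R _")
  unfolding subgroup_lattice_iff
proof (intro conjI ballI)
  have "0 = 0 + 0 *s v" by simp
  then show "0 \<in> ?R" using L unfolding subgroup_lattice_iff by blast
next
  fix x y assume "x \<in> ?R" "y \<in> ?R"
  then obtain a b m k where "a \<in> L" "b \<in> L" "x = a + m *s v" "y = b + k *s v" by blast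
  then have "a + b \<in> L" "x + y = (a + b) + (m + k) *s v"
    using L by (auto simp: subgroup_lattice_iff vector_sadd_rdistrib)
  then show "x + y \<in> ?R" by blast
next
  fix x assume "x \<in> ?R"
  then obtain a m where "a \<in> L" "x = a + m *s v" by blast
  then have "- a \<in> L" "- x = - a + (- m) *s v"
    using L by (auto simp: subgroup_lattice_iff cart_eq_iff)
  then show "- x \<in> ?R" by blast
qed

lemma generate_insert:
  "generate lattice_group (insert v S) = {x + m *s v |x m. x \<in> generate lattice_group S}"
proof (rule equalityI)
  let ?G = "generate lattice_group S" and ?R = "{x + m *s v |x m. x \<in> generate lattice_group S}"
  have G: "subgroup ?G lattice_group" by (rule subgroup_generate)
  show "generate lattice_group (insert v S) \<subseteq> ?R"
  proof (rule generate_minimal)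
    show "insert v S \<subseteq> ?R"
    proof
      fix x assume "x \<in> insert v S"
      then show "x \<in> ?R"
      proof
        assume "x = v"
        then have "x = 0 + 1 *s v" by simp
        then show ?thesis using G unfolding subgroup_lattice_iff by blast
      next
        assume "x \<in> S"
        then have "x \<in> ?G" by (rule generate.incl)
        moreover have "x = x + 0 *s v" by simp
        ultimately show ?thesis by blast
      qed
    qed
    show "subgroup ?R lattice_group" using G by (rule subgroup_add_multiples)
  qed
  show "?R \<subseteq> generate lattice_group (insert v S)"
  proof
    let ?H = "generate lattice_group (insert v S)"
    fix x assume "x \<in> ?R"
    then obtain a m where am: "a \<in> ?G" "x = a + m *s v" by blast
    have H: "subgroup ?H lattice_group" by (rule subgroup_generate)
    have "?G \<subseteq> ?H" by (rule generate_minimal[OF _ H]) (auto intro: generate.incl)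
    moreover have "m *s v \<in> ?H" by (rule subgroup_scale[OF H]) (auto intro: generate.incl)
    ultimately show "x \<in> ?H" using H am unfolding subgroup_lattice_iff by blast
  qed
qed

text \<open>The values of \<open>f\<close> form a subgroup of the integers, which is generated by its least positive
  element.\<close>

lemma least_value_divides:
  fixes f :: "'n::finite lvec \<Rightarrow> int"
  assumes L: "subgroup L lattice_group" and add: "\<And>x y. f (x + y) = f x + f y" and sc: "\<And>m x. f (m *s x) = m * f x"
    and nz: "\<exists>x\<in>L. f x \<noteq> 0"
  obtains w where "w \<in> L" "f w > 0" "\<And>x. x \<in> L \<Longrightarrow> f w dvd f x"
proof -
  define P where "P = (\<lambda>k::nat. k > 0 \<and> (\<exists>x\<in>L. f x = int k))"
  obtain x where x: "x \<in> L" "f x \<noteq> 0" using nz by blast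
  have "sgn (f x) *s x \<in> L" "f (sgn (f x) *s x) = \<bar>f x\<bar>"
    using subgroup_scale[OF L x(1)] by (auto simp: sc abs_sgn mult.commute)
  then have "P (nat \<bar>f x\<bar>)" unfolding P_def using x(2) by auto
  then have "P (Least P)" by (rule LeastI)
  then obtain w where w: "w \<in> L" "f w = int (Least P)" "Least P > 0" unfolding P_def by blast
  show ?thesis
  proof (rule that[OF w(1)])
    show "f w > 0" using w by simp
    fix y assume y: "y \<in> L"
    let ?z = "y + (- (f y div f w)) *s w"
    have z: "?z \<in> L" using L y subgroup_scale[OF L w(1)] unfolding subgroup_lattice_iff by blast
    have fz: "f ?z = f y mod f w" by (simp add: add sc minus_div_mult_eq_mod[symmetric])
    show "f w dvd f y"
    proof (rule ccontr)
      assume "\<not> f w dvd f y"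
      then have "f y mod f w \<noteq> 0" by (simp add: dvd_eq_mod_eq_0)
      moreover have "f y mod f w \<ge> 0" "f y mod f w < f w" using w by auto
      ultimately have "P (nat (f y mod f w))"
        unfolding P_def using z fz by (intro conjI bexI[of _ ?z]) simp_all
      moreover have "nat (f y mod f w) < Least P"
        using \<open>f y mod f w < f w\<close> w(2,3) by linarith
      ultimately show False using not_less_Least[of "nat (f y mod f w)" P] by simp
    qed
  qed
qed

text \<open>Coordinate by coordinate: among the vectors of \<open>L\<close> take \<open>v\<close> whose \<open>a\<close>-coordinate generates all
  \<open>a\<close>-coordinates; the rest of \<open>L\<close> is supported on fewer coordinates after subtracting multiples of \<open>v\<close>.\<close>

lemma lattice_basis_exists_supported:
  assumes "finite A" "subgroup L lattice_group" "\<And>x a. x \<in> L \<Longrightarrow> a \<notin> A \<Longrightarrow> vec_nth x a = 0"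
  shows "\<exists>us. lattice_basis (L :: 'n::finite lvec set) us"
  using assms
proof (induction A arbitrary: L)
  case empty
  then have "x = 0" if "x \<in> L" for x using that by (simp add: cart_eq_iff)
  moreover have "0 \<in> L" using empty by (simp add: subgroup_lattice_iff)
  ultimately have "L = {0}" by blast
  moreover have "generate lattice_group {} = {0 :: 'n lvec}"
    using generate_minimal[of "{}" "{0 :: 'n lvec}"] subgroup_generate[of "{} :: 'n lvec set"]
    by (auto simp: subgroup_lattice_iff)
  ultimately have "lattice_basis L []" by (simp add: lattice_basis_def)
  then show ?case by blast
next
  case (insert a A)
  let ?L0 = "{x \<in> L. vec_nth x a = 0}"
  have sub0: "subgroup ?L0 lattice_group" using insert.prems(1) by (auto simp: subgroup_lattice_iff)
  have "vec_nth x b = 0" if "x \<in> ?L0" "b \<notin> A" for x b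
    using that insert.prems(2)[of x b] by (cases "b = a") auto
  then obtain us where us: "lattice_basis ?L0 us" using insert.IH[OF sub0] by blast
  show ?case
  proof (cases "\<exists>x\<in>L. vec_nth x a \<noteq> 0")
    case False
    then have "?L0 = L" by auto
    with us show ?thesis by auto
  next
    case True
    obtain v where v: "v \<in> L" "vec_nth v a > 0" "\<And>x. x \<in> L \<Longrightarrow> vec_nth v a dvd vec_nth x a"
      using least_value_divides[OF insert.prems(1), of "\<lambda>x. vec_nth x a"] True by auto
    have gen: "generate lattice_group (set us) = ?L0" using us by (simp add: lattice_basis_def)
    have "generate lattice_group (set (v # us)) = L"
    proof (rule equalityI)
      have "set us \<subseteq> ?L0" using gen generate.incl by fastforce
      then show "generate lattice_group (set (v # us)) \<subseteq> L"
        by (intro generate_minimal insert.prems(1)) (use v in auto)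
      show "L \<subseteq> generate lattice_group (set (v # us))"
      proof
        fix x assume x: "x \<in> L"
        obtain q where q: "vec_nth x a = vec_nth v a * q" using v(3)[OF x] by (auto elim: dvdE)
        have "x - q *s v \<in> L" using subgroup_diff[OF insert.prems(1) x] subgroup_scale[OF insert.prems(1) v(1)] by blast
        then have "x - q *s v \<in> generate lattice_group (set us)" using gen q by simp
        moreover have "x = (x - q *s v) + q *s v" by simp
        ultimately show "x \<in> generate lattice_group (set (v # us))"
          by (simp only: list.set generate_insert) blast
      qed
    qed
    moreover have "\<forall>c. (\<Sum>i<length (v # us). c i *s (v # us) ! i) = 0 \<longrightarrow> (\<forall>i<length (v # us). c i = 0)"
    proof (intro allI impI)
      fix c i assume sum: "(\<Sum>i<length (v # us). c i *s (v # us) ! i) = 0" and i: "i < length (v # us)"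
      have sum': "c 0 *s v + (\<Sum>i<length us. c (Suc i) *s us ! i) = 0"
        using sum by (simp add: sum.lessThan_Suc_shift del: sum.lessThan_Suc)
      have "vec_nth (us ! i) a = 0" if "i < length us" for i
      proof -
        have "us ! i \<in> generate lattice_group (set us)" using that by (intro generate.incl) simp
        then show ?thesis using gen by simp
      qed
      then have "vec_nth (c 0 *s v + (\<Sum>i<length us. c (Suc i) *s us ! i)) a = c 0 * vec_nth v a"
        by (simp add: sum_component)
      then have c0: "c 0 = 0" using sum' v(2) by simp
      then have "(\<Sum>i<length us. c (Suc i) *s us ! i) = 0" using sum' by simp
      then have "\<forall>i<length us. c (Suc i) = 0" using us[unfolded lattice_basis_def] by (auto dest: spec[of _ "\<lambda>i. c (Suc i)"])
      with c0 i show "c i = 0" by (cases i) auto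
    qed
    ultimately have "lattice_basis L (v # us)" by (simp add: lattice_basis_def)
    then show ?thesis by blast
  qed
qed

theorem lattice_basis_exists:
  "subgroup L lattice_group \<Longrightarrow> \<exists>us. lattice_basis L us"
  by (rule lattice_basis_exists_supported[of UNIV]) auto

lemma sat_lattice_props:
  "subgroup (sat_lattice J) lattice_group" "saturated (sat_lattice J)" "ray_lattice J \<subseteq> sat_lattice J"
proof -
  let ?S = "\<lambda>L. subgroup L lattice_group \<and> saturated L"
  have "?S (?S hull X)" for X :: "'n::finite lvec set"
  proof (rule hull_in, intro conjI)
    fix T :: "'n lvec set set" assume T: "\<forall>s\<in>T. subgroup s lattice_group \<and> saturated s"
    show "subgroup (\<Inter> T) lattice_group" using T unfolding subgroup_lattice_iff by blast
    show "saturated (\<Inter> T)" using T unfolding saturated_def by blast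
  qed
  then show "subgroup (sat_lattice J) lattice_group" "saturated (sat_lattice J)"
    unfolding sat_lattice_def by blast+
  show "ray_lattice J \<subseteq> sat_lattice J" unfolding sat_lattice_def by (rule hull_subset)
qed

lemma sat_lattice_minimal:
  "ray_lattice J \<subseteq> L \<Longrightarrow> subgroup L lattice_group \<Longrightarrow> saturated L \<Longrightarrow> sat_lattice J \<subseteq> L"
  unfolding sat_lattice_def by (rule hull_minimal) auto

lemma prim_vec_in_ray_lattice: "j \<in> J \<Longrightarrow> prim_vec j \<in> ray_lattice J"
  unfolding ray_lattice_def by (rule generate.incl) simp

text \<open>The vectors orthogonal to \<open>u\<close> form a saturated subgroup, so orthogonality to the generators passes
  to the saturation.\<close>

lemma ann_lattice_iff: "u \<in> ann_lattice J \<longleftrightarrow> (\<forall>j\<in>J. pairing u (prim_vec j) = 0)"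
proof
  assume "u \<in> ann_lattice J"
  then show "\<forall>j\<in>J. pairing u (prim_vec j) = 0"
    unfolding ann_lattice_def using sat_lattice_props(3) prim_vec_in_ray_lattice by blast
next
  assume u: "\<forall>j\<in>J. pairing u (prim_vec j) = 0"
  have "sat_lattice J \<subseteq> {v. pairing u v = 0}"
  proof (rule sat_lattice_minimal)
    show sub: "subgroup {v. pairing u v = 0} lattice_group"
      unfolding subgroup_lattice_iff using pairing_scale_right[of u "-1"]
      by (auto simp: pairing_add_right vector_sneg_minus1)
    show "ray_lattice J \<subseteq> {v. pairing u v = 0}"
      unfolding ray_lattice_def by (rule generate_minimal[OF _ sub]) (use u in auto)
    show "saturated {v. pairing u v = 0}"
      unfolding saturated_def by (auto simp: pairing_scale_right)
  qed
  then show "u \<in> ann_lattice J" unfolding ann_lattice_def by blast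
qed

lemma subgroup_ann_lattice: "subgroup (ann_lattice J) lattice_group"
  unfolding subgroup_lattice_iff
  by (auto simp: ann_lattice_iff pairing_add_left vector_sneg_minus1 pairing_scale_left)

definition lattice_cosets :: "'n::finite lvec set \<Rightarrow> 'n lvec set \<Rightarrow> 'n lvec set set" where
  "lattice_cosets L X = (\<lambda>a. (\<lambda>h. h + a) ` L) ` X"

lemma coset_eq_iff:
  assumes "subgroup L lattice_group"
  shows "(\<lambda>h. h + a) ` L = (\<lambda>h. h + b) ` L \<longleftrightarrow> a - b \<in> L"
proof
  assume "(\<lambda>h. h + a) ` L = (\<lambda>h. h + b) ` L"
  moreover have "0 + a \<in> (\<lambda>h. h + a) ` L" using assms unfolding subgroup_lattice_iff by blast
  ultimately have "a \<in> (\<lambda>h. h + b) ` L" by simp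
  then show "a - b \<in> L" by auto
next
  assume ab: "a - b \<in> L"
  have "x + (a - b) \<in> L" "x - (a - b) \<in> L" if "x \<in> L" for x
    using ab that assms subgroup_diff[OF assms] by (auto simp: subgroup_lattice_iff)
  then show "(\<lambda>h. h + a) ` L = (\<lambda>h. h + b) ` L"
    by (auto simp: image_iff) (metis add_diff_eq diff_add_cancel, metis (no_types, lifting) add_diff_cancel_right' add_diff_eq diff_add_cancel)
qed

lemma order_H_group_full:
  assumes "sat_lattice I = UNIV"
  shows "order (H_group I) = card (lattice_cosets (ray_lattice I) UNIV)"
  unfolding H_group_def order_def assms FactGroup_def RCOSETS_def r_coset_def lattice_cosets_def lattice_group_def
  by (rule arg_cong[where f = card]) (auto simp: image_def)

text \<open>Let \<open>\<langle>u,w\<rangle>\<close> generate the values of \<open>u\<close> and put \<open>d = \<langle>u,v\<rangle> / \<langle>u,w\<rangle>\<close>. Every vector is congruent modulo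
  \<open>\<int>v\<close> to \<open>k + t w\<close> with \<open>k\<close> in the kernel of \<open>u\<close> and a unique \<open>0 \<le> t < \<bar>d\<bar>\<close>, and \<open>k\<close> is then unique
  modulo \<open>L\<close>. Hence the index of \<open>L + \<int>v\<close> is \<open>\<bar>d\<bar>\<close> times the index of \<open>L\<close> in the kernel.\<close>

lemma card_cosets_insert:
  fixes u v w :: "'n::finite lvec" and L :: "'n lvec set"
  assumes L: "subgroup L lattice_group" and uL: "\<And>x. x \<in> L \<Longrightarrow> pairing u x = 0"
    and w: "pairing u w > 0" "\<And>x. pairing u w dvd pairing u x"
    and v: "pairing u v \<noteq> 0"
  shows "int (card (lattice_cosets {x + m *s v |x m. x \<in> L} UNIV)) * pairing u w
    = \<bar>pairing u v\<bar> * int (card (lattice_cosets L {x. pairing u x = 0}))"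
proof -
  let ?L' = "{x + m *s v |x m. x \<in> L}" and ?K = "{x. pairing u x = 0}"
  obtain d where d: "pairing u v = pairing u w * d" using w(2)[of v] by (auto elim: dvdE)
  have d0: "d \<noteq> 0" using d v by auto
  have L': "subgroup ?L' lattice_group" using L by (rule subgroup_add_multiples)
  define c' where "c' = (\<lambda>a. (\<lambda>h. h + a) ` ?L')"
  define c where "c = (\<lambda>a. (\<lambda>h. h + a) ` L)"
  \<comment> \<open>A coset of \<open>L\<close> is turned into a coset of \<open>L + \<int>v\<close> through a chosen representative.\<close>
  define F where "F = (\<lambda>(C, t). c' ((SOME k. k \<in> ?K \<and> C = c k) + t *s w))"
  have c'_iff: "c' a = c' b \<longleftrightarrow> a - b \<in> ?L'" for a b unfolding c'_def by (rule coset_eq_iff[OF L'])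
  have c_iff: "c a = c b \<longleftrightarrow> a - b \<in> L" for a b unfolding c_def by (rule coset_eq_iff[OF L])
  have rep: "(SOME k. k \<in> ?K \<and> C = c k) \<in> ?K \<and> C = c (SOME k. k \<in> ?K \<and> C = c k)" if "C \<in> c ` ?K" for C
    by (rule someI_ex) (use that in auto)
  have dv: "pairing u (a - b) = pairing u a - pairing u b" for a b
    using pairing_add_right[of u "a - b" b] by simp
  have "bij_betw F (c ` ?K \<times> {0..<\<bar>d\<bar>}) (c' ` UNIV)"
    unfolding bij_betw_def
  proof
    show "inj_on F (c ` ?K \<times> {0..<\<bar>d\<bar>})"
    proof (rule inj_onI, clarify)
      fix k1 t1 k2 t2
      assume k: "pairing u k1 = 0" "pairing u k2 = 0" and t: "t1 \<in> {0..<\<bar>d\<bar>}" "t2 \<in> {0..<\<bar>d\<bar>}"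
        and F: "F (c k1, t1) = F (c k2, t2)"
      define r1 where "r1 = (SOME k. k \<in> ?K \<and> c k1 = c k)"
      define r2 where "r2 = (SOME k. k \<in> ?K \<and> c k2 = c k)"
      have r1: "pairing u r1 = 0" "c k1 = c r1" using rep[of "c k1"] k by (auto simp: r1_def)
      have r2: "pairing u r2 = 0" "c k2 = c r2" using rep[of "c k2"] k by (auto simp: r2_def)
      have "(r1 + t1 *s w) - (r2 + t2 *s w) \<in> ?L'"
        using F unfolding F_def prod.case r1_def[symmetric] r2_def[symmetric] c'_iff .
      then obtain x m where x: "x \<in> L" "(r1 + t1 *s w) - (r2 + t2 *s w) = x + m *s v" by blast
      have "pairing u ((r1 + t1 *s w) - (r2 + t2 *s w)) = (t1 - t2) * pairing u w"
        by (simp add: dv pairing_add_right pairing_scale_right r1 r2 algebra_simps)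
      moreover have "pairing u (x + m *s v) = m * d * pairing u w"
        using uL[OF x(1)] by (simp add: pairing_add_right pairing_scale_right d)
      ultimately have "t1 - t2 = m * d" using x(2) w(1) by simp
      then have "d dvd t1 - t2" by simp
      then have "\<bar>d\<bar> dvd t1 - t2" by simp
      moreover have "\<bar>t1 - t2\<bar> < \<bar>d\<bar>" using t by auto
      ultimately have teq: "t1 = t2" using zdvd_not_zless[of "\<bar>t1 - t2\<bar>" "\<bar>d\<bar>"] by fastforce
      then have "m = 0" using \<open>t1 - t2 = m * d\<close> d0 by simp
      then have "r1 - r2 \<in> L" using x teq by simp
      then have "c r1 = c r2" by (simp only: c_iff)
      then show "c k1 = c k2 \<and> t1 = t2" using teq r1(2) r2(2) by simp
    qed
    show "F ` (c ` ?K \<times> {0..<\<bar>d\<bar>}) = c' ` UNIV"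
    proof (intro equalityI subsetI)
      fix y assume "y \<in> c' ` UNIV"
      then obtain x where y: "y = c' x" by auto
      obtain e where e: "pairing u x = pairing u w * e" using w(2)[of x] by (auto elim: dvdE)
      define t where "t = e mod \<bar>d\<bar>"
      have t: "t \<in> {0..<\<bar>d\<bar>}" using d0 by (simp add: t_def)
      have "\<bar>d\<bar> dvd e - t" unfolding t_def by (simp add: mod_eq_dvd_iff)
      then have "d dvd e - t" by simp
      then obtain q where q: "e - t = d * q" by (auto elim: dvdE)
      define k where "k = x - q *s v - t *s w"
      have "pairing u k = pairing u w * (e - q * d - t)"
        by (simp add: k_def dv pairing_add_right pairing_scale_right e d algebra_simps)
      then have k: "k \<in> ?K" using q by (simp add: mult.commute)
      define r where "r = (SOME k'. k' \<in> ?K \<and> c k = c k')"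
      have r: "c k = c r" using rep[of "c k"] k by (auto simp: r_def)
      then have kr: "k - r \<in> L" using c_iff by simp
      have "x - (r + t *s w) = (k - r) + q *s v" by (simp add: k_def)
      then have "x - (r + t *s w) \<in> ?L'" using kr by blast
      then have "c' x = c' (r + t *s w)" by (simp only: c'_iff)
      then have "y = F (c k, t)" unfolding y F_def prod.case r_def .
      then show "y \<in> F ` (c ` ?K \<times> {0..<\<bar>d\<bar>})" using k t by blast
    qed (auto simp: F_def)
  qed
  then have "card (c' ` UNIV) = card (c ` ?K) * nat \<bar>d\<bar>"
    by (simp add: bij_betw_same_card[symmetric] card_cartesian_product)
  then have "int (card (lattice_cosets ?L' UNIV)) * pairing u w = int (card (lattice_cosets L ?K)) * \<bar>d\<bar> * pairing u w"
    by (simp add: lattice_cosets_def c_def c'_def)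
  also have "\<dots> = \<bar>pairing u v\<bar> * int (card (lattice_cosets L ?K))"
    using w(1) by (simp add: d abs_mult)
  finally show ?thesis .
qed

lemma vec_of_add: "vec_of (x + y) = vec_of x + vec_of y"
  and vec_of_0 [simp]: "vec_of 0 = 0"
  and vec_of_minus: "vec_of (- x) = - vec_of x"
  and vec_of_scale: "vec_of (m *s x) = of_int m *s vec_of x"
  by (simp_all add: vec_of_def cart_eq_iff)

lemma pairing_vec_of: "pairing (vec_of u) (vec_of v) = (of_int (pairing u v) :: 'a::comm_ring_1)"
  by (simp add: pairing_def vec_of_def)

lemma clear_denominators:
  fixes f :: "'i \<Rightarrow> rat"
  assumes "finite A"
  obtains d :: int and z where "d > 0" "\<And>i. i \<in> A \<Longrightarrow> of_int d * f i = of_int (z i)"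
proof -
  have "\<exists>d>0. \<forall>i\<in>A. \<exists>z. of_int d * f i = (of_int z :: rat)"
    using assms
  proof induction
    case empty then show ?case by (auto intro: exI[of _ 1])
  next
    case (insert i A)
    then obtain d where d: "d > 0" "\<forall>i\<in>A. \<exists>z. of_int d * f i = (of_int z :: rat)" by blast
    obtain a b where ab: "quotient_of (f i) = (a, b)" by force
    then have b: "b > 0" "f i = of_int a / of_int b" using quotient_of_denom_pos quotient_of_div by auto
    have "of_int (d * b) * f i = (of_int (d * a) :: rat)" using b by simp
    moreover have "\<exists>z. of_int (d * b) * f j = (of_int z :: rat)" if j: "j \<in> A" for j
    proof -
      obtain z where "of_int d * f j = (of_int z :: rat)" using d j by blast
      then have "of_int (d * b) * f j = (of_int (b * z) :: rat)" by (simp add: mult_ac)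
      then show ?thesis by blast
    qed
    ultimately show ?case using d b by (intro exI[of _ "d * b"]) (auto simp del: of_int_mult)
  qed
  then obtain d where d: "d > 0" "\<forall>i\<in>A. \<exists>z. of_int d * f i = (of_int z :: rat)" by blast
  then have "\<forall>i\<in>A. of_int d * f i = (of_int (SOME z. of_int d * f i = (of_int z :: rat)) :: rat)"
    by (auto intro: someI_ex)
  then show ?thesis using that[OF d(1), of "\<lambda>i. SOME z. of_int d * f i = (of_int z :: rat)"] by blast
qed

lemma clear_vec_denominators:
  fixes u :: "rat ^ 'n::finite"
  obtains d :: int and z :: "'n lvec" where "d > 0" "of_int d *s u = vec_of z"
proof -
  obtain d z where "d > 0" "\<And>i. i \<in> UNIV \<Longrightarrow> of_int d * vec_nth u i = of_int (z i)"
    using clear_denominators[of "UNIV :: 'n set" "vec_nth u"] by auto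
  then have "of_int d *s u = vec_of (\<chi> i. z i)" by (simp add: cart_eq_iff vec_of_def)
  with \<open>d > 0\<close> that show ?thesis by blast
qed

section \<open>Linear functionals on rational vector spaces\<close>

text \<open>Extend a basis of the span by \<open>x\<close> and read off one coordinate of a linear map that sends \<open>x\<close> to
  the all-ones vector and the basis to zero.\<close>

lemma functional_separating:
  fixes x :: "rat ^ 'n" and V :: "(rat ^ 'n) set"
  assumes "x \<notin> vec.span V"
  obtains u where "pairing u x = 1" "\<And>y. y \<in> vec.span V \<Longrightarrow> pairing u y = 0"
proof -
  obtain B where B: "B \<subseteq> vec.span V" "vec.independent B" "vec.span V \<subseteq> vec.span B"
      "card B = vec.dim (vec.span V)"
    by (rule vec.basis_exists)
  have spB: "vec.span B = vec.span V"
    using B vec.span_mono[OF B(1)] by (simp add: vec.span_span)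
  then have xB: "x \<notin> vec.span B" using assms by simp
  then have "vec.independent (insert x B)" using B(2) by (rule vec.independent_insertI)
  from vec.linear_independent_extend[OF this, of "\<lambda>v. if v = x then (\<chi> b. 1) else (0 :: rat ^ 'n)"]
  obtain g where g: "Vector_Spaces.linear (*s) (*s) g"
    "\<And>v. v \<in> insert x B \<Longrightarrow> g v = (if v = x then (\<chi> b. 1) else (0 :: rat ^ 'n))" by blast
  have gadd: "g (a + b) = g a + g b" and gsc: "g (c *s a) = c *s g a" for a b c
    using g(1) by (simp_all add: Vector_Spaces.linear.axioms(3) linear_iff module_hom_iff vec.linear_add vec.linear_scale)
  have gsum: "g (\<Sum>i\<in>A. h i) = (\<Sum>i\<in>A. g (h i))" for A and h :: "'n \<Rightarrow> _"
    using gsc[of 0 0] by (induction A rule: infinite_finite_induct) (auto simp: gadd)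
  define e where "e = (undefined :: 'n)"
  define u where "u = (\<chi> b. vec_nth (g (axis b 1)) e)"
  have u: "pairing u y = vec_nth (g y) e" for y
  proof -
    have "y = (\<Sum>b\<in>UNIV. vec_nth y b *s axis b 1)"
      by (simp add: basis_expansion)
    then have "g y = (\<Sum>b\<in>UNIV. vec_nth y b *s g (axis b 1))"
      by (metis (no_types, lifting) gsum gsc sum.cong)
    then have "vec_nth (g y) e = (\<Sum>b\<in>UNIV. vec_nth y b * vec_nth (g (axis b 1)) e)"
      by (simp add: sum_component)
    then show ?thesis by (simp add: pairing_def u_def mult.commute)
  qed
  have "pairing u x = 1" using g(2)[of x] by (simp add: u)
  moreover have "pairing u y = 0" if "y \<in> vec.span V" for y
  proof -
    have "y \<in> vec.span B" using that spB by simp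
    then show ?thesis
    proof (induction rule: vec.span_induct_alt)
      case (step c a y)
      then have "a \<noteq> x" using xB vec.span_base by blast
      then have "g a = 0" using g(2)[of a] step by simp
      then have "pairing u a = 0" by (simp add: u)
      then show ?case using step by (simp add: pairing_add_right pairing_scale_right)
    qed simp
  qed
  ultimately show ?thesis using that by blast
qed

text \<open>This supplies the linear forms of the reduction to squarefree monomials: they vanish on \<open>E\<close> and
  single out one generator of a simplex whose span is transversal to \<open>E\<close>.\<close>

lemma dual_functional:
  fixes f :: "'i \<Rightarrow> rat ^ 'n"
  assumes "finite K" "inj_on f K" "vec.independent (f ` K)" and E: "vec.subspace E"
    and tr: "\<And>e. e \<in> E \<Longrightarrow> e \<in> vec.span (f ` K) \<Longrightarrow> e = 0" and i: "i \<in> K"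
  obtains u where "\<And>e. e \<in> E \<Longrightarrow> pairing u e = 0" "\<And>j. j \<in> K \<Longrightarrow> pairing u (f j) = (if j = i then 1 else 0)"
proof -
  let ?V = "E \<union> f ` (K - {i})"
  have "f i \<notin> vec.span ?V"
  proof
    assume "f i \<in> vec.span ?V"
    then obtain e s where es: "e \<in> vec.span E" "s \<in> vec.span (f ` (K - {i}))" "f i = e + s"
      by (auto simp: vec.span_Un)
    have e: "e \<in> E" using es(1) vec.span_eq_iff[THEN iffD2, OF E] by simp
    have sK: "s \<in> vec.span (f ` K)" using es(2) vec.span_mono[of "f ` (K - {i})" "f ` K"] by blast
    have "f i \<in> vec.span (f ` K)" using i by (simp add: vec.span_base)
    then have "f i - s \<in> vec.span (f ` K)" using sK by (rule vec.span_diff)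
    then have "e \<in> vec.span (f ` K)" using es(3) by simp
    then have "f i = s" using tr e es(3) by simp
    then have "f i \<in> vec.span (f ` (K - {i}))" using es by simp
    also have "f ` (K - {i}) = f ` K - {f i}" using assms(2) i by (auto simp: inj_on_def)
    finally show False using assms(3) i by (auto simp: vec.dependent_def)
  qed
  from functional_separating[OF this] obtain u where u: "pairing u (f i) = 1" "\<And>y. y \<in> vec.span ?V \<Longrightarrow> pairing u y = 0" by blast
  show ?thesis
  proof (rule that)
    show "pairing u e = 0" if "e \<in> E" for e using that by (intro u vec.span_base) simp
    show "pairing u (f j) = (if j = i then 1 else 0)" if "j \<in> K" for j
      using that u by (auto intro: vec.span_base)
  qed
qed

section \<open>Dual bases and annihilators\<close>

context complete_simplicial_fan
begin

text \<open>The generators live in real space for the geometry of the fan and in rational space for the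
  algebra.\<close>

definition qgen :: "'n cone \<Rightarrow> rat ^ 'n" where
  "qgen \<rho> = vec_of (prim_vec \<rho>)"

lemma qgen_inj_independent:
  assumes "J \<in> simplices \<Delta>"
  shows "inj_on qgen J" "vec.independent (qgen ` J)"
proof -
  note JD = simplexD[OF assms]
  show inj: "inj_on qgen J"
  proof (rule inj_onI)
    fix i j assume ij: "i \<in> J" "j \<in> J" "qgen i = qgen j"
    then have "prim_vec i = prim_vec j" by (simp add: qgen_def cart_eq_iff)
    then have "gen i = gen j" by (simp add: gen_def)
    then show "i = j" using JD(3) ij by (simp add: inj_on_def)
  qed
  show "vec.independent (qgen ` J)"
    unfolding independent_image_iff[OF JD(1) inj]
  proof (intro allI impI ballI)
    fix c i assume c: "(\<Sum>j\<in>J. c j *s qgen j) = 0" and i: "i \<in> J"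
    have "(\<Sum>j\<in>J. real_of_rat (c j) *\<^sub>R gen j) = 0"
    proof (subst cart_eq_iff, rule allI)
      fix a
      have "(\<Sum>j\<in>J. c j * of_int (vec_nth (prim_vec j) a)) = 0"
        using arg_cong[OF c, of "\<lambda>x. vec_nth x a"] by (simp add: sum_component qgen_def)
      then have "real_of_rat (\<Sum>j\<in>J. c j * of_int (vec_nth (prim_vec j) a)) = 0" by simp
      then show "vec_nth (\<Sum>j\<in>J. real_of_rat (c j) *\<^sub>R gen j) a = vec_nth 0 a"
        by (simp add: sum_component gen_def of_rat_sum of_rat_mult)
    qed
    then have "(\<Sum>v\<in>gen ` J. real_of_rat (c (the_inv_into J gen v)) *\<^sub>R v) = 0"
      by (subst sum.reindex[OF JD(3)]) (simp add: the_inv_into_f_f[OF JD(3)] cong: sum.cong)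
    moreover have "\<forall>c. (\<Sum>v\<in>gen ` J. c v *\<^sub>R v) = 0 \<longrightarrow> (\<forall>v\<in>gen ` J. c v = 0)"
      using JD(4) unfolding independent_explicit by blast
    ultimately have "\<forall>v\<in>gen ` J. real_of_rat (c (the_inv_into J gen v)) = 0"
      by (rule mp[OF spec[where x = "\<lambda>v. real_of_rat (c (the_inv_into J gen v))"], rotated])
    then show "c i = 0" using i by (simp add: the_inv_into_f_f[OF JD(3)])
  qed
qed

abbreviation full_simplices :: "'n cone set set" where
  "full_simplices \<equiv> simplices_of_card \<Delta> CARD('n)"

lemma full_simplex: "I \<in> full_simplices \<Longrightarrow> I \<in> simplices \<Delta>" "I \<in> full_simplices \<Longrightarrow> card I = CARD('n)"
  by (auto simp: simplices_of_card_def)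

lemma full_simplex_qspan:
  assumes "I \<in> full_simplices"
  shows "vec.span (qgen ` I) = UNIV"
proof -
  note I = full_simplex[OF assms] and Q = qgen_inj_independent[OF full_simplex(1)[OF assms]]
  have "vec.dim (qgen ` I) = card (qgen ` I)" using Q(2) by (rule vec.dim_eq_card_independent)
  also have "\<dots> = CARD('n)" using Q(1) I(2) by (simp add: card_image)
  finally show ?thesis using vec.dim_eq_full[of "qgen ` I"] by (simp add: vec.dimension_def card_cart_basis)
qed

lemma eq_by_pairing:
  assumes "I \<in> full_simplices" "\<And>j. j \<in> I \<Longrightarrow> pairing u (qgen j) = pairing u' (qgen j)"
  shows "u = u'"
proof -
  have "pairing (u - u') y = 0" if "y \<in> vec.span (qgen ` I)" for y
    using that
  proof (induction rule: vec.span_induct_alt)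
    case (step c x y)
    then have "pairing u x = pairing u' x" using assms(2) by auto
    moreover have "pairing (u - u') x + pairing u' x = pairing u x"
      unfolding pairing_add_left[symmetric] by simp
    ultimately show ?case using step by (simp add: pairing_add_right pairing_scale_right)
  qed simp
  then have "pairing (u - u') (u - u') = 0" using full_simplex_qspan[OF assms(1)] by simp
  then show ?thesis by (simp add: pairing_self_eq_0_iff)
qed

lemma dual_vec_pairing:
  assumes "I \<in> full_simplices" "i \<in> I" "j \<in> I"
  shows "pairing (dual_vec I i) (qgen j) = (if j = i then 1 else 0)"
proof -
  note I = full_simplex[OF assms(1)]
  obtain u where u: "\<And>j. j \<in> I \<Longrightarrow> pairing u (qgen j) = (if j = i then 1 else 0)"
    using dual_functional[OF simplexD(1)[OF I(1)] qgen_inj_independent[OF I(1)] vec.subspace_single_0 _ assms(2)] by auto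
  have "\<exists>!u. \<forall>j\<in>I. pairing u (vec_of (prim_vec j)) = (if j = i then 1 else (0::rat))"
  proof (rule ex1I[of _ u])
    show "\<forall>j\<in>I. pairing u (vec_of (prim_vec j)) = (if j = i then 1 else 0)" using u by (simp add: qgen_def)
    fix u' assume "\<forall>j\<in>I. pairing u' (vec_of (prim_vec j)) = (if j = i then 1 else (0::rat))"
    then show "u' = u" by (intro eq_by_pairing[OF assms(1)]) (simp add: u[unfolded qgen_def] qgen_def)
  qed
  from theI'[OF this] show ?thesis using assms(3) by (simp add: dual_vec_def qgen_def)
qed

lemma iota_vec_pairing:
  assumes "I \<in> full_simplices" "j \<in> I"
  shows "pairing (iota_vec I i) (qgen j) = (if j = i then 1 else 0)"
  using dual_vec_pairing[OF assms(1) _ assms(2)] assms(2) by (auto simp: iota_vec_def)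

lemma dual_vec_nonzero: "I \<in> full_simplices \<Longrightarrow> i \<in> I \<Longrightarrow> dual_vec I i \<noteq> 0"
  using dual_vec_pairing[of I i i] by auto

lemma dual_expansion:
  assumes "I \<in> full_simplices"
  shows "u = (\<Sum>i\<in>I. pairing u (qgen i) *s dual_vec I i)"
proof (rule eq_by_pairing[OF assms])
  fix j assume j: "j \<in> I"
  have "pairing (\<Sum>i\<in>I. pairing u (qgen i) *s dual_vec I i) (qgen j) = (\<Sum>i\<in>I. if i = j then pairing u (qgen j) else 0)"
    unfolding pairing_sum_left
    by (rule sum.cong) (use dual_vec_pairing[OF assms _ j] in \<open>auto simp: pairing_scale_left\<close>)
  also have "\<dots> = pairing u (qgen j)" using j simplexD(1)[OF full_simplex(1)[OF assms]] by simp
  finally show "pairing u (qgen j) = pairing (\<Sum>i\<in>I. pairing u (qgen i) *s dual_vec I i) (qgen j)" ..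
qed

lemma pairing_qgen_of_int: "pairing (vec_of u) (qgen j) = of_int (pairing u (prim_vec j))"
  by (simp add: qgen_def pairing_vec_of)

lemma inner_gen_of_int: "vec_of u \<bullet> gen j = of_int (pairing u (prim_vec j))"
  by (simp add: gen_def inner_vec_def pairing_def)

text \<open>Rational coordinates with respect to the generators have a common denominator \<open>d\<close>, so \<open>d x\<close> lies in
  the ray lattice for every integral \<open>x\<close>.\<close>

lemma sat_lattice_full:
  assumes "I \<in> full_simplices"
  shows "sat_lattice I = UNIV"
proof -
  have fin: "finite I" using simplexD(1)[OF full_simplex(1)[OF assms]] .
  have "x \<in> sat_lattice I" for x :: "'n lvec"
  proof -
    define c where "c = (\<lambda>i. pairing (dual_vec I i) (vec_of x))"
    obtain d z where d: "d > 0" "\<And>i. i \<in> I \<Longrightarrow> of_int d * c i = of_int (z i)"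
      using clear_denominators[OF fin, of c] by blast
    define y where "y = (\<Sum>i\<in>I. z i *s prim_vec i)"
    have y: "y \<in> sat_lattice I"
      unfolding y_def
    proof (rule subgroup_sum[OF sat_lattice_props(1)])
      fix i assume "i \<in> I"
      then have "prim_vec i \<in> sat_lattice I" using prim_vec_in_ray_lattice sat_lattice_props(3) by blast
      then show "z i *s prim_vec i \<in> sat_lattice I" by (rule subgroup_scale[OF sat_lattice_props(1)])
    qed
    have "(vec_of y :: rat ^ 'n) = (\<Sum>i\<in>I. of_int (z i) *s qgen i)"
      by (simp add: y_def qgen_def cart_eq_iff sum_component)
    also have "\<dots> = (\<Sum>i\<in>I. of_int d *s (c i *s qgen i))"
      by (intro sum.cong refl) (simp add: d(2)[symmetric] vector_smult_assoc)
    also have "\<dots> = of_int d *s (\<Sum>i\<in>I. c i *s qgen i)" by (simp add: vec.scale_sum_right)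
    also have "(\<Sum>i\<in>I. c i *s qgen i) = vec_of x"
    proof -
      have "pairing u (\<Sum>i\<in>I. c i *s qgen i) = pairing u (vec_of x)" for u
      proof -
        have "pairing u (vec_of x) = (\<Sum>i\<in>I. pairing u (qgen i) * c i)"
          by (subst dual_expansion[OF assms, of u]) (simp add: pairing_sum_left pairing_scale_left c_def)
        then show ?thesis by (simp add: pairing_sum_right pairing_scale_right mult.commute)
      qed
      then have "pairing u ((\<Sum>i\<in>I. c i *s qgen i) - vec_of x) = 0" for u
        using pairing_add_right[of u "(\<Sum>i\<in>I. c i *s qgen i) - vec_of x" "vec_of x"] by simp
      then have "(\<Sum>i\<in>I. c i *s qgen i) - vec_of x = 0" using pairing_self_eq_0_iff by blast
      then show ?thesis by simp
    qed
    finally have "(vec_of y :: rat ^ 'n) = vec_of (d *s x)" by (simp add: vec_of_scale)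
    then have "rat_of_int (vec_nth y a) = rat_of_int (vec_nth (d *s x) a)" for a by (metis vec_of_nth)
    then have "vec_nth y a = vec_nth (d *s x) a" for a by (simp only: of_int_eq_iff)
    then have "y = d *s x" unfolding cart_eq_iff by blast
    then have "d *s x \<in> sat_lattice I" using y by simp
    then show ?thesis using sat_lattice_props(2)[of I] d(1) unfolding saturated_def by (metis less_irrefl)
  qed
  then show ?thesis by blast
qed

text \<open>Only the two full cones at the wall contribute. Their new generators lie on opposite sides of
  the wall, and the order of \<open>H_group (insert i J)\<close> is proportional to the height \<open>\<bar>\<langle>u,v\<^sub>i\<rangle>\<bar>\<close>, so the
  two terms cancel.\<close>

lemma wall_balance:
  assumes J: "J \<in> simplices \<Delta>" "card J + 1 = CARD('n)" and u: "\<And>j. j \<in> J \<Longrightarrow> pairing u (prim_vec j) = 0"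
  shows "(\<Sum>i\<in>{i\<in>rays \<Delta> - J. insert i J \<in> simplices \<Delta>}.
    rat_of_int (pairing u (prim_vec i)) / rat_of_nat (order (H_group (insert i J)))) = 0"
proof (cases "u = 0")
  case True then show ?thesis by simp
next
  case u0: False
  have finJ: "finite J" using simplexD(1)[OF J(1)] .
  let ?u = "vec_of u :: real ^ 'n"
  have ru: "?u \<bullet> gen j = 0" if "j \<in> J" for j using u[OF that] by (simp add: inner_gen_of_int)
  obtain i where i: "i \<notin> J" "insert i J \<in> simplices \<Delta>" "pairing u (prim_vec i) > 0"
    using wall_neighbour_exists[OF J, of ?u] u0 ru by (auto simp: inner_gen_of_int)
  obtain k where k: "k \<notin> J" "insert k J \<in> simplices \<Delta>" "pairing u (prim_vec k) < 0"
    using wall_neighbour_exists[OF J, of "- ?u"] u0 ru by (auto simp: inner_gen_of_int)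
  have full: "insert l J \<in> full_simplices" if "l \<notin> J" "insert l J \<in> simplices \<Delta>" for l
    using that J(2) finJ by (simp add: simplices_of_card_def)
  have "{i\<in>rays \<Delta> - J. insert i J \<in> simplices \<Delta>} = {i, k}"
  proof (intro equalityI subsetI)
    fix l assume "l \<in> {i\<in>rays \<Delta> - J. insert i J \<in> simplices \<Delta>}"
    then have l: "l \<notin> J" "insert l J \<in> simplices \<Delta>" by auto
    have "pairing u (prim_vec l) \<noteq> 0"
    proof
      assume "pairing u (prim_vec l) = 0"
      then have "vec_of u = (0 :: rat ^ 'n)"
        by (intro eq_by_pairing[OF full[OF l]]) (use u in \<open>auto simp: pairing_qgen_of_int\<close>)
      with u0 show False by simp
    qed
    then consider "pairing u (prim_vec l) > 0" | "pairing u (prim_vec l) < 0" by linarith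
    then show "l \<in> {i, k}"
    proof cases
      case 1
      then have "l = i"
        using wall_neighbour_unique[OF J(2), of ?u l i] ru l i by (simp add: inner_gen_of_int)
      then show ?thesis by simp
    next
      case 2
      then have "l = k"
        using wall_neighbour_unique[OF J(2), of "- ?u" l k] ru l k by (simp add: inner_gen_of_int)
      then show ?thesis by simp
    qed
  next
    fix l assume "l \<in> {i, k}"
    then show "l \<in> {i\<in>rays \<Delta> - J. insert i J \<in> simplices \<Delta>}"
      using i k simplexD(2)[OF i(2)] simplexD(2)[OF k(2)] by auto
  qed
  moreover have "i \<noteq> k" using i k by auto
  ultimately have "(\<Sum>i\<in>{i\<in>rays \<Delta> - J. insert i J \<in> simplices \<Delta>}.
      rat_of_int (pairing u (prim_vec i)) / rat_of_nat (order (H_group (insert i J))))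
    = rat_of_int (pairing u (prim_vec i)) / rat_of_nat (order (H_group (insert i J)))
     + rat_of_int (pairing u (prim_vec k)) / rat_of_nat (order (H_group (insert k J)))" by simp
  also have "\<dots> = 0"
  proof -
    have sub: "subgroup (ray_lattice J) lattice_group" unfolding ray_lattice_def by (rule subgroup_generate)
    have uL: "pairing u x = 0" if "x \<in> ray_lattice J" for x
    proof -
      have "u \<in> ann_lattice J" using u by (simp add: ann_lattice_iff)
      then show ?thesis using that sat_lattice_props(3)[of J] unfolding ann_lattice_def by blast
    qed
    have "subgroup UNIV (lattice_group :: 'n lvec monoid)" by (simp add: subgroup_lattice_iff)
    then obtain w where w: "pairing u w > 0" "\<And>x. pairing u w dvd pairing u x"
      using least_value_divides[of UNIV "pairing u"] i(3)
      by (metis UNIV_I less_irrefl pairing_add_right pairing_scale_right)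
    define c where "c = card (lattice_cosets (ray_lattice J) {x. pairing u x = 0})"
    have index: "int (order (H_group (insert l J))) * pairing u w = \<bar>pairing u (prim_vec l)\<bar> * int c"
      if "l \<notin> J" "insert l J \<in> simplices \<Delta>" "pairing u (prim_vec l) \<noteq> 0" for l
    proof -
      have "ray_lattice (insert l J) = {x + m *s prim_vec l |x m. x \<in> ray_lattice J}"
        unfolding ray_lattice_def by (simp add: generate_insert)
      then show ?thesis
        using card_cosets_insert[OF sub uL w that(3)] order_H_group_full[OF sat_lattice_full[OF full[OF that(1,2)]]]
        by (simp add: c_def)
    qed
    define g where "g = rat_of_int (pairing u w)"
    have g: "g > 0" using w by (simp add: g_def)
    define hi hk where "hi = rat_of_nat (order (H_group (insert i J)))" and "hk = rat_of_nat (order (H_group (insert k J)))"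
    have 1: "hi * g = rat_of_int (pairing u (prim_vec i)) * of_nat c"
      using arg_cong[OF index[OF i(1,2)], of rat_of_int] i(3) by (simp add: hi_def g_def)
    have 2: "hk * g = - rat_of_int (pairing u (prim_vec k)) * of_nat c"
      using arg_cong[OF index[OF k(1,2)], of rat_of_int] k(3) by (simp add: hk_def g_def)
    \<comment> \<open>If \<open>c = 0\<close> the orders are zero, and both quotients are zero by the convention on division.\<close>
    show ?thesis
    proof (cases "c = 0")
      case True
      then have "hi = 0" "hk = 0" using 1 2 g by auto
      then show ?thesis by (simp add: hi_def hk_def)
    next
      case False
      then have "hi > 0" "hk > 0" using 1 2 g i(3) k(3)
        by (simp_all add: zero_less_mult_iff flip: zero_less_mult_pos2)
          (metis mult_pos_pos of_int_0_less_iff of_nat_0_less_iff zero_less_mult_pos2 neg_0_less_iff_less of_int_minus minus_mult_left gr0I)+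
      then have "rat_of_int (pairing u (prim_vec i)) / hi = g / of_nat c"
        "rat_of_int (pairing u (prim_vec k)) / hk = - (g / of_nat c)"
        using 1 2 False by (simp_all add: field_simps)
      then show ?thesis by (simp add: hi_def hk_def)
    qed
  qed
  finally show ?thesis .
qed

text \<open>Clearing denominators shows that an integral basis of the annihilator of \<open>J\<close> is also a rational
  basis of the orthogonal complement of the generators of \<open>J\<close>. The dual vectors of a full simplex
  \<open>I\<close> belonging to \<open>I - J\<close> form another basis of this space, which gives the dimension.\<close>

lemma annihilator_frame:
  assumes I: "I \<in> full_simplices" and J: "J \<subseteq> I" and us: "lattice_basis (ann_lattice J) us"
  defines "vs \<equiv> map vec_of us :: (rat ^ 'n) list"
  shows "length us = CARD('n) - card J" "distinct vs" "vec.independent (set vs)"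
    "vec.span (set vs) = {u. \<forall>j\<in>J. pairing u (qgen j) = 0}"
proof -
  have finI: "finite I" using simplexD(1)[OF full_simplex(1)[OF I]] .
  let ?A = "{u :: rat ^ 'n. \<forall>j\<in>J. pairing u (qgen j) = 0}"
  have subA: "vec.subspace ?A" by (auto simp: vec.subspace_def pairing_add_left pairing_scale_left)
  have basis: "\<And>c. (\<Sum>a<length us. c a *s us ! a) = 0 \<Longrightarrow> \<forall>a<length us. c a = 0"
    and gen: "generate lattice_group (set us) = ann_lattice J"
    using us by (auto simp: lattice_basis_def)
  have nz: "\<forall>a<length us. c a = 0" if sum0: "(\<Sum>a<length us. c a *s vs ! a) = 0" for c :: "nat \<Rightarrow> rat"
  proof -
    obtain d z where d: "d > 0" "\<And>a. a \<in> {..<length us} \<Longrightarrow> of_int d * c a = of_int (z a)"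
      using clear_denominators[of "{..<length us}" c] by blast
    have "vec_of (\<Sum>a<length us. z a *s us ! a) = (\<Sum>a<length us. (of_int d * c a) *s vs ! a)"
      using d(2) by (simp add: vs_def cart_eq_iff sum_component)
    also have "\<dots> = of_int d *s (\<Sum>a<length us. c a *s vs ! a)"
      by (simp add: vec.scale_sum_right)
    also have "\<dots> = 0" using sum0 by simp
    finally have "(\<Sum>a<length us. z a *s us ! a) = 0" by simp
    then have "\<forall>a<length us. z a = 0" by (rule basis)
    then show ?thesis using d by force
  qed
  have "length vs = length us" by (simp add: vs_def)
  then have "distinct vs \<and> vec.independent (set vs)" using nz unfolding independent_list_iff by simp
  then show dist: "distinct vs" and ind: "vec.independent (set vs)" by auto
  show span: "vec.span (set vs) = ?A"
  proof
    have "set us \<subseteq> ann_lattice J" using gen generate.incl by fastforce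
    then have "set vs \<subseteq> ?A" by (auto simp: vs_def ann_lattice_iff pairing_qgen_of_int)
    then show "vec.span (set vs) \<subseteq> ?A" using subA by (rule vec.span_minimal)
    show "?A \<subseteq> vec.span (set vs)"
    proof
      fix u assume u: "u \<in> ?A"
      obtain d z where d: "d > 0" "of_int d *s u = vec_of z" using clear_vec_denominators .
      have "z \<in> ann_lattice J"
        unfolding ann_lattice_iff
      proof
        fix j assume "j \<in> J"
        then have "pairing (of_int d *s u) (qgen j) = 0" using u by (simp add: pairing_scale_left)
        then show "pairing z (prim_vec j) = 0" unfolding d(2) pairing_qgen_of_int by simp
      qed
      have "generate lattice_group (set us) \<subseteq> {x. vec_of x \<in> vec.span (set vs)}"
      proof (rule generate_minimal)
        show "set us \<subseteq> {x. vec_of x \<in> vec.span (set vs)}" by (auto simp: vs_def intro: vec.span_base)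
        show "subgroup {x. vec_of x \<in> vec.span (set vs)} lattice_group"
          unfolding subgroup_lattice_iff by (auto simp: vec_of_add vec_of_minus vec.span_zero vec.span_add vec.span_neg)
      qed
      then have "vec_of z \<in> vec.span (set vs)" using \<open>z \<in> ann_lattice J\<close> gen by auto
      then have "(1 / of_int d) *s (of_int d *s u) \<in> vec.span (set vs)" unfolding d(2) by (rule vec.span_scale)
      then show "u \<in> vec.span (set vs)" using d(1) by (simp add: vector_smult_assoc)
    qed
  qed
  have dinj: "inj_on (dual_vec I) (I - J)"
  proof (rule inj_onI)
    fix i j assume "i \<in> I - J" "j \<in> I - J" "dual_vec I i = dual_vec I j"
    then show "i = j" using dual_vec_pairing[OF I, of i i] dual_vec_pairing[OF I, of j i] by (auto split: if_splits)
  qed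
  have dind: "vec.independent (dual_vec I ` (I - J))"
  proof (subst independent_image_iff[OF _ dinj])
    show "finite (I - J)" using finI by simp
    show "\<forall>c. (\<Sum>i\<in>I - J. c i *s dual_vec I i) = 0 \<longrightarrow> (\<forall>i\<in>I - J. c i = 0)"
    proof (intro allI impI ballI)
      fix c i assume c: "(\<Sum>i\<in>I - J. c i *s dual_vec I i) = 0" and i: "i \<in> I - J"
      have "pairing (\<Sum>i\<in>I - J. c i *s dual_vec I i) (qgen i) = (\<Sum>j\<in>I - J. if j = i then c i else 0)"
        unfolding pairing_sum_left
        by (rule sum.cong) (use i dual_vec_pairing[OF I] in \<open>auto simp: pairing_scale_left\<close>)
      also have "\<dots> = c i" using i finI by simp
      finally show "c i = 0" using c by simp
    qed
  qed
  have "?A = vec.span (dual_vec I ` (I - J))"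
  proof
    show "vec.span (dual_vec I ` (I - J)) \<subseteq> ?A"
    proof (rule vec.span_minimal[OF _ subA])
      show "dual_vec I ` (I - J) \<subseteq> ?A" using J dual_vec_pairing[OF I] by (fastforce split: if_splits)
    qed
    show "?A \<subseteq> vec.span (dual_vec I ` (I - J))"
    proof
      fix u assume u: "u \<in> ?A"
      have "u = (\<Sum>i\<in>I. pairing u (qgen i) *s dual_vec I i)" by (rule dual_expansion[OF I])
      also have "\<dots> = (\<Sum>i\<in>I - J. pairing u (qgen i) *s dual_vec I i)"
        by (rule sum.mono_neutral_right) (use finI u in auto)
      also have "\<dots> \<in> vec.span (dual_vec I ` (I - J))"
        by (intro vec.span_sum vec.span_scale vec.span_base) auto
      finally show "u \<in> vec.span (dual_vec I ` (I - J))" .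
    qed
  qed
  then have "vec.dim ?A = card (I - J)"
    using dind dinj by (simp add: vec.dim_eq_card_independent card_image)
  moreover have "vec.dim ?A = length us"
  proof -
    have "vec.dim (vec.span (set vs)) = card (set vs)" using ind by (simp add: vec.dim_eq_card_independent)
    also have "\<dots> = length us" using distinct_card[OF dist] by (simp add: vs_def)
    finally show ?thesis unfolding span .
  qed
  ultimately show "length us = CARD('n) - card J"
    using J finI full_simplex(2)[OF I] by (simp add: card_Diff_subset finite_subset)
qed

end

section \<open>The push-forward to a point\<close>

lemma lin_form_add: "lin_form (u + v) = lin_form u + lin_form v"
  by (simp add: lin_form_def Const_add distrib_right sum.distrib)

lemma lin_form_scale: "lin_form (c *s u) = Const c * lin_form u"
  by (simp add: lin_form_def Const_mult sum_distrib_left mult.assoc)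

lemma lin_form_0 [simp]: "lin_form 0 = 0"
  by (simp add: lin_form_def)

lemma lin_form_sum: "lin_form (\<Sum>i\<in>A. f i) = (\<Sum>i\<in>A. lin_form (f i))"
  by (induction A rule: infinite_finite_induct) (auto simp: lin_form_add)

lemma lookup_lin_form: "lookup (lin_form u) (single a 1) = vec_nth u a"
proof -
  have eq: "single b 1 = single a (1::nat) \<longleftrightarrow> b = a" for b
    using lookup_single_not_eq[of b a "1::nat"] by (metis lookup_single_eq zero_neq_one)
  have "lookup (lin_form u) (single a 1) =
      (\<Sum>b\<in>UNIV. if b = a then vec_nth u a else 0)"
    unfolding lin_form_def lookup_sum
    by (rule sum.cong) (use eq in \<open>auto simp: lookup_Const_mult Var_def lookup_single when_def\<close>)
  then show ?thesis by simp
qed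

lemma lin_form_eq_0_iff [simp]: "lin_form u = 0 \<longleftrightarrow> u = 0"
proof
  assume "lin_form u = 0"
  then have "vec_nth u a = 0" for a using lookup_lin_form[of u a] by simp
  then show "u = 0" by (simp add: cart_eq_iff)
qed simp

lemma homogeneous_lin_form: "homogeneous 1 (lin_form u)"
  unfolding lin_form_def by (intro homogeneous_sum homogeneous_Const_mult homogeneous_Var)

lemma to_fract_of_nat: "to_fract (of_nat k) = (of_nat k :: 'a::idom fract)"
  by (induction k) auto

lemma to_fract_prod: "to_fract (\<Prod>i\<in>A. f i) = (\<Prod>i\<in>A. to_fract (f i))"
  by (induction A rule: infinite_finite_induct) auto

lemma to_fract_Const_inverse:
  "to_fract (Const (1 / of_nat k)) = 1 / (of_nat k :: 'n::linorder qpoly fract)"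
proof (cases "k = 0")
  case False
  have "to_fract (Const (1 / of_nat k)) * (of_nat k :: 'n qpoly fract) = to_fract (Const (1 / of_nat k) * Const (of_nat k))"
    by (simp add: Const_of_nat to_fract_of_nat)
  also have "\<dots> = 1" using False by (simp add: Const_mult[symmetric])
  finally have eq: "to_fract (Const (1 / of_nat k)) * (of_nat k :: 'n qpoly fract) = 1" .
  then have "(of_nat k :: 'n qpoly fract) \<noteq> 0" by auto
  with eq show ?thesis by (simp add: eq_divide_eq)
qed simp

locale complete_simplicial_fan_ordered = complete_simplicial_fan \<Delta>
  for \<Delta> :: "'n::{finite,linorder} cone set"
begin

abbreviation restriction :: "'n cone set \<Rightarrow> 'n cone qpoly \<Rightarrow> 'n qpoly" where
  "restriction I \<equiv> poly_hom Const (\<lambda>i. lin_form (iota_vec I i))"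

text \<open>The denominator of the localization formula at the fixed point of \<open>I\<close>.\<close>

definition euler :: "'n cone set \<Rightarrow> 'n qpoly fract" where
  "euler I = of_nat (order (H_group I)) * (\<Prod>i\<in>I. to_fract (lin_form (dual_vec I i)))"

definition push :: "'n cone qpoly \<Rightarrow> 'n qpoly fract" where
  "push p = (\<Sum>I\<in>full_simplices. to_fract (restriction I p) / euler I)"

text \<open>The image of \<open>u\<close> under the structure map from the cohomology of the point.\<close>

definition theta :: "rat ^ 'n::{finite,linorder} \<Rightarrow> 'n cone qpoly" where
  "theta u = (\<Sum>i\<in>rays \<Delta>. Const (pairing u (qgen i)) * Var i)"

lemma push_add: "push (p + q) = push p + push q"
  by (simp add: push_def Const_hom.hom_add add_divide_distrib sum.distrib)

lemma push_scale: "push (Const c * p) = to_fract (Const c) * push p"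
  by (simp add: push_def Const_hom.hom_mult sum_distrib_left)

lemma push_0 [simp]: "push 0 = 0"
  by (simp add: push_def)

lemma push_sum: "push (\<Sum>i\<in>A. f i) = (\<Sum>i\<in>A. push (f i))"
  by (induction A rule: infinite_finite_induct) (auto simp: push_add)

lemma sum_rays_iota:
  assumes I: "I \<in> full_simplices"
  shows "(\<Sum>i\<in>rays \<Delta>. pairing u (qgen i) *s iota_vec I i) = u"
proof -
  have "(\<Sum>i\<in>rays \<Delta>. pairing u (qgen i) *s iota_vec I i) = (\<Sum>i\<in>I. pairing u (qgen i) *s iota_vec I i)"
    by (rule sum.mono_neutral_right) (use finite_rays simplexD(2)[OF full_simplex(1)[OF I]] in \<open>auto simp: iota_vec_def\<close>)
  also have "\<dots> = (\<Sum>i\<in>I. pairing u (qgen i) *s dual_vec I i)"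
    by (rule sum.cong) (auto simp: iota_vec_def)
  finally show ?thesis using dual_expansion[OF I, of u] by simp
qed

text \<open>This is the expansion of \<open>u\<close> in the basis dual to the generators of \<open>I\<close>.\<close>

lemma restriction_theta: "I \<in> full_simplices \<Longrightarrow> restriction I (theta u) = lin_form u"
proof -
  assume I: "I \<in> full_simplices"
  have "restriction I (theta u) = lin_form (\<Sum>i\<in>rays \<Delta>. pairing u (qgen i) *s iota_vec I i)"
    by (simp add: theta_def Const_hom.hom_sum Const_hom.hom_mult lin_form_sum lin_form_scale)
  then show ?thesis by (simp add: sum_rays_iota[OF I])
qed

text \<open>The push-forward is linear over the cohomology of the point.\<close>

lemma push_theta: "push (theta u * p) = to_fract (lin_form u) * push p"
  unfolding push_def sum_distrib_left
  by (rule sum.cong) (simp_all add: Const_hom.hom_mult restriction_theta)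

lemma restriction_nonface_monom:
  assumes "I \<in> full_simplices" "keys m \<notin> simplices \<Delta>"
  shows "restriction I (Monom m) = 0"
proof -
  have "\<not> keys m \<subseteq> I" using simplices_subset[OF full_simplex(1)[OF assms(1)]] assms(2) by blast
  then obtain i where i: "i \<in> keys m" "i \<notin> I" by blast
  have "lin_form (iota_vec I i) ^ lookup m i = 0"
    using i by (simp add: iota_vec_def in_keys_iff)
  then show ?thesis unfolding Const_hom.hom_Monom using i(1) by (intro prod_zero) auto
qed

lemma push_nonface_monom: "keys m \<notin> simplices \<Delta> \<Longrightarrow> push (Monom m) = 0"
  by (simp add: push_def restriction_nonface_monom)

lemma restriction_prod_Var: "restriction I (\<Prod>k\<in>K. Var k) = (\<Prod>k\<in>K. lin_form (iota_vec I k))"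
  by (simp add: Const_hom.hom_prod)

lemma restriction_prod_Var_0: "finite K \<Longrightarrow> \<not> K \<subseteq> I \<Longrightarrow> restriction I (\<Prod>k\<in>K. Var k) = 0"
  unfolding restriction_prod_Var by (rule prod_zero) (auto simp: iota_vec_def)

lemma push_nonface_prod: "finite K \<Longrightarrow> K \<notin> simplices \<Delta> \<Longrightarrow> push (\<Prod>k\<in>K. Var k) = 0"
  unfolding push_def
proof (rule sum.neutral, rule ballI)
  fix I assume K: "finite K" "K \<notin> simplices \<Delta>" and I: "I \<in> full_simplices"
  have "\<not> K \<subseteq> I" using simplices_subset[OF full_simplex(1)[OF I]] K(2) by blast
  then show "to_fract (restriction I (\<Prod>k\<in>K. Var k)) / euler I = 0"
    by (simp add: restriction_prod_Var_0[OF K(1)])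
qed

lemma finite_full: "finite full_simplices"
  using finite_simplices by (rule finite_subset[rotated]) (auto simp: simplices_of_card_def)

text \<open>Only the fixed point of \<open>J\<close> itself contributes, and there numerator and denominator cancel up to
  the order of the group.\<close>

lemma push_full_simplex:
  assumes J: "J \<in> full_simplices"
  shows "push (\<Prod>j\<in>J. Var j) = to_fract (Const (1 / of_nat (order (H_group J))))"
proof -
  have finJ: "finite J" using simplexD(1)[OF full_simplex(1)[OF J]] .
  have "push (\<Prod>j\<in>J. Var j) = (\<Sum>I\<in>{J}. to_fract (restriction I (\<Prod>j\<in>J. Var j)) / euler I)"
    unfolding push_def
  proof (rule sum.mono_neutral_right[OF finite_full])
    show "\<forall>I\<in>full_simplices - {J}. to_fract (restriction I (\<Prod>j\<in>J. Var j)) / euler I = 0"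
    proof
      fix I assume I: "I \<in> full_simplices - {J}"
      have "\<not> J \<subseteq> I"
      proof
        assume "J \<subseteq> I"
        then have "J = I" using I J full_simplex(2) simplexD(1)[OF full_simplex(1)] card_subset_eq
          by (metis DiffD1)
        with I show False by simp
      qed
      then show "to_fract (restriction I (\<Prod>j\<in>J. Var j)) / euler I = 0"
        by (simp add: restriction_prod_Var_0[OF finJ])
    qed
  qed (use J in auto)
  also have "restriction J (\<Prod>j\<in>J. Var j) = (\<Prod>j\<in>J. lin_form (dual_vec J j))"
    unfolding restriction_prod_Var by (rule prod.cong) (auto simp: iota_vec_def)
  then have "(\<Sum>I\<in>{J}. to_fract (restriction I (\<Prod>j\<in>J. Var j)) / euler I) =
      (\<Prod>j\<in>J. to_fract (lin_form (dual_vec J j))) / euler J" by (simp add: to_fract_prod)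
  also have "(\<Prod>j\<in>J. to_fract (lin_form (dual_vec J j))) \<noteq> 0"
    using dual_vec_nonzero[OF J] finJ by simp
  then have "(\<Prod>j\<in>J. to_fract (lin_form (dual_vec J j))) / euler J = 1 / of_nat (order (H_group J))"
    by (simp add: euler_def)
  finally show ?thesis by (simp add: to_fract_Const_inverse)
qed

lemma integral_annihilator_exists:
  assumes J: "J \<in> simplices \<Delta>" "card J < CARD('n)"
  obtains u :: "'n lvec" where "u \<noteq> 0" "\<And>j. j \<in> J \<Longrightarrow> pairing u (prim_vec j) = 0"
proof -
  obtain I where I: "I \<in> full_simplices" "J \<subseteq> I" using simplex_in_full_simplex[OF J(1)] .
  have "I \<noteq> J" using full_simplex(2)[OF I(1)] J(2) by auto
  then obtain i where i: "i \<in> I" "i \<notin> J" using I(2) by blast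
  obtain d u where u: "d > 0" "of_int d *s dual_vec I i = vec_of u" using clear_vec_denominators .
  show ?thesis
  proof (rule that)
    have "(vec_of u :: rat ^ 'n::{finite,linorder}) \<noteq> 0" using u dual_vec_nonzero[OF I(1) i(1)] by (simp add: u(2)[symmetric])
    then show "u \<noteq> 0" by simp
    fix j assume j: "j \<in> J"
    then have "pairing (dual_vec I i) (qgen j) = 0" using dual_vec_pairing[OF I(1) i(1), of j] I(2) i(2) by auto
    then have "pairing (of_int d *s dual_vec I i) (qgen j) = 0" by (simp add: pairing_scale_left)
    then show "pairing u (prim_vec j) = 0" unfolding u(2) pairing_qgen_of_int by simp
  qed
qed

text \<open>Take a nonzero \<open>u\<close> that kills the generators of \<open>J\<close>. Multiplying \<open>x\<^sub>J\<close> by \<open>theta u\<close> gives a combination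
  of the \<open>x\<^bsub>J \<union> {i}\<^esub>\<close>. Their push-forwards vanish by induction, except when \<open>J\<close> is a wall, where they
  are constants that cancel by \<open>wall_balance\<close>. So \<open>u\<close> times the push-forward of \<open>x\<^sub>J\<close> is zero.\<close>

lemma push_small_simplex:
  assumes "J \<in> simplices \<Delta>" "card J < CARD('n)"
  shows "push (\<Prod>j\<in>J. Var j) = 0"
  using assms
proof (induction "CARD('n) - card J" arbitrary: J rule: less_induct)
  case less
  note finJ = simplexD(1)[OF less.prems(1)]
  obtain u where u: "u \<noteq> 0" "\<And>j. j \<in> J \<Longrightarrow> pairing u (prim_vec j) = 0"
    by (rule integral_annihilator_exists[OF less.prems]) blast
  let ?u = "vec_of u :: rat ^ 'n::{finite,linorder}"
  let ?N = "{i\<in>rays \<Delta> - J. insert i J \<in> simplices \<Delta>}"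
  have "to_fract (lin_form ?u) * push (\<Prod>j\<in>J. Var j) = push (theta ?u * (\<Prod>j\<in>J. Var j))"
    by (simp add: push_theta)
  also have "theta ?u * (\<Prod>j\<in>J. Var j) = (\<Sum>i\<in>rays \<Delta>. Const (pairing ?u (qgen i)) * (Var i * (\<Prod>j\<in>J. Var j)))"
    by (simp add: theta_def sum_distrib_right mult.assoc)
  also have "push \<dots> = (\<Sum>i\<in>rays \<Delta>. to_fract (Const (pairing ?u (qgen i))) * push (Var i * (\<Prod>j\<in>J. Var j)))"
    by (simp add: push_sum push_scale)
  also have "\<dots> = (\<Sum>i\<in>?N. to_fract (Const (pairing ?u (qgen i))) * push (\<Prod>j\<in>insert i J. Var j))"
  proof (rule sum.mono_neutral_cong_right)
    show "finite (rays \<Delta>)" by (rule finite_rays)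
    show "\<forall>i\<in>rays \<Delta> - ?N. to_fract (Const (pairing ?u (qgen i))) * push (Var i * (\<Prod>j\<in>J. Var j)) = 0"
    proof
      fix i assume i: "i \<in> rays \<Delta> - ?N"
      show "to_fract (Const (pairing ?u (qgen i))) * push (Var i * (\<Prod>j\<in>J. Var j)) = 0"
      proof (cases "i \<in> J")
        case True then show ?thesis using u(2) by (simp add: pairing_qgen_of_int)
      next
        case False
        then have "insert i J \<notin> simplices \<Delta>" using i by auto
        then have "push (\<Prod>j\<in>insert i J. Var j) = 0" using push_nonface_prod finJ by simp
        then show ?thesis using False finJ by simp
      qed
    qed
  qed (use finJ in auto)
  also have "\<dots> = 0"
  proof (cases "card J + 1 = CARD('n)")
    case True
    have "insert i J \<in> full_simplices" if "i \<in> ?N" for i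
      using that True finJ by (auto simp: simplices_of_card_def)
    then have "(\<Sum>i\<in>?N. to_fract (Const (pairing ?u (qgen i))) * push (\<Prod>j\<in>insert i J. Var j))
      = (\<Sum>i\<in>?N. to_fract (Const (rat_of_int (pairing u (prim_vec i)) / rat_of_nat (order (H_group (insert i J))))))"
      by (intro sum.cong refl)
        (simp only: push_full_simplex pairing_qgen_of_int to_fract_mult[symmetric] Const_mult[symmetric] times_divide_eq_right mult_1_right)
    also have "\<dots> = to_fract (Const (\<Sum>i\<in>?N. rat_of_int (pairing u (prim_vec i)) / rat_of_nat (order (H_group (insert i J)))))"
      by (simp only: Const_sum to_fract_sum)
    also have "\<dots> = 0" using wall_balance[OF less.prems(1) True u(2)] by simp
    finally show ?thesis .
  next
    case False
    then have "push (\<Prod>j\<in>insert i J. Var j) = 0" if "i \<in> ?N" for i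
      using that less.prems(2) finJ by (intro less.hyps) auto
    then show ?thesis by simp
  qed
  finally show ?case using u(1) by simp
qed

section \<open>Reduction to squarefree monomials\<close>

lemma theta_Monom: "theta u * Monom m = (\<Sum>l\<in>rays \<Delta>. Const (pairing u (qgen l)) * Monom (single l 1 + m))"
  by (simp add: theta_def sum_distrib_right Monom_add Var_def mult.assoc)

text \<open>The reduction is used twice, for integrality with \<open>E = {0}\<close> and for the main identity with a plane \<open>E\<close>,
  so it is stated for an arbitrary property \<open>P\<close> of a degree and a polynomial. The subspace \<open>E\<close> must
  meet the span of every simplex with fewer than \<open>k\<close> elements only in \<open>0\<close>.\<close>

context
  fixes P :: "nat \<Rightarrow> 'n cone qpoly \<Rightarrow> bool" and E :: "(rat ^ 'n::{finite,linorder}) set" and k :: nat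
  assumes zero: "\<And>d. P d 0" and add: "\<And>d p q. P d p \<Longrightarrow> P d q \<Longrightarrow> P d (p + q)"
    and scale: "\<And>d c p. P d p \<Longrightarrow> P d (Const c * p)"
    and nonface: "\<And>m. keys m \<notin> simplices \<Delta> \<Longrightarrow> P (monom_deg m) (Monom m)"
    and face: "\<And>J. J \<in> simplices \<Delta> \<Longrightarrow> P (card J) (\<Prod>j\<in>J. Var j)"
    and mult: "\<And>d u p. (\<And>e. e \<in> E \<Longrightarrow> pairing u e = 0) \<Longrightarrow> P d p \<Longrightarrow> P (Suc d) (theta u * p)"
    and E: "vec.subspace E"
    and tr: "\<And>K e. K \<in> simplices \<Delta> \<Longrightarrow> card K < k \<Longrightarrow> e \<in> E \<Longrightarrow> e \<in> vec.span (qgen ` K) \<Longrightarrow> e = 0"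
begin

text \<open>Let \<open>x\<^sub>i\<close> be a repeated variable of a monomial with support \<open>K\<close>. A linear form \<open>u\<close> that vanishes on
  \<open>E\<close>, takes the value 1 at the generator of \<open>i\<close> and 0 at the other generators of \<open>K\<close> gives
  \<open>x\<^sub>i = theta u - (\<Sum>l\<notin>K. \<langle>u,v\<^sub>l\<rangle> x\<^sub>l)\<close>. Replacing one factor \<open>x\<^sub>i\<close> by the right-hand side leaves a
  multiple of \<open>theta u\<close>, with a cofactor of smaller degree, and monomials of the same degree with
  larger support. A monomial with a repeated variable has fewer than \<open>k\<close> variables, which is why
  transversality is needed only for such simplices.\<close>

lemma monomial_reduction:
  shows "keys m \<subseteq> rays \<Delta> \<Longrightarrow> monom_deg m \<le> k \<Longrightarrow> P (monom_deg m) (Monom m)"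
proof (induction "monom_deg m" arbitrary: m rule: less_induct)
  case outer: less
  from outer.prems show ?case
    using outer.hyps
  proof (induction "monom_deg m - card (keys m)" arbitrary: m rule: less_induct)
    case (less m)
    let ?K = "keys m"
    show ?case
    proof (cases "?K \<in> simplices \<Delta>")
      case False then show ?thesis by (rule nonface)
    next
      case K: True
      show ?thesis
      proof (cases "\<forall>v. lookup m v \<le> 1")
        case True
        have "monom_deg m = (\<Sum>v\<in>?K. 1)"
          unfolding monom_deg_def
        proof (rule sum.cong[OF refl])
          fix v assume "v \<in> ?K"
          then show "lookup m v = 1" using spec[OF True, of v] by (auto simp: in_keys_iff)
        qed
        then have "monom_deg m = card ?K" by simp
        then show ?thesis using face[OF K] Monom_squarefree[of m] True by simp
      next
        case False
        then obtain i where i: "lookup m i \<ge> 2" by (metis Suc_1 not_less_eq_eq One_nat_def)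
        have iK: "i \<in> ?K" using i by (auto simp: in_keys_iff)
        define m' where "m' = m - single i 1"
        have m: "m = single i 1 + m'"
        proof (rule poly_mapping_eqI)
          fix v show "lookup m v = lookup (single i 1 + m') v"
            using i by (cases "v = i") (auto simp: m'_def lookup_add lookup_minus lookup_single)
        qed
        have K': "keys m' = ?K"
        proof (rule Set.set_eqI)
          fix v show "v \<in> keys m' \<longleftrightarrow> v \<in> ?K"
            using i by (cases "v = i") (auto simp: m'_def in_keys_iff lookup_minus lookup_single)
        qed
        have deg: "monom_deg m = Suc (monom_deg m')" by (subst m) (simp add: monom_deg_add)
        have "card ?K < monom_deg m"
        proof -
          have "card ?K = (\<Sum>v\<in>?K. 1)" by simp
          also have "\<dots> < (\<Sum>v\<in>?K. lookup m v)"
          proof (rule sum_strict_mono_ex1)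
            show "\<forall>x\<in>?K. 1 \<le> lookup m x" by (auto simp: in_keys_iff Suc_le_eq)
            show "\<exists>a\<in>?K. 1 < lookup m a" using i iK by (intro bexI[of _ i]) auto
          qed simp
          finally show ?thesis by (simp add: monom_deg_def)
        qed
        then have cardK: "card ?K < k" using less.prems(2) by simp
        obtain u where u: "\<And>e. e \<in> E \<Longrightarrow> pairing u e = 0" "\<And>j. j \<in> ?K \<Longrightarrow> pairing u (qgen j) = (if j = i then 1 else 0)"
          using dual_functional[OF finite_keys qgen_inj_independent[OF K] E tr[OF K cardK] iK] by blast
        have "P (monom_deg m') (Monom m')"
          using less.prems K' deg by (intro less.prems(3)) auto
        then have base: "P (monom_deg m) (theta u * Monom m')"
          unfolding deg by (rule mult[rotated]) (rule u)
        have step: "P (monom_deg m) (Monom (single l 1 + m'))" if l: "l \<in> rays \<Delta> - ?K" for l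
        proof -
          have keys: "keys (single l 1 + m') = insert l ?K"
          proof (rule Set.set_eqI)
            fix v show "v \<in> keys (single l 1 + m') \<longleftrightarrow> v \<in> insert l ?K"
              unfolding K'[symmetric] by (cases "v = l") (auto simp: in_keys_iff lookup_add lookup_single)
          qed
          have d: "monom_deg (single l 1 + m') = monom_deg m" by (simp add: monom_deg_add deg)
          have c: "card (insert l ?K) = Suc (card ?K)" using l by simp
          have "P (monom_deg (single l 1 + m')) (Monom (single l 1 + m'))"
          proof (rule less.hyps)
            show "monom_deg (single l 1 + m') - card (keys (single l 1 + m'))
               < monom_deg m - card ?K"
              unfolding d keys c using \<open>card ?K < monom_deg m\<close> by simp
            show "keys (single l 1 + m') \<subseteq> rays \<Delta>" using keys l less.prems(1) by auto
            show "monom_deg (single l 1 + m') \<le> k" using d less.prems(2) by simp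
          qed (use less.prems(3) d in auto)
          then show ?thesis using d by simp
        qed
        have "P (monom_deg m) (theta u * Monom m' + (\<Sum>l\<in>A. Const (- pairing u (qgen l)) * Monom (single l 1 + m')))"
          if "finite A" "A \<subseteq> rays \<Delta> - ?K" for A
          using that
        proof (induction A)
          case empty then show ?case using base by simp
        next
          case (insert l A)
          have IH: "P (monom_deg m) (theta u * Monom m' + (\<Sum>l\<in>A. Const (- pairing u (qgen l)) * Monom (single l 1 + m')))"
            using insert by auto
          have "P (monom_deg m) (Const (- pairing u (qgen l)) * Monom (single l 1 + m'))"
            by (rule scale, rule step) (use insert.prems in auto)
          from add[OF IH this]
          have "P (monom_deg m) ((theta u * Monom m' + (\<Sum>l\<in>A. Const (- pairing u (qgen l)) * Monom (single l 1 + m')))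
             + Const (- pairing u (qgen l)) * Monom (single l 1 + m'))" .
          then show ?case using insert by (simp add: algebra_simps)
        qed
        then have "P (monom_deg m) (theta u * Monom m' + (\<Sum>l\<in>rays \<Delta> - ?K. Const (- pairing u (qgen l)) * Monom (single l 1 + m')))"
          using finite_rays by blast
        also have "theta u * Monom m' + (\<Sum>l\<in>rays \<Delta> - ?K. Const (- pairing u (qgen l)) * Monom (single l 1 + m')) = Monom m"
        proof -
          have "theta u * Monom m' = (\<Sum>l\<in>?K. Const (pairing u (qgen l)) * Monom (single l 1 + m'))
              + (\<Sum>l\<in>rays \<Delta> - ?K. Const (pairing u (qgen l)) * Monom (single l 1 + m'))"
            unfolding theta_Monom using less.prems(1) finite_rays by (subst sum.subset_diff[of ?K]) (auto simp: add.commute)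
          also have "(\<Sum>l\<in>?K. Const (pairing u (qgen l)) * Monom (single l 1 + m')) = (\<Sum>l\<in>?K. if l = i then Monom m else 0)"
            by (rule sum.cong) (auto simp: u(2) m[symmetric] simp del: One_nat_def)
          also have "\<dots> = Monom m" using iK by simp
          finally show ?thesis
            by (simp add: sum.distrib[symmetric] distrib_right[symmetric] Const_add[symmetric] add.assoc)
        qed
        finally show ?thesis .
      qed
    qed
  qed
qed

theorem homogeneous_reduction:
  assumes p: "vars p \<subseteq> rays \<Delta>" "homogeneous k p"
  shows "P k p"
proof -
  have "P k (\<Sum>m\<in>A. Const (c m) * Monom m)" if "finite A" "A \<subseteq> keys p" for A c
    using that
  proof induction
    case empty then show ?case by (simp add: zero)
  next
    case (insert m A)
    have "keys m \<subseteq> rays \<Delta>" using insert.prems p(1) by (auto simp: vars_def)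
    moreover have deg: "monom_deg m = k" using insert.prems p(2) by (auto simp: homogeneous_iff)
    ultimately have "P (monom_deg m) (Monom m)" by (intro monomial_reduction) auto
    then have "P k (Const (c m) * Monom m)" unfolding deg by (rule scale)
    then show ?case using insert add by simp
  qed
  then show ?thesis by (subst qpoly_eq_sum_monoms) auto
qed

end

section \<open>Integrality of the push-forward\<close>

text \<open>Besides integrality, this records that the push-forward lowers the degree by the dimension; in
  particular it is zero in degrees below the dimension.\<close>

definition push_integral :: "nat \<Rightarrow> 'n cone qpoly \<Rightarrow> bool" where
  "push_integral d p \<longleftrightarrow> (\<exists>q. push p = to_fract q \<and> (\<forall>m\<in>keys q. monom_deg m + CARD('n) = d))"

lemma push_integral_0: "push p = 0 \<Longrightarrow> push_integral d p"
  unfolding push_integral_def by (rule exI[of _ 0]) simp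

lemma push_integral_add: "push_integral d p \<Longrightarrow> push_integral d q \<Longrightarrow> push_integral d (p + q)"
  unfolding push_integral_def
proof (elim exE conjE)
  fix a b assume "push p = to_fract a" "push q = to_fract b"
    "\<forall>m\<in>keys a. monom_deg m + CARD('n) = d" "\<forall>m\<in>keys b. monom_deg m + CARD('n) = d"
  then show "\<exists>c. push (p + q) = to_fract c \<and> (\<forall>m\<in>keys c. monom_deg m + CARD('n) = d)"
    using Poly_Mapping.keys_add[of a b] by (intro exI[of _ "a + b"]) (auto simp: push_add)
qed

lemma push_integral_scale: "push_integral d p \<Longrightarrow> push_integral d (Const c * p)"
  unfolding push_integral_def
proof (elim exE conjE)
  fix a assume "push p = to_fract a" "\<forall>m\<in>keys a. monom_deg m + CARD('n) = d"
  then show "\<exists>b. push (Const c * p) = to_fract b \<and> (\<forall>m\<in>keys b. monom_deg m + CARD('n) = d)"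
    by (intro exI[of _ "Const c * a"]) (auto simp: push_scale in_keys_iff lookup_Const_mult)
qed

lemma push_integral_theta: "push_integral d p \<Longrightarrow> push_integral (Suc d) (theta u * p)"
  unfolding push_integral_def
proof (elim exE conjE)
  fix a assume a: "push p = to_fract a" "\<forall>m\<in>keys a. monom_deg m + CARD('n) = d"
  have "monom_deg m + CARD('n) = Suc d" if m: "m \<in> keys (lin_form u * a)" for m
  proof -
    obtain m1 m2 where "m = m1 + m2" "m1 \<in> keys (lin_form u)" "m2 \<in> keys a"
      using Poly_Mapping.keys_mult[of "lin_form u" a] m by blast
    then show ?thesis using a(2) homogeneous_lin_form[of u] by (auto simp: homogeneous_iff monom_deg_add)
  qed
  then show "\<exists>b. push (theta u * p) = to_fract b \<and> (\<forall>m\<in>keys b. monom_deg m + CARD('n) = Suc d)"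
    using a by (intro exI[of _ "lin_form u * a"]) (auto simp: push_theta)
qed

lemma push_integral_face:
  assumes "J \<in> simplices \<Delta>"
  shows "push_integral (card J) (\<Prod>j\<in>J. Var j)"
proof -
  have "card J \<le> CARD('n)"
  proof -
    obtain I where I: "I \<in> full_simplices" "J \<subseteq> I" using simplex_in_full_simplex[OF assms] .
    then show ?thesis using card_mono[OF simplexD(1)[OF full_simplex(1)[OF I(1)]] I(2)] full_simplex(2) by simp
  qed
  then consider "card J < CARD('n)" | "J \<in> full_simplices" using assms by (fastforce simp: simplices_of_card_def)
  then show ?thesis
  proof cases
    case 1 then show ?thesis using push_small_simplex[OF assms] by (intro push_integral_0)
  next
    case 2
    then show ?thesis unfolding push_integral_def
      by (intro exI[of _ "Const (1 / of_nat (order (H_group J)))"])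
        (auto simp: push_full_simplex full_simplex(2) Const_def split: if_splits)
  qed
qed

text \<open>For \<open>E = {0}\<close> transversality is automatic, and the reduction leaves only squarefree monomials,
  whose push-forwards are constants.\<close>

theorem push_integral:
  assumes "vars p \<subseteq> rays \<Delta>" "homogeneous d p"
  shows "push_integral d p"
proof (rule homogeneous_reduction[where P = push_integral and E = "{0}"])
  show "push_integral (monom_deg m) (Monom m)" if "keys m \<notin> simplices \<Delta>" for m
    using push_nonface_monom[OF that] by (rule push_integral_0)
qed (use assms in \<open>auto intro: push_integral_0 push_integral_add push_integral_scale push_integral_face push_integral_theta\<close>)

end

section \<open>Passing to the Stanley--Reisner ring\<close>

lemma ray_poly_ring_simps [simp]:
  "carrier (ray_poly_ring \<Delta>) = {p. vars p \<subseteq> rays \<Delta>}"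
  "p \<otimes>\<^bsub>ray_poly_ring \<Delta>\<^esub> q = p * q" "p \<oplus>\<^bsub>ray_poly_ring \<Delta>\<^esub> q = p + q"
  "\<one>\<^bsub>ray_poly_ring \<Delta>\<^esub> = 1" "\<zero>\<^bsub>ray_poly_ring \<Delta>\<^esub> = 0"
  by (simp_all add: ray_poly_ring_def)

lemma cring_ray_poly_ring: "cring (ray_poly_ring (\<Delta> :: 'n::finite cone set))"
proof (rule cringI)
  show "abelian_group (ray_poly_ring \<Delta>)"
  proof (rule abelian_groupI)
    fix p assume "p \<in> carrier (ray_poly_ring \<Delta>)"
    then show "\<exists>q\<in>carrier (ray_poly_ring \<Delta>). q \<oplus>\<^bsub>ray_poly_ring \<Delta>\<^esub> p = \<zero>\<^bsub>ray_poly_ring \<Delta>\<^esub>"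
      by (intro bexI[of _ "- p"]) auto
  qed (use vars_add in \<open>fastforce simp: add_ac\<close>)+
  show "comm_monoid (ray_poly_ring \<Delta>)"
    by (rule comm_monoidI) (use vars_mult in \<open>fastforce simp: mult_ac\<close>)+
qed (simp add: distrib_right)

lemma uminus_ray_poly_ring:
  assumes "vars p \<subseteq> rays \<Delta>"
  shows "\<ominus>\<^bsub>ray_poly_ring \<Delta>\<^esub> p = - p"
proof -
  interpret R: cring "ray_poly_ring \<Delta>" by (rule cring_ray_poly_ring)
  show ?thesis by (rule R.minus_equality) (use assms in auto)
qed

lemma ideal_SR: "ideal (SR_ideal \<Delta>) (ray_poly_ring \<Delta>)"
proof -
  interpret R: cring "ray_poly_ring \<Delta>" by (rule cring_ray_poly_ring)
  show ?thesis unfolding SR_ideal_def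
  proof (rule R.genideal_ideal, rule subsetI)
    fix p assume "p \<in> {\<Prod>i\<in>K. Var i |K. K \<subseteq> rays \<Delta> \<and> K \<notin> simplices \<Delta>}"
    then obtain K where K: "K \<subseteq> rays \<Delta>" "p = (\<Prod>i\<in>K. Var i)" by blast
    have "vars p \<subseteq> rays \<Delta>" unfolding K(2) by (rule vars_prod_subset) (use K(1) in auto)
    then show "p \<in> carrier (ray_poly_ring \<Delta>)" by simp
  qed
qed

text \<open>The kernel of a ring homomorphism is an ideal, so it contains the Stanley--Reisner ideal once it
  contains the monomials of the nonfaces.\<close>

lemma (in rat_algebra) hom_SR_ideal:
  assumes K: "\<And>K. K \<subseteq> rays \<Delta> \<Longrightarrow> K \<notin> simplices \<Delta> \<Longrightarrow> (\<Prod>i\<in>K. h i) = 0" and p: "p \<in> SR_ideal \<Delta>"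
  shows "poly_hom c h p = 0"
proof -
  interpret R: cring "ray_poly_ring \<Delta>" by (rule cring_ray_poly_ring)
  let ?k = "{p \<in> carrier (ray_poly_ring \<Delta>). poly_hom c h p = 0}"
  have "ideal ?k (ray_poly_ring \<Delta>)"
  proof (rule idealI[OF R.ring_axioms])
    show "subgroup ?k (add_monoid (ray_poly_ring \<Delta>))"
    proof (rule R.add.subgroupI)
      fix p assume "p \<in> ?k"
      then show "\<ominus>\<^bsub>ray_poly_ring \<Delta>\<^esub> p \<in> ?k"
        using uminus_ray_poly_ring[of p \<Delta>] by (simp add: hom_uminus)
    next
      fix p q assume "p \<in> ?k" "q \<in> ?k"
      then show "p \<oplus>\<^bsub>ray_poly_ring \<Delta>\<^esub> q \<in> ?k"
        using vars_add[of p q] by (auto simp: hom_add)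
    qed (auto intro: exI[of _ 0])
  next
    fix a x assume "a \<in> ?k" "x \<in> carrier (ray_poly_ring \<Delta>)"
    then show "x \<otimes>\<^bsub>ray_poly_ring \<Delta>\<^esub> a \<in> ?k" "a \<otimes>\<^bsub>ray_poly_ring \<Delta>\<^esub> x \<in> ?k"
      using vars_mult[of a x] vars_mult[of x a] by (auto simp: hom_mult)
  qed
  moreover have "{\<Prod>i\<in>K. Var i |K. K \<subseteq> rays \<Delta> \<and> K \<notin> simplices \<Delta>} \<subseteq> ?k"
  proof
    fix q assume "q \<in> {\<Prod>i\<in>K. Var i |K. K \<subseteq> rays \<Delta> \<and> K \<notin> simplices \<Delta>}"
    then obtain K where q: "q = (\<Prod>i\<in>K. Var i)" "K \<subseteq> rays \<Delta>" "K \<notin> simplices \<Delta>" by blast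
    have "vars q \<subseteq> rays \<Delta>" unfolding q(1) by (rule vars_prod_subset) (use q in auto)
    then show "q \<in> ?k" using K[OF q(2,3)] by (simp add: q(1) hom_prod)
  qed
  ultimately have "SR_ideal \<Delta> \<subseteq> ?k" unfolding SR_ideal_def by (rule R.genideal_minimal)
  then show ?thesis using p by blast
qed

lemma HT_class_eq: "HT_class \<Delta> p = (\<lambda>h. h + p) ` SR_ideal \<Delta>"
  by (auto simp: HT_class_def a_r_coset_def r_coset_def)

lemma (in rat_algebra) the_elem_HT_class:
  assumes K: "\<And>K. K \<subseteq> rays \<Delta> \<Longrightarrow> K \<notin> simplices \<Delta> \<Longrightarrow> (\<Prod>i\<in>K. h i) = 0"
  shows "the_elem (poly_hom c h ` HT_class \<Delta> p) = poly_hom c h p"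
proof -
  have "0 \<in> SR_ideal \<Delta>" using additive_subgroup.zero_closed[OF ideal.axioms(1)[OF ideal_SR[of \<Delta>]]] by simp
  then have "poly_hom c h ` HT_class \<Delta> p = {poly_hom c h p}"
    using hom_SR_ideal[OF K] unfolding HT_class_eq by (force simp: hom_add)
  then show ?thesis by simp
qed

lemma ring_HT: "ring (HT \<Delta>)"
  unfolding HT_def by (rule ideal.quotient_is_ring[OF ideal_SR])

lemma HT_class_hom: "HT_class \<Delta> \<in> Ring.ring_hom (ray_poly_ring \<Delta>) (HT \<Delta>)"
  using ideal.rcos_ring_hom[OF ideal_SR[of \<Delta>]] unfolding HT_class_def[abs_def] HT_def by simp

lemma HT_class_mult:
  "vars p \<subseteq> rays \<Delta> \<Longrightarrow> vars q \<subseteq> rays \<Delta> \<Longrightarrow> HT_class \<Delta> p \<otimes>\<^bsub>HT \<Delta>\<^esub> HT_class \<Delta> q = HT_class \<Delta> (p * q)"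
  using Ring.ring_hom_mult[OF HT_class_hom[of \<Delta>], of p q] by simp

lemma HT_class_power:
  assumes "vars p \<subseteq> rays \<Delta>"
  shows "HT_class \<Delta> p [^]\<^bsub>HT \<Delta>\<^esub> (m::nat) = HT_class \<Delta> (p ^ m)"
proof -
  interpret H: ring "HT \<Delta>" by (rule ring_HT)
  show ?thesis
  proof (induction m)
    case 0
    then show ?case using Ring.ring_hom_one[OF HT_class_hom[of \<Delta>]] by simp
  next
    case (Suc m)
    have "HT_class \<Delta> p [^]\<^bsub>HT \<Delta>\<^esub> Suc m = HT_class \<Delta> (p ^ m) \<otimes>\<^bsub>HT \<Delta>\<^esub> HT_class \<Delta> p"
      by (simp add: Suc)
    also have "\<dots> = HT_class \<Delta> (p ^ m * p)"
      by (rule HT_class_mult) (use assms vars_power_subset[OF assms, of m] in auto)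
    finally show ?case by (simp add: mult.commute)
  qed
qed

context complete_simplicial_fan_ordered
begin

lemma iota_class:
  assumes "I \<in> full_simplices"
  shows "iota I (HT_class \<Delta> p) = restriction I p"
  unfolding iota_def
proof (rule Const_hom.the_elem_HT_class)
  fix K assume K: "K \<subseteq> rays \<Delta>" "K \<notin> simplices \<Delta>"
  then have "\<not> K \<subseteq> I" using simplices_subset[OF full_simplex(1)[OF assms]] by blast
  then show "(\<Prod>i\<in>K. lin_form (iota_vec I i)) = 0"
    using finite_subset[OF K(1) finite_rays] by (intro prod_zero) (auto simp: iota_vec_def)
qed

lemma pi_star_class: "pi_star \<Delta> (HT_class \<Delta> p) = push p"
  unfolding pi_star_def push_def euler_def
  by (rule sum.cong) (simp_all add: iota_class)

definition push_poly :: "'n cone qpoly \<Rightarrow> 'n qpoly" where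
  "push_poly p = (THE q. to_fract q = push p)"

lemma p_star_class: "p_star \<Delta> (HT_class \<Delta> p) = lookup (push_poly p) 0"
  by (simp add: p_star_def pi_star_class push_poly_def)

lemma push_poly_eq: "push p = to_fract q \<Longrightarrow> push_poly p = q"
  unfolding push_poly_def by (rule the_equality) auto

lemma push_poly_integral:
  assumes "push_integral d p"
  shows "push p = to_fract (push_poly p)" "\<And>m. m \<in> keys (push_poly p) \<Longrightarrow> monom_deg m + CARD('n) = d"
  using assms push_poly_eq unfolding push_integral_def by auto

text \<open>The contribution of \<open>\<xi>\<^sup>m / m!\<close> to the push-forward of \<open>e\<^sup>\<xi> p\<close>. For \<open>p\<close> of degree \<open>k\<close> only
  \<open>m = n - k\<close> matters, and for this \<open>m\<close> it is treated below as a linear functional of \<open>p\<close>.\<close>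

definition top_pairing :: "nat \<Rightarrow> 'n cone qpoly \<Rightarrow> 'n cone qpoly \<Rightarrow> rat" where
  "top_pairing m z p = lookup (push_poly (Const (1 / fact m) * z ^ m * p)) 0"

lemma push_integral_top:
  assumes "vars z \<subseteq> rays \<Delta>" "homogeneous 1 z" "vars p \<subseteq> rays \<Delta>" "homogeneous d p"
  shows "push_integral (m + d) (Const (1 / fact m) * z ^ m * p)"
proof (rule push_integral)
  show "vars (Const (1 / fact m) * z ^ m * p) \<subseteq> rays \<Delta>"
    using vars_mult[of "Const (1 / fact m)" "z ^ m"] vars_mult[of "Const (1 / fact m) * z ^ m" p]
      vars_power_subset[OF assms(1), of m] assms(3) by auto
  show "homogeneous (m + d) (Const (1 / fact m) * z ^ m * p)"
    using homogeneous_mult[OF homogeneous_Const_mult[OF homogeneous_power[OF assms(2), of m]] assms(4)] by simp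
qed

text \<open>By \<open>push_integral\<close>, a nonzero constant term requires total degree \<open>m + k = n\<close>.\<close>

lemma p_star_exp_class:
  assumes z: "vars z \<subseteq> rays \<Delta>" "homogeneous 1 z" and p: "vars p \<subseteq> rays \<Delta>" "homogeneous k p"
    and k: "k \<le> CARD('n)"
  shows "p_star_exp \<Delta> (HT_class \<Delta> z) (HT_class \<Delta> p) = top_pairing (CARD('n) - k) z p"
proof -
  have summand: "p_star \<Delta> (HT_class \<Delta> (Const (1 / fact m)) \<otimes>\<^bsub>HT \<Delta>\<^esub> (HT_class \<Delta> z [^]\<^bsub>HT \<Delta>\<^esub> m) \<otimes>\<^bsub>HT \<Delta>\<^esub> HT_class \<Delta> p)
      = top_pairing m z p" for m
  proof -
    have v: "vars (Const (1 / fact m) * z ^ m) \<subseteq> rays \<Delta>"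
      using vars_mult[of "Const (1 / fact m)" "z ^ m"] vars_power_subset[OF z(1), of m] by auto
    have "HT_class \<Delta> (Const (1 / fact m)) \<otimes>\<^bsub>HT \<Delta>\<^esub> (HT_class \<Delta> z [^]\<^bsub>HT \<Delta>\<^esub> m) \<otimes>\<^bsub>HT \<Delta>\<^esub> HT_class \<Delta> p
        = HT_class \<Delta> (Const (1 / fact m) * z ^ m * p)"
      unfolding HT_class_power[OF z(1)]
      using v p(1) vars_power_subset[OF z(1), of m] by (simp add: HT_class_mult)
    then show ?thesis by (simp add: p_star_class top_pairing_def)
  qed
  have zero: "top_pairing m z p = 0" if "m \<noteq> CARD('n) - k" for m
  proof -
    let ?p = "Const (1 / fact m) * z ^ m * p"
    have "push_integral (m + k) ?p" by (rule push_integral_top[OF z p])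
    from push_poly_integral(2)[OF this, of 0] that k
    have "0 \<notin> keys (push_poly ?p)" by auto
    then show ?thesis by (simp add: top_pairing_def in_keys_iff)
  qed
  have "Sum_any (\<lambda>m. top_pairing m z p) = (\<Sum>m\<in>{CARD('n) - k}. top_pairing m z p)"
    by (rule Sum_any.expand_superset) (use zero in auto)
  then show ?thesis by (simp add: p_star_exp_def summand)
qed

text \<open>The constant term of a push-forward is additive only where the push-forward is a polynomial.\<close>

definition top_integral :: "nat \<Rightarrow> 'n cone qpoly \<Rightarrow> 'n cone qpoly \<Rightarrow> bool" where
  "top_integral m z p \<longleftrightarrow> (\<exists>q. push (Const (1 / fact m) * z ^ m * p) = to_fract q)"

lemma top_integral_homogeneous:
  assumes "vars z \<subseteq> rays \<Delta>" "homogeneous 1 z" "vars p \<subseteq> rays \<Delta>" "homogeneous d p"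
  shows "top_integral m z p"
  using push_integral_top[OF assms] unfolding push_integral_def top_integral_def by blast

lemma top_eq: "push (Const (1 / fact m) * z ^ m * p) = to_fract q \<Longrightarrow> top_pairing m z p = lookup q 0"
  by (simp add: top_pairing_def push_poly_eq)

lemma top_add:
  assumes "top_integral m z p" "top_integral m z q"
  shows "top_integral m z (p + q) \<and> top_pairing m z (p + q) = top_pairing m z p + top_pairing m z q"
proof -
  obtain a b where ab: "push (Const (1 / fact m) * z ^ m * p) = to_fract a" "push (Const (1 / fact m) * z ^ m * q) = to_fract b"
    using assms by (auto simp: top_integral_def)
  have s: "push (Const (1 / fact m) * z ^ m * (p + q)) = to_fract (a + b)" by (simp add: distrib_left push_add ab)
  show ?thesis
  proof
    show "top_integral m z (p + q)" unfolding top_integral_def using s by blast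
    show "top_pairing m z (p + q) = top_pairing m z p + top_pairing m z q"
      using top_eq[OF ab(1)] top_eq[OF ab(2)] top_eq[OF s] by (simp add: lookup_add)
  qed
qed

lemma top_scale:
  assumes "top_integral m z p"
  shows "top_integral m z (Const c * p) \<and> top_pairing m z (Const c * p) = c * top_pairing m z p"
proof -
  obtain a where a: "push (Const (1 / fact m) * z ^ m * p) = to_fract a"
    using assms by (auto simp: top_integral_def)
  have "push (Const (1 / fact m) * z ^ m * (Const c * p)) = push (Const c * (Const (1 / fact m) * z ^ m * p))"
    by (simp add: mult_ac)
  from this have s: "push (Const (1 / fact m) * z ^ m * (Const c * p)) = to_fract (Const c * a)"
    by (simp add: push_scale a)
  show ?thesis
  proof
    show "top_integral m z (Const c * p)" unfolding top_integral_def using s by blast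
    show "top_pairing m z (Const c * p) = c * top_pairing m z p"
      using top_eq[OF a] top_eq[OF s] by (simp add: lookup_Const_mult)
  qed
qed

text \<open>A polynomial multiple of a linear form has no constant term.\<close>

lemma top_theta:
  assumes "top_integral m z p"
  shows "top_integral m z (theta u * p) \<and> top_pairing m z (theta u * p) = 0"
proof -
  obtain a where a: "push (Const (1 / fact m) * z ^ m * p) = to_fract a"
    using assms by (auto simp: top_integral_def)
  have "push (Const (1 / fact m) * z ^ m * (theta u * p)) = push (theta u * (Const (1 / fact m) * z ^ m * p))"
    by (simp add: mult_ac)
  then have s: "push (Const (1 / fact m) * z ^ m * (theta u * p)) = to_fract (lin_form u * a)"
    by (simp add: push_theta a)
  have "0 \<notin> keys (lin_form u * a)"
  proof
    assume "0 \<in> keys (lin_form u * a)"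
    then obtain m1 m2 where "0 = m1 + m2" "m1 \<in> keys (lin_form u)"
      using Poly_Mapping.keys_mult[of "lin_form u" a] by blast
    then have "monom_deg m1 = 1" "monom_deg (m1 + m2) = 0"
      using homogeneous_lin_form[of u] by (auto simp: homogeneous_iff)
    then show False by (simp add: monom_deg_add)
  qed
  then have "top_pairing m z (theta u * p) = 0" using top_eq[OF s] by (simp add: in_keys_iff)
  moreover have "top_integral m z (theta u * p)" unfolding top_integral_def using s by blast
  ultimately show ?thesis by simp
qed

lemma top_nonface:
  assumes "keys m' \<notin> simplices \<Delta>"
  shows "top_integral m z (Monom m') \<and> top_pairing m z (Monom m') = 0"
proof -
  have "push (Const (1 / fact m) * z ^ m * Monom m') = to_fract 0"
    unfolding push_def using restriction_nonface_monom[OF _ assms] by (simp add: Const_hom.hom_mult)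
  then show ?thesis using top_eq[of m z "Monom m'" 0] unfolding top_integral_def by (metis lookup_zero)
qed

end

section \<open>The function field of the Grassmannian\<close>

lemma ext_forms_0 [simp]: "0 \<in> ext_forms r d"
  by (simp add: ext_forms_def)

lemma ext_forms_Const [simp]: "Const c \<in> ext_forms r 0"
  by (simp add: ext_forms_def)

lemma ext_forms_1 [simp]: "1 \<in> ext_forms r 0"
  by (simp add: ext_forms_def)

lemma ext_forms_add: "P \<in> ext_forms r d \<Longrightarrow> Q \<in> ext_forms r d \<Longrightarrow> P + Q \<in> ext_forms r d"
  using vars_add[of P Q] by (auto simp: ext_forms_def homogeneous_add)

lemma ext_forms_diff: "P \<in> ext_forms r d \<Longrightarrow> Q \<in> ext_forms r d \<Longrightarrow> P - Q \<in> ext_forms r d"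
  using vars_diff[of P Q] by (auto simp: ext_forms_def homogeneous_diff)

lemma ext_forms_mult: "P \<in> ext_forms r d \<Longrightarrow> Q \<in> ext_forms r e \<Longrightarrow> P * Q \<in> ext_forms r (d + e)"
  using vars_mult[of P Q] by (auto simp: ext_forms_def homogeneous_mult)

lemma ext_forms_scale: "P \<in> ext_forms r d \<Longrightarrow> Const c * P \<in> ext_forms r d"
  using ext_forms_mult[OF ext_forms_Const] by fastforce

lemma ext_forms_sum: "(\<And>i. i \<in> A \<Longrightarrow> f i \<in> ext_forms r d) \<Longrightarrow> sum f A \<in> ext_forms r d"
  by (induction A rule: infinite_finite_induct) (auto intro: ext_forms_add)

lemma ext_forms_prod: "(\<And>i. i \<in> A \<Longrightarrow> f i \<in> ext_forms r d) \<Longrightarrow> prod f A \<in> ext_forms r (d * card A)"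
  by (induction A rule: infinite_finite_induct) (auto intro: ext_forms_mult)

lemma vanishes_0 [simp]: "vanishes_on_grassmannian r 0"
  by (simp add: vanishes_on_grassmannian_def)

lemma vanishes_add: "vanishes_on_grassmannian r P \<Longrightarrow> vanishes_on_grassmannian r Q \<Longrightarrow> vanishes_on_grassmannian r (P + Q)"
  by (simp add: vanishes_on_grassmannian_def id_hom.hom_add)

lemma vanishes_mult: "vanishes_on_grassmannian r P \<Longrightarrow> vanishes_on_grassmannian r (P * Q)"
  by (simp add: vanishes_on_grassmannian_def id_hom.hom_mult)

lemma not_vanishes_mult:
  "P \<in> ext_forms r d \<Longrightarrow> Q \<in> ext_forms r e \<Longrightarrow> \<not> vanishes_on_grassmannian r P \<Longrightarrow> \<not> vanishes_on_grassmannian r Q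
    \<Longrightarrow> \<not> vanishes_on_grassmannian r (P * Q)"
  by (rule vanishing_ideal_prime[of d P e Q]) (auto simp: ext_forms_def)

lemma not_vanishes_prod:
  fixes f :: "'i \<Rightarrow> 'n::{finite,linorder} list qpoly"
  assumes "\<not> vanishes_on_grassmannian r (1 :: 'n list qpoly)" "\<And>i. i \<in> A \<Longrightarrow> f i \<in> ext_forms r d"
    "\<And>i. i \<in> A \<Longrightarrow> \<not> vanishes_on_grassmannian r (f i)"
  shows "\<not> vanishes_on_grassmannian r (prod f A)"
  using assms(2,3)
proof (induction A rule: infinite_finite_induct)
  case (insert i A)
  then show ?case
    using not_vanishes_mult[of "f i" r d "prod f A" "d * card A"] ext_forms_prod[of A f r d] by auto
qed (use assms(1) in auto)

lemma plucker_local_ring_simps [simp]: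
  "f \<otimes>\<^bsub>plucker_local_ring r\<^esub> g = f * g" "f \<oplus>\<^bsub>plucker_local_ring r\<^esub> g = f + g"
  "\<one>\<^bsub>plucker_local_ring r\<^esub> = 1" "\<zero>\<^bsub>plucker_local_ring r\<^esub> = 0"
  by (simp_all add: plucker_local_ring_def)

lemma plucker_local_ringI:
  "P \<in> ext_forms r d \<Longrightarrow> Q \<in> ext_forms r d \<Longrightarrow> \<not> vanishes_on_grassmannian r Q \<Longrightarrow> to_fract P / to_fract Q \<in> carrier (plucker_local_ring r)"
  unfolding plucker_local_ring_def Fract_conv_to_fract by auto

lemma plucker_local_ringE:
  assumes "f \<in> carrier (plucker_local_ring r)"
  obtains P Q d where "P \<in> ext_forms r d" "Q \<in> ext_forms r d" "\<not> vanishes_on_grassmannian r Q" "Q \<noteq> 0"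
    "f = to_fract P / to_fract Q"
proof -
  obtain P Q d where "P \<in> ext_forms r d" "Q \<in> ext_forms r d" "\<not> vanishes_on_grassmannian r Q" "f = to_fract P / to_fract Q"
    using assms unfolding plucker_local_ring_def Fract_conv_to_fract by auto
  moreover from this have "Q \<noteq> 0" by auto
  ultimately show ?thesis using that by blast
qed

lemma plucker_max_idealI:
  "P \<in> ext_forms r d \<Longrightarrow> Q \<in> ext_forms r d \<Longrightarrow> vanishes_on_grassmannian r P \<Longrightarrow> \<not> vanishes_on_grassmannian r Q
    \<Longrightarrow> to_fract P / to_fract Q \<in> plucker_max_ideal r"
  unfolding plucker_max_ideal_def Fract_conv_to_fract by auto

lemma plucker_max_idealE:
  assumes "f \<in> plucker_max_ideal r"
  obtains P Q d where "P \<in> ext_forms r d" "Q \<in> ext_forms r d" "vanishes_on_grassmannian r P"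
    "\<not> vanishes_on_grassmannian r Q" "Q \<noteq> 0" "f = to_fract P / to_fract Q"
proof -
  obtain P Q d where "P \<in> ext_forms r d" "Q \<in> ext_forms r d" "vanishes_on_grassmannian r P"
    "\<not> vanishes_on_grassmannian r Q" "f = to_fract P / to_fract Q"
    using assms unfolding plucker_max_ideal_def Fract_conv_to_fract by auto
  moreover from this have "Q \<noteq> 0" by auto
  ultimately show ?thesis using that by blast
qed

text \<open>Where the constant 1 vanishes, that is, on an empty Grassmannian, the local ring would be empty.
  The type argument only fixes the ambient space.\<close>

locale nonempty_grassmannian =
  fixes r :: nat and TYPE_n :: "'n::{finite,linorder} itself"
  assumes one_not_vanishing: "\<not> vanishes_on_grassmannian r (1 :: 'n list qpoly)"
begin

abbreviation R :: "'n list qpoly fract ring" where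
  "R \<equiv> plucker_local_ring r"

lemma const_in_R: "to_fract (Const c) \<in> carrier R"
  using plucker_local_ringI[OF ext_forms_Const ext_forms_1 one_not_vanishing, of c] by simp

lemma add_in_R: "f \<in> carrier R \<Longrightarrow> g \<in> carrier R \<Longrightarrow> f + g \<in> carrier R"
proof (elim plucker_local_ringE)
  fix P Q d P' Q' e
  assume h: "P \<in> ext_forms r d" "Q \<in> ext_forms r d" "\<not> vanishes_on_grassmannian r Q" "Q \<noteq> 0" "f = to_fract P / to_fract Q"
    "P' \<in> ext_forms r e" "Q' \<in> ext_forms r e" "\<not> vanishes_on_grassmannian r Q'" "Q' \<noteq> 0" "g = to_fract P' / to_fract Q'"
  have "f + g = to_fract (P * Q' + Q * P') / to_fract (Q * Q')"
    using h by (simp add: add_frac_eq mult.commute)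
  also have "\<dots> \<in> carrier R"
    by (rule plucker_local_ringI[of _ r "d + e", OF _ _ not_vanishes_mult[OF h(2,7,3,8)]])
      (use h in \<open>auto intro: ext_forms_add ext_forms_mult\<close>)
  finally show ?thesis .
qed

lemma mult_in_R: "f \<in> carrier R \<Longrightarrow> g \<in> carrier R \<Longrightarrow> f * g \<in> carrier R"
proof (elim plucker_local_ringE)
  fix P Q d P' Q' e
  assume h: "P \<in> ext_forms r d" "Q \<in> ext_forms r d" "\<not> vanishes_on_grassmannian r Q" "Q \<noteq> 0" "f = to_fract P / to_fract Q"
    "P' \<in> ext_forms r e" "Q' \<in> ext_forms r e" "\<not> vanishes_on_grassmannian r Q'" "Q' \<noteq> 0" "g = to_fract P' / to_fract Q'"
  have "f * g = to_fract (P * P') / to_fract (Q * Q')" using h by simp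
  also have "\<dots> \<in> carrier R"
    by (rule plucker_local_ringI[of _ r "d + e", OF _ _ not_vanishes_mult[OF h(2,7,3,8)]])
      (use h in \<open>auto intro: ext_forms_mult\<close>)
  finally show ?thesis .
qed

lemma uminus_in_R: "f \<in> carrier R \<Longrightarrow> - f \<in> carrier R"
  using mult_in_R[OF const_in_R[of "-1"], of f] by (simp add: Const_def single_uminus)

lemma cring_R: "cring R"
proof (rule cringI)
  have z: "0 \<in> carrier R" and o: "1 \<in> carrier R" using const_in_R[of 0] const_in_R[of 1] by auto
  show "abelian_group R"
  proof (rule abelian_groupI)
    fix f assume "f \<in> carrier R"
    then show "\<exists>g\<in>carrier R. g \<oplus>\<^bsub>R\<^esub> f = \<zero>\<^bsub>R\<^esub>"
      using uminus_in_R by (intro bexI[of _ "- f"]) auto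
  qed (use z add_in_R in \<open>auto simp: add_ac\<close>)
  show "comm_monoid R"
    by (rule comm_monoidI) (use o mult_in_R in \<open>auto simp: mult_ac\<close>)
qed (simp add: distrib_right)

lemma max_ideal_add:
  "f \<in> plucker_max_ideal r \<Longrightarrow> g \<in> plucker_max_ideal r \<Longrightarrow> f + g \<in> (plucker_max_ideal r :: 'n list qpoly fract set)"
proof (elim plucker_max_idealE)
  fix P Q d P' Q' e
  assume h: "P \<in> ext_forms r d" "Q \<in> ext_forms r d" "vanishes_on_grassmannian r P" "\<not> vanishes_on_grassmannian r Q" "Q \<noteq> 0" "f = to_fract P / to_fract Q"
    "P' \<in> ext_forms r e" "Q' \<in> ext_forms r e" "vanishes_on_grassmannian r P'" "\<not> vanishes_on_grassmannian r Q'" "Q' \<noteq> 0" "g = to_fract P' / to_fract Q'"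
  have "f + g = to_fract (P * Q' + Q * P') / to_fract (Q * Q')"
    using h by (simp add: add_frac_eq mult.commute)
  also have "vanishes_on_grassmannian r (Q * P')"
    using vanishes_mult[OF h(9), of Q] by (simp add: mult.commute)
  then have "to_fract (P * Q' + Q * P') / to_fract (Q * Q') \<in> plucker_max_ideal r"
    by (intro plucker_max_idealI[of _ r "d + e", OF _ _ _ not_vanishes_mult[OF h(2,8,4,10)]])
      (use h in \<open>auto intro: ext_forms_add ext_forms_mult vanishes_add vanishes_mult\<close>)
  finally show ?thesis .
qed

lemma max_ideal_mult:
  "f \<in> plucker_max_ideal r \<Longrightarrow> g \<in> carrier R \<Longrightarrow> f * g \<in> plucker_max_ideal r"
proof (elim plucker_max_idealE plucker_local_ringE)
  fix P Q d P' Q' e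
  assume h: "P \<in> ext_forms r d" "Q \<in> ext_forms r d" "vanishes_on_grassmannian r P" "\<not> vanishes_on_grassmannian r Q" "Q \<noteq> 0" "f = to_fract P / to_fract Q"
    "P' \<in> ext_forms r e" "Q' \<in> ext_forms r e" "\<not> vanishes_on_grassmannian r Q'" "Q' \<noteq> 0" "g = to_fract P' / to_fract Q'"
  have "f * g = to_fract (P * P') / to_fract (Q * Q')" using h by simp
  also have "\<dots> \<in> plucker_max_ideal r"
    by (rule plucker_max_idealI[of _ r "d + e", OF _ _ _ not_vanishes_mult[OF h(2,8,4,9)]])
      (use h in \<open>auto intro: ext_forms_mult vanishes_mult\<close>)
  finally show ?thesis .
qed

lemma max_ideal_uminus: "f \<in> plucker_max_ideal r \<Longrightarrow> - f \<in> (plucker_max_ideal r :: 'n list qpoly fract set)"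
  using max_ideal_mult[OF _ const_in_R[of "-1"], of f] by (simp add: Const_def single_uminus)

lemma max_ideal_0: "0 \<in> (plucker_max_ideal r :: 'n list qpoly fract set)"
  using plucker_max_idealI[OF ext_forms_0 ext_forms_1 vanishes_0 one_not_vanishing] by simp

lemma max_ideal_subset: "f \<in> plucker_max_ideal r \<Longrightarrow> f \<in> carrier R"
  by (elim plucker_max_idealE) (auto intro: plucker_local_ringI)

lemma ideal_max: "ideal (plucker_max_ideal r) R"
proof -
  interpret R: cring R by (rule cring_R)
  have inv: "\<ominus>\<^bsub>R\<^esub> f = - f" if "f \<in> carrier R" for f
    by (rule R.minus_equality) (use that uminus_in_R in auto)
  show ?thesis
  proof (rule idealI[OF R.ring_axioms])
    show "subgroup (plucker_max_ideal r) (add_monoid R)"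
    proof (rule R.add.subgroupI)
      show "plucker_max_ideal r \<noteq> ({} :: 'n list qpoly fract set)" using max_ideal_0 by auto
    next
      fix f :: "'n list qpoly fract" assume "f \<in> plucker_max_ideal r"
      then show "\<ominus>\<^bsub>R\<^esub> f \<in> plucker_max_ideal r" using inv max_ideal_uminus max_ideal_subset by simp
    qed (auto intro: max_ideal_add max_ideal_subset)
  next
    fix f g :: "'n list qpoly fract" assume "f \<in> plucker_max_ideal r" "g \<in> carrier R"
    then show "g \<otimes>\<^bsub>R\<^esub> f \<in> plucker_max_ideal r" "f \<otimes>\<^bsub>R\<^esub> g \<in> plucker_max_ideal r"
      using max_ideal_mult[of f g] by (auto simp: mult.commute)
  qed
qed

lemma pullback_hom: "plucker_pullback r \<in> Ring.ring_hom R (Rat_G r)"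
  using ideal.rcos_ring_hom[OF ideal_max] unfolding plucker_pullback_def[abs_def] Rat_G_def by simp

lemma ring_Rat_G: "ring (Rat_G r :: 'n list qpoly fract set ring)"
  unfolding Rat_G_def by (rule ideal.quotient_is_ring[OF ideal_max])

lemma finsum_pullback:
  assumes "finite A" "\<And>J. J \<in> A \<Longrightarrow> h J \<in> carrier R"
  shows "(\<Oplus>\<^bsub>Rat_G r\<^esub>J\<in>A. plucker_pullback r (h J)) = plucker_pullback r (\<Sum>J\<in>A. h J) \<and> (\<Sum>J\<in>A. h J) \<in> carrier R"
proof -
  interpret G: ring "Rat_G r :: 'n list qpoly fract set ring" by (rule ring_Rat_G)
  interpret R: cring R by (rule cring_R)
  have cl: "plucker_pullback r f \<in> carrier (Rat_G r)" if "f \<in> carrier R" for f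
    using Ring.ring_hom_closed[OF pullback_hom that] .
  show ?thesis
    using assms
  proof (induction A)
    case empty
    have "plucker_pullback r \<zero>\<^bsub>R\<^esub> = \<zero>\<^bsub>Rat_G r\<^esub>"
      by (rule Ring.ring_hom_zero[OF pullback_hom R.ring_axioms G.ring_axioms])
    then show ?case using const_in_R[of 0] by simp
  next
    case (insert J A)
    then have IH: "(\<Oplus>\<^bsub>Rat_G r\<^esub>J\<in>A. plucker_pullback r (h J)) = plucker_pullback r (\<Sum>J\<in>A. h J)" "(\<Sum>J\<in>A. h J) \<in> carrier R"
      by auto
    have "(\<Oplus>\<^bsub>Rat_G r\<^esub>J\<in>insert J A. plucker_pullback r (h J)) =
        plucker_pullback r (h J) \<oplus>\<^bsub>Rat_G r\<^esub> (\<Oplus>\<^bsub>Rat_G r\<^esub>J\<in>A. plucker_pullback r (h J))"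
      by (rule G.finsum_insert) (use insert cl in auto)
    also have "\<dots> = plucker_pullback r (h J + (\<Sum>J\<in>A. h J))"
      using Ring.ring_hom_add[OF pullback_hom, of "h J" "\<Sum>J\<in>A. h J"] IH insert.prems by simp
    finally show ?case using insert IH by (auto intro: add_in_R)
  qed
qed

lemma pullback_eqI:
  assumes "f - g \<in> (plucker_max_ideal r :: 'n list qpoly fract set)"
  shows "plucker_pullback r f = plucker_pullback r g"
proof -
  have pb: "plucker_pullback r f = (\<lambda>h. h + f) ` plucker_max_ideal r" for f :: "'n list qpoly fract"
    by (auto simp: plucker_pullback_def a_r_coset_def r_coset_def)
  have "h + (f - g) \<in> plucker_max_ideal r" "h + - (f - g) \<in> plucker_max_ideal r" if "h \<in> plucker_max_ideal r" for h
    using that assms max_ideal_add max_ideal_uminus by blast+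
  moreover have "h + f = (h + (f - g)) + g" "h + g = (h + - (f - g)) + f" for h by simp_all
  ultimately show ?thesis unfolding pb by (intro equalityI image_subsetI) (metis image_eqI)+
qed

end

section \<open>Evaluation at a subspace\<close>

lemma wedge_pair_add: "wedge_pair r ((u + v) # us) w = wedge_pair r (u # us) w + wedge_pair r (v # us) w"
  by (simp add: wedge_pair_def wedge_add_hd distrib_right sum.distrib)

lemma wedge_pair_scale: "wedge_pair r ((c *s u) # us) w = c * wedge_pair r (u # us) w"
  by (simp add: wedge_pair_def wedge_scale_hd sum_distrib_left mult.assoc)

lemma wedge_pair_0 [simp]: "wedge_pair r (0 # us) w = 0"
  by (simp add: wedge_pair_def wedge_zero_hd)

lemma wedge_pair_sum: "wedge_pair r ((\<Sum>i\<in>A. f i) # us) w = (\<Sum>i\<in>A. wedge_pair r (f i # us) w)"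
  by (induction A rule: infinite_finite_induct) (auto simp: wedge_pair_add)

lemma wedge_pair_span: "u \<in> vec.span (set us) \<Longrightarrow> wedge_pair r (u # us) w = 0"
  by (simp add: wedge_pair_def wedge_hd_in_span)

lemma wedge_pair_gram:
  assumes "length us = r" "length ws = r"
  shows "wedge_pair r us (\<lambda>S. c * wedge ws S) = c * det (gram us ws)"
  using cauchy_binet[of us ws] assms by (simp add: wedge_pair_def sum_distrib_left[symmetric] mult.left_commute)

text \<open>By the Cauchy--Binet formula the value depends on \<open>u\<close> only through its pairings with \<open>ws\<close>.\<close>

lemma wedge_pair_orthogonal:
  assumes "length (u # us) = r" "length ws = r" "\<And>v. v \<in> set ws \<Longrightarrow> pairing u v = 0"
  shows "wedge_pair r (u # us) (\<lambda>S. c * wedge ws S) = 0"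
proof -
  have "gram (u # us) ws = gram (0 # us) ws"
    unfolding gram_def by (rule eq_matI) (use assms in \<open>auto simp: nth_Cons split: nat.splits\<close>)
  then have "wedge_pair r (u # us) (\<lambda>S. c * wedge ws S) = wedge_pair r (0 # us) (\<lambda>S. c * wedge ws S)"
    using wedge_pair_gram[of "u # us" r ws c] wedge_pair_gram[of "0 # us" r ws c] assms by simp
  then show ?thesis by simp
qed

lemma span_set_sum:
  assumes "e \<in> vec.span (set ws)"
  obtains f where "e = (\<Sum>b<length ws. f b *s ws ! b)"
proof -
  have "\<exists>f. e = (\<Sum>b<length ws. f b *s ws ! b)"
    using assms
  proof (induction rule: vec.span_induct_alt)
    case base then show ?case by (intro exI[of _ "\<lambda>_. 0"]) simp
  next
    case (step c x y)
    then obtain f b where f: "y = (\<Sum>b<length ws. f b *s ws ! b)" and b: "b < length ws" "x = ws ! b"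
      by (auto simp: in_set_conv_nth)
    have "(\<Sum>i<length ws. (f i + (if i = b then c else 0)) *s ws ! i)
        = (\<Sum>i<length ws. f i *s ws ! i) + (\<Sum>i<length ws. (if i = b then c *s x else 0))"
      unfolding sum.distrib[symmetric] by (rule sum.cong) (auto simp: b vector_sadd_rdistrib)
    also have "\<dots> = y + c *s x" using b f by simp
    finally show ?case by (intro exI[of _ "\<lambda>i. f i + (if i = b then c else 0)"]) (simp add: add.commute)
  qed
  with that show ?thesis by blast
qed

lemma wedge_form_ext_forms: "length us = r \<Longrightarrow> wedge_form us \<in> ext_forms r 1"
proof -
  assume r: "length us = r"
  have "vars (wedge_form us) \<subseteq> ext_index r"
    unfolding wedge_form_def r
    by (rule vars_sum_subset) (use vars_mult in fastforce)
  moreover have "homogeneous 1 (wedge_form us)"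
    unfolding wedge_form_def by (intro homogeneous_sum homogeneous_Const_mult homogeneous_Var)
  ultimately show ?thesis by (simp add: ext_forms_def)
qed

context complete_simplicial_fan_ordered
begin

text \<open>The choices made in the definition of \<^const>\<open>mu\<close>, and the resulting homomorphism \<open>f\<^sup>J\<close> on polynomials.\<close>

definition chamber :: "'n cone set \<Rightarrow> 'n cone set" where
  "chamber J = (SOME I. I \<in> full_simplices \<and> J \<subseteq> I)"

definition ann_basis :: "'n cone set \<Rightarrow> 'n lvec list" where
  "ann_basis J = (SOME us. lattice_basis (ann_lattice J) us)"

definition ann_frame :: "'n cone set \<Rightarrow> (rat ^ 'n::{finite,linorder}) list" where
  "ann_frame J = map vec_of (ann_basis J)"

definition face_hom :: "'n cone set \<Rightarrow> 'n cone qpoly \<Rightarrow> 'n list qpoly" where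
  "face_hom J = poly_hom Const (\<lambda>i. wedge_form (iota_vec (chamber J) i # ann_frame J))"

lemma chamber: "J \<in> simplices \<Delta> \<Longrightarrow> chamber J \<in> full_simplices \<and> J \<subseteq> chamber J"
  unfolding chamber_def by (rule someI_ex) (metis simplex_in_full_simplex)

lemma ann_basis: "lattice_basis (ann_lattice J) (ann_basis J)"
  unfolding ann_basis_def by (rule someI_ex) (rule lattice_basis_exists[OF subgroup_ann_lattice])

lemma ann_frame:
  assumes "J \<in> simplices \<Delta>"
  shows "length (ann_frame J) = CARD('n) - card J" "distinct (ann_frame J)" "vec.independent (set (ann_frame J))"
    "vec.span (set (ann_frame J)) = {u. \<forall>j\<in>J. pairing u (qgen j) = 0}"
  using annihilator_frame[OF conjunct1[OF chamber] conjunct2[OF chamber] ann_basis, OF assms assms]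
  by (simp_all add: ann_frame_def)

lemma f_hom_class:
  assumes "J \<in> simplices \<Delta>"
  shows "f_hom (chamber J) (ann_basis J) (HT_class \<Delta> p) = face_hom J p"
  unfolding f_hom_def face_hom_def ann_frame_def
proof (rule Const_hom.the_elem_HT_class)
  fix K assume K: "K \<subseteq> rays \<Delta>" "K \<notin> simplices \<Delta>"
  then have "\<not> K \<subseteq> chamber J"
    using simplices_subset[OF full_simplex(1)[OF conjunct1[OF chamber[OF assms]]]] by blast
  then obtain i where i: "i \<in> K" "i \<notin> chamber J" by blast
  have "wedge_form (iota_vec (chamber J) i # map vec_of (ann_basis J)) = 0"
    using i(2) by (simp add: wedge_form_def iota_vec_def wedge_zero_hd)
  then show "(\<Prod>i\<in>K. wedge_form (iota_vec (chamber J) i # map vec_of (ann_basis J))) = 0"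
    using finite_subset[OF K(1) finite_rays] i(1) by (intro prod_zero) auto
qed

lemma mu_class:
  assumes "J \<in> simplices \<Delta>"
  shows "mu \<Delta> (HT_class \<Delta> p) J = plucker_pullback (CARD('n) - card J + 1)
    (to_fract (face_hom J p) / to_fract (face_hom J (\<Prod>j\<in>J. Var j)))"
  unfolding mu_def Let_def chamber_def[symmetric] ann_basis_def[symmetric] x_face_def f_hom_class[OF assms] ..

text \<open>The dual vector of \<open>j\<close> takes the value 1 at the generator of \<open>j\<close>, which the annihilator of \<open>J\<close> kills.\<close>

lemma frame_with_dual:
  assumes "J \<in> simplices \<Delta>" "j \<in> J"
  shows "distinct (dual_vec (chamber J) j # ann_frame J)" "vec.independent (set (dual_vec (chamber J) j # ann_frame J))"
    "length (dual_vec (chamber J) j # ann_frame J) = CARD('n) - card J + 1"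
proof -
  note c = chamber[OF assms(1)] and f = ann_frame[OF assms(1)]
  have "pairing (dual_vec (chamber J) j) (qgen j) = 1" using dual_vec_pairing[of "chamber J" j j] c assms(2) by auto
  then have n: "dual_vec (chamber J) j \<notin> vec.span (set (ann_frame J))" unfolding f(4) using assms(2) by (auto intro!: bexI[of _ j])
  then show "distinct (dual_vec (chamber J) j # ann_frame J)" using f(2) vec.span_base by auto
  show "vec.independent (set (dual_vec (chamber J) j # ann_frame J))"
    using vec.independent_insertI[OF n f(3)] by simp
  show "length (dual_vec (chamber J) j # ann_frame J) = CARD('n) - card J + 1" using f(1) by simp
qed

lemma face_hom_ext_forms:
  assumes "J \<in> simplices \<Delta>" "homogeneous d p"
  shows "face_hom J p \<in> ext_forms (CARD('n) - card J + 1) d"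
proof -
  let ?r = "CARD('n) - card J + 1"
  have w: "wedge_form (u # ann_frame J) \<in> ext_forms ?r 1" for u
    by (rule wedge_form_ext_forms) (simp add: ann_frame(1)[OF assms(1)])
  then have "vars (face_hom J p) \<subseteq> ext_index ?r"
    unfolding face_hom_def by (intro vars_poly_hom) (simp add: ext_forms_def)
  moreover have "homogeneous d (face_hom J p)"
    unfolding face_hom_def by (rule homogeneous_poly_hom[OF _ assms(2)]) (use w in \<open>simp add: ext_forms_def\<close>)
  ultimately show ?thesis by (simp add: ext_forms_def)
qed

lemma face_hom_self:
  assumes "J \<in> simplices \<Delta>"
  shows "face_hom J (\<Prod>j\<in>J. Var j) = (\<Prod>j\<in>J. wedge_form (dual_vec (chamber J) j # ann_frame J))"
  unfolding face_hom_def Const_hom.hom_prod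
  by (rule prod.cong) (use chamber[OF assms] in \<open>auto simp: iota_vec_def\<close>)

lemma homogeneous_face: "finite J \<Longrightarrow> homogeneous (card J) (\<Prod>j\<in>J. Var j)"
  using homogeneous_prod[OF homogeneous_Var, of J "\<lambda>j. j"] by simp

lemma simplex_of_card_exists:
  assumes "K \<in> simplices \<Delta>" "card K \<le> k" "k \<le> CARD('n)"
  obtains J where "J \<in> simplices_of_card \<Delta> k" "K \<subseteq> J"
proof -
  obtain I where I: "I \<in> full_simplices" "K \<subseteq> I" using simplex_in_full_simplex[OF assms(1)] .
  have fin: "finite I" using simplexD(1)[OF full_simplex(1)[OF I(1)]] .
  have "k - card K \<le> card (I - K)" using I full_simplex(2) fin assms(3) by (simp add: card_Diff_subset finite_subset)
  then obtain L where L: "L \<subseteq> I - K" "card L = k - card K" using obtain_subset_with_card_n by metis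
  have "card (K \<union> L) = k"
    using L I fin assms(2) by (subst card_Un_disjoint) (auto intro: finite_subset)
  moreover have "K \<union> L \<in> simplices \<Delta>" using simplices_subset[OF full_simplex(1)[OF I(1)]] L I by blast
  ultimately show ?thesis using that[of "K \<union> L"] by (simp add: simplices_of_card_def)
qed

lemma empty_simplex: "{} \<in> simplices \<Delta>"
proof -
  have "0 \<in> \<Union>\<Delta>" using complete by (simp add: complete_fan_def)
  then obtain \<sigma> where "\<sigma> \<in> \<Delta>" by blast
  then have "{\<rho>\<in>rays \<Delta>. \<rho> face_of \<sigma>} \<in> simplices \<Delta>" by (auto simp: simplices_def)
  then show ?thesis by (rule simplices_subset) simp
qed

lemma nonvanishing_1:
  assumes "1 \<le> k" "k \<le> CARD('n)"
  shows "\<not> vanishes_on_grassmannian (CARD('n) - k + 1) (1 :: 'n list qpoly)"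
proof -
  obtain J where J: "J \<in> simplices_of_card \<Delta> k" using simplex_of_card_exists[OF empty_simplex, of k] assms by auto
  then have Js: "J \<in> simplices \<Delta>" "card J = k" by (auto simp: simplices_of_card_def)
  then obtain j where "j \<in> J" using assms(1) by fastforce
  note f = frame_with_dual[OF Js(1) this]
  have "\<not> vanishes_on_grassmannian (CARD('n) - k + 1) (wedge_form (dual_vec (chamber J) j # ann_frame J))"
    using wedge_form_not_vanishing[OF f(1,2)] f(3) Js(2) by simp
  then show ?thesis using vanishes_mult[of _ 1] by fastforce
qed

lemma face_hom_self_not_vanishing:
  assumes "J \<in> simplices_of_card \<Delta> k" "1 \<le> k" "k \<le> CARD('n)"
  shows "\<not> vanishes_on_grassmannian (CARD('n) - k + 1) (face_hom J (\<Prod>j\<in>J. Var j))"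
proof -
  have J: "J \<in> simplices \<Delta>" "card J = k" using assms(1) by (auto simp: simplices_of_card_def)
  note f = frame_with_dual[OF J(1)]
  show ?thesis
    unfolding face_hom_self[OF J(1)]
  proof (rule not_vanishes_prod[OF nonvanishing_1[OF assms(2,3)]])
    fix j assume j: "j \<in> J"
    show "wedge_form (dual_vec (chamber J) j # ann_frame J) \<in> ext_forms (CARD('n) - k + 1) 1"
      by (rule wedge_form_ext_forms) (use f(3)[OF j] J(2) in simp)
    show "\<not> vanishes_on_grassmannian (CARD('n) - k + 1) (wedge_form (dual_vec (chamber J) j # ann_frame J))"
      using wedge_form_not_vanishing[OF f(1,2)[OF j]] f(3)[OF j] J(2) by simp
  qed
qed

text \<open>Evaluate at the plane \<open>E\<close> spanned by \<open>ws\<close>. Composing \<open>f\<^sup>J\<close> with this evaluation sends \<open>x\<^sub>i\<close> to the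
  value at \<open>\<iota>\<^sub>I x\<^sub>i\<close> of a linear functional \<open>a J\<close> on \<open>M\<close>, which kills the annihilators of \<open>J\<close> and of
  \<open>E\<close>; up to scale it is the pairing with a vector on the line where \<open>E\<close> meets the span of \<open>J\<close>. So
  the ring homomorphism \<open>A J\<close> kills \<open>theta u\<close> for \<open>u\<close> orthogonal to \<open>E\<close>, and all \<open>x\<close> of other simplices
  of the same size. The top pairing kills multiples of \<open>theta u\<close> as well. Both sides of the identity
  therefore agree everywhere once they agree on squarefree monomials, where both are
  evident. The nonvanishing of the denominators says precisely that \<open>E\<close> is transversal to the
  simplices with fewer than \<open>k\<close> elements, as the reduction requires.\<close>

theorem pointwise_identity:
  assumes k: "1 \<le> k" "k \<le> CARD('n)"
    and z: "vars z \<subseteq> rays \<Delta>" "homogeneous 1 z" and p: "vars p \<subseteq> rays \<Delta>" "homogeneous k p"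
    and ws: "length ws = CARD('n) - k + 1"
    and nz: "\<And>J. J \<in> simplices_of_card \<Delta> k \<Longrightarrow> poly_hom id (\<lambda>S. c * wedge ws S) (face_hom J (\<Prod>j\<in>J. Var j)) \<noteq> 0"
  shows "top_pairing m z p = (\<Sum>J\<in>simplices_of_card \<Delta> k.
     poly_hom id (\<lambda>S. c * wedge ws S) (face_hom J p) / poly_hom id (\<lambda>S. c * wedge ws S) (face_hom J (\<Prod>j\<in>J. Var j))
      * top_pairing m z (\<Prod>j\<in>J. Var j))"
proof -
  let ?r = "CARD('n) - k + 1" and ?S = "simplices_of_card \<Delta> k" and ?w = "\<lambda>S. c * wedge ws S"
  define a where "a = (\<lambda>J u. wedge_pair ?r (u # ann_frame J) ?w)"
  define A where "A = (\<lambda>J p. poly_hom id ?w (face_hom J p))"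
  have S: "J \<in> simplices \<Delta>" "card J = k" if "J \<in> ?S" for J using that by (auto simp: simplices_of_card_def)
  have finS: "finite ?S" using finite_simplices by (rule finite_subset[rotated]) (auto simp: simplices_of_card_def)
  have len: "length (u # ann_frame J) = ?r" if "J \<in> ?S" for J u using ann_frame(1)[OF S(1)[OF that]] S(2)[OF that] by simp
  have A_eq: "A J q = poly_hom id (\<lambda>i. a J (iota_vec (chamber J) i)) q" if "J \<in> ?S" for J q
    unfolding A_def face_hom_def id_hom.hom_comp eval_wedge_form a_def len[OF that] ..
  have a0: "a J 0 = 0" for J by (simp add: a_def)
  have a_ann: "a J u = 0" if "J \<in> ?S" "\<And>j. j \<in> J \<Longrightarrow> pairing u (qgen j) = 0" for J u
    unfolding a_def using that ann_frame(4)[OF S(1)[OF that(1)]] by (intro wedge_pair_span) auto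
  \<comment> \<open>This uses that \<open>u\<close> is orthogonal to the frame \<open>ws\<close>; the previous fact uses that \<open>u\<close> repeats the frame of the annihilator.\<close>
  have a_orth: "a J u = 0" if "J \<in> ?S" "\<And>e. e \<in> vec.span (set ws) \<Longrightarrow> pairing u e = 0" for J u
    unfolding a_def by (rule wedge_pair_orthogonal) (use len[OF that(1)] ws that(2) vec.span_base in auto)
  have A_theta: "A J (theta u * q) = a J u * A J q" if J: "J \<in> ?S" for J u q
  proof -
    have full: "chamber J \<in> full_simplices" using chamber[OF S(1)[OF J]] by blast
    have "A J (theta u) = (\<Sum>i\<in>rays \<Delta>. pairing u (qgen i) * a J (iota_vec (chamber J) i))"
      unfolding A_eq[OF J] theta_def by (simp add: id_hom.hom_sum id_hom.hom_mult)
    also have "\<dots> = a J (\<Sum>i\<in>rays \<Delta>. pairing u (qgen i) *s iota_vec (chamber J) i)"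
      by (simp add: a_def wedge_pair_sum wedge_pair_scale)
    also have "\<dots> = a J u" by (simp add: sum_rays_iota[OF full])
    finally show ?thesis unfolding A_eq[OF J] by (simp add: id_hom.hom_mult)
  qed
  have A_nonface: "A J (Monom m') = 0" if J: "J \<in> ?S" and m': "keys m' \<notin> simplices \<Delta>" for J m'
  proof -
    have "\<not> keys m' \<subseteq> chamber J"
      using simplices_subset[OF full_simplex(1)] chamber[OF S(1)[OF J]] m' by blast
    then obtain i where i: "i \<in> keys m'" "i \<notin> chamber J" by blast
    have "a J (iota_vec (chamber J) i) ^ lookup m' i = 0"
      using i a0 by (simp add: iota_vec_def in_keys_iff)
    then show ?thesis unfolding A_eq[OF J] id_hom.hom_Monom using i(1) by (intro prod_zero) auto
  qed
  have A_other: "A J (\<Prod>j\<in>J'. Var j) = 0" if J: "J \<in> ?S" and J': "J' \<in> ?S" and ne: "J' \<noteq> J" for J J'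
  proof -
    have fin: "finite J" "finite J'" using simplexD(1) S(1) J J' by auto
    have "\<not> J' \<subseteq> J" using card_subset_eq[OF fin(1)] S(2) J J' ne by metis
    then obtain j where j: "j \<in> J'" "j \<notin> J" by blast
    note ch = chamber[OF S(1)[OF J]]
    have "a J (iota_vec (chamber J) j) = 0"
    proof (rule a_ann[OF J])
      fix i assume "i \<in> J"
      then show "pairing (iota_vec (chamber J) j) (qgen i) = 0"
        using iota_vec_pairing[of "chamber J" i j] ch j(2) by auto
    qed
    then show ?thesis unfolding A_eq[OF J] id_hom.hom_prod using j(1) fin(2) by (intro prod_zero) auto
  qed
  have a_nz: "a J (dual_vec (chamber J) j) \<noteq> 0" if J: "J \<in> ?S" and j: "j \<in> J" for J j
  proof
    assume z: "a J (dual_vec (chamber J) j) = 0"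
    have "iota_vec (chamber J) j = dual_vec (chamber J) j" using chamber[OF S(1)[OF J]] j by (auto simp: iota_vec_def)
    then have "A J (\<Prod>j\<in>J. Var j) = 0"
      unfolding A_eq[OF J] id_hom.hom_prod using j z simplexD(1)[OF S(1)[OF J]]
      by (intro prod_zero) (auto intro!: bexI[of _ j])
    with nz[OF J] show False by (simp add: A_def)
  qed
  have tr: "e = 0" if K: "K \<in> simplices \<Delta>" "card K < k" and e: "e \<in> vec.span (set ws)" "e \<in> vec.span (qgen ` K)" for K e
  proof (rule ccontr)
    assume "e \<noteq> 0"
    obtain J where J: "J \<in> ?S" "K \<subseteq> J" using simplex_of_card_exists[OF K(1)] K(2) k(2) by (metis less_imp_le)
    have "K \<noteq> J" using K(2) S(2)[OF J(1)] by auto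
    then obtain j where j: "j \<in> J" "j \<notin> K" using J(2) by blast
    let ?us = "dual_vec (chamber J) j # ann_frame J"
    note ch = chamber[OF S(1)[OF J(1)]]
    obtain f where f: "e = (\<Sum>b<length ws. f b *s ws ! b)" using span_set_sum[OF e(1)] by blast
    have "\<exists>b<length ws. f b \<noteq> 0"
    proof (rule ccontr)
      assume "\<not> (\<exists>b<length ws. f b \<noteq> 0)"
      then have "e = 0" unfolding f by (intro sum.neutral) auto
      with \<open>e \<noteq> 0\<close> show False by simp
    qed
    then obtain b where b: "b < length ws" "f b \<noteq> 0" by blast
    have orth: "pairing u e = 0" if u: "u \<in> set ?us" for u
    proof -
      have uK: "pairing u (qgen i) = 0" if i: "i \<in> K" for i
      proof -
        have iJ: "i \<in> J" "i \<noteq> j" using i J(2) j(2) by auto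
        consider "u = dual_vec (chamber J) j" | "u \<in> set (ann_frame J)" using u by auto
        then show ?thesis
        proof cases
          case 1 then show ?thesis using dual_vec_pairing[of "chamber J" j i] ch iJ j(1) by auto
        next
          case 2
          then have "u \<in> vec.span (set (ann_frame J))" by (rule vec.span_base)
          then show ?thesis using iJ(1) unfolding ann_frame(4)[OF S(1)[OF J(1)]] by auto
        qed
      qed
      show ?thesis
        using e(2)
      proof (induction rule: vec.span_induct_alt)
        case (step d x y)
        then show ?case using uK by (auto simp: pairing_add_right pairing_scale_right)
      qed simp
    qed
    \<comment> \<open>The vector \<open>e\<close> of \<open>E\<close> is orthogonal to the whole frame at \<open>j\<close>, so the denominator at \<open>J\<close> would vanish.\<close>
    have "det (gram ?us ws) = 0"
      by (rule det_gram_eq_0[of ?us ws f b, OF _ b(2) b(1)]) (use len[OF J(1)] ws orth f in auto)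
    then have "a J (dual_vec (chamber J) j) = 0"
      unfolding a_def using wedge_pair_gram[OF len[OF J(1)] ws] by simp
    with a_nz[OF J(1) j(1)] show False by simp
  qed
  \<comment> \<open>Outside degree \<open>k\<close> only integrality is claimed; it is what the induction passes on to multiples of \<open>theta u\<close>.\<close>
  define P where "P = (\<lambda>d q. top_integral m z q \<and> (d = k \<longrightarrow> top_pairing m z q =
      (\<Sum>J\<in>?S. A J q / A J (\<Prod>j\<in>J. Var j) * top_pairing m z (\<Prod>j\<in>J. Var j))))"
  have P_iff: "P d q \<longleftrightarrow> top_integral m z q \<and> (d = k \<longrightarrow> top_pairing m z q =
      (\<Sum>J\<in>?S. A J q / A J (\<Prod>j\<in>J. Var j) * top_pairing m z (\<Prod>j\<in>J. Var j)))" for d q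
    by (simp add: P_def)
  have A_add: "A J (q + q') = A J q + A J q'" for J q q'
    by (simp add: A_def face_hom_def Const_hom.hom_add id_hom.hom_add)
  have A_scale: "A J (Const b * q) = b * A J q" for J q b
    by (simp add: A_def face_hom_def Const_hom.hom_mult id_hom.hom_mult)
  have scale: "P d (Const b * q)" if "P d q" for d b q
    using that top_scale[of m z q b] unfolding P_iff
    by (auto simp: A_scale sum_distrib_left mult.assoc)
  have nonface: "P d (Monom m')" if "keys m' \<notin> simplices \<Delta>" for d m'
    using top_nonface[OF that, of m z] A_nonface[OF _ that] unfolding P_iff by simp
  have "P k p"
  proof (rule homogeneous_reduction[where P = P and E = "vec.span (set ws)"])
    show "P d 0" for d
    proof -
      have "push (Const (1 / fact m) * z ^ m * 0) = to_fract 0" by simp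
      then show ?thesis unfolding P_iff using top_eq[of m z 0 0]
        by (auto simp: top_integral_def A_def face_hom_def intro!: exI[of _ 0])
    qed
    show "P d (q + q')" if "P d q" "P d q'" for d q q'
      using that top_add[of m z q q'] unfolding P_iff
      by (auto simp: A_add add_divide_distrib distrib_right sum.distrib)
    show "P (card J) (\<Prod>j\<in>J. Var j)" if J: "J \<in> simplices \<Delta>" for J
    proof -
      have hom: "homogeneous (card J) (\<Prod>j\<in>J. Var j)" using simplexD(1)[OF J] by (rule homogeneous_face)
      have "vars (\<Prod>j\<in>J. Var j) \<subseteq> rays \<Delta>" by (rule vars_prod_subset) (use simplexD(2)[OF J] in auto)
      then have "top_integral m z (\<Prod>j\<in>J. Var j)" using top_integral_homogeneous[OF z _ hom] by blast
      moreover have "top_pairing m z (\<Prod>j\<in>J. Var j) =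
          (\<Sum>J'\<in>?S. A J' (\<Prod>j\<in>J. Var j) / A J' (\<Prod>j\<in>J'. Var j) * top_pairing m z (\<Prod>j\<in>J'. Var j))" if "card J = k"
      proof -
        have JS: "J \<in> ?S" using J that by (simp add: simplices_of_card_def)
        have "(\<Sum>J'\<in>?S. A J' (\<Prod>j\<in>J. Var j) / A J' (\<Prod>j\<in>J'. Var j) * top_pairing m z (\<Prod>j\<in>J'. Var j))
           = (\<Sum>J'\<in>?S. if J' = J then top_pairing m z (\<Prod>j\<in>J. Var j) else 0)"
          by (rule sum.cong) (use A_other[OF _ JS] nz[OF JS] in \<open>auto simp: A_def\<close>)
        then show ?thesis using JS finS by simp
      qed
      ultimately show ?thesis unfolding P_iff by blast
    qed
    show "P (Suc d) (theta u * q)" if "\<And>e. e \<in> vec.span (set ws) \<Longrightarrow> pairing u e = 0" "P d q" for d u q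
      using that(2) top_theta[of m z q u] a_orth[OF _ that(1)] unfolding P_iff by (simp add: A_theta)
    show "vec.subspace (vec.span (set ws))" by (rule vec.subspace_span)
  qed (use scale nonface tr p in auto)
  then show ?thesis unfolding P_iff A_def by simp
qed

text \<open>Clearing denominators turns the identity into the vanishing of a form \<open>N\<close>. At planes where the
  common denominator \<open>D\<close> is nonzero this is the pointwise identity, so \<open>N D\<close> vanishes on the whole
  Grassmannian. Since its ideal is prime and \<open>D\<close> is not in it, \<open>N\<close> vanishes.\<close>

theorem localization_identity:
  assumes k: "1 \<le> k" "k \<le> CARD('n)" and x: "x \<in> HT_deg \<Delta> k" and \<xi>: "\<xi> \<in> HT_deg \<Delta> 1"
  shows "Rat_G_const (CARD('n) - k + 1) (p_star_exp \<Delta> \<xi> x) =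
    (\<Oplus>\<^bsub>Rat_G (CARD('n) - k + 1)\<^esub>J\<in>simplices_of_card \<Delta> k.
       mu \<Delta> x J \<otimes>\<^bsub>Rat_G (CARD('n) - k + 1)\<^esub>
       Rat_G_const (CARD('n) - k + 1) (p_star_exp \<Delta> \<xi> (x_face \<Delta> J)))"
proof -
  let ?r = "CARD('n) - k + 1" and ?S = "simplices_of_card \<Delta> k" and ?m = "CARD('n) - k"
  obtain p where p: "x = HT_class \<Delta> p" "vars p \<subseteq> rays \<Delta>" "homogeneous k p"
    using x by (auto simp: HT_deg_def)
  obtain z where z: "\<xi> = HT_class \<Delta> z" "vars z \<subseteq> rays \<Delta>" "homogeneous 1 z"
    using \<xi> by (auto simp: HT_deg_def)
  interpret nonempty_grassmannian ?r "TYPE('n)" by unfold_locales (rule nonvanishing_1[OF k])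
  have S: "J \<in> simplices \<Delta>" "card J = k" if "J \<in> ?S" for J using that by (auto simp: simplices_of_card_def)
  have finS: "finite ?S" using finite_simplices by (rule finite_subset[rotated]) (auto simp: simplices_of_card_def)
  define X where "X = (\<lambda>J :: 'n cone set. \<Prod>j\<in>J. Var j :: 'n cone qpoly)"
  define c where "c = top_pairing ?m z p"
  define cJ where "cJ = (\<lambda>J. top_pairing ?m z (X J))"
  define F where "F = (\<lambda>J. face_hom J p)"
  define Q where "Q = (\<lambda>J. face_hom J (X J))"
  have X: "vars (X J) \<subseteq> rays \<Delta>" "homogeneous k (X J)" if "J \<in> ?S" for J
  proof -
    show "vars (X J) \<subseteq> rays \<Delta>"
      unfolding X_def by (rule vars_prod_subset) (use simplexD(2)[OF S(1)[OF that]] in auto)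
    show "homogeneous k (X J)"
      unfolding X_def using homogeneous_face[OF simplexD(1)[OF S(1)[OF that]]] S(2)[OF that] by simp
  qed
  have lhs: "p_star_exp \<Delta> \<xi> x = c"
    unfolding p(1) z(1) c_def by (rule p_star_exp_class) (use p z k in auto)
  have rhs: "p_star_exp \<Delta> \<xi> (x_face \<Delta> J) = cJ J" if "J \<in> ?S" for J
    unfolding x_face_def z(1) cJ_def X_def[symmetric] by (rule p_star_exp_class) (use X[OF that] z k in auto)
  have FQ: "F J \<in> ext_forms ?r k" "Q J \<in> ext_forms ?r k" "\<not> vanishes_on_grassmannian ?r (Q J)" "Q J \<noteq> 0" if "J \<in> ?S" for J
  proof -
    show "F J \<in> ext_forms ?r k" "Q J \<in> ext_forms ?r k"
      unfolding F_def Q_def using face_hom_ext_forms[OF S(1)[OF that]] p(3) X(2)[OF that] S(2)[OF that] by auto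
    show "\<not> vanishes_on_grassmannian ?r (Q J)"
      unfolding Q_def X_def by (rule face_hom_self_not_vanishing[OF that k])
    then show "Q J \<noteq> 0" by auto
  qed
  have muR: "to_fract (F J) / to_fract (Q J) \<in> carrier R" if "J \<in> ?S" for J
    using FQ[OF that] by (intro plucker_local_ringI)
  define h where "h = (\<lambda>J. to_fract (F J) / to_fract (Q J) * to_fract (Const (cJ J)))"
  have hR: "h J \<in> carrier R" if "J \<in> ?S" for J
    unfolding h_def by (rule mult_in_R[OF muR[OF that] const_in_R])
  have summand: "mu \<Delta> x J \<otimes>\<^bsub>Rat_G ?r\<^esub> Rat_G_const ?r (p_star_exp \<Delta> \<xi> (x_face \<Delta> J)) = plucker_pullback ?r (h J)"
    if "J \<in> ?S" for J
  proof -
    have "mu \<Delta> x J = plucker_pullback ?r (to_fract (F J) / to_fract (Q J))"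
      unfolding p(1) mu_class[OF S(1)[OF that]] S(2)[OF that] F_def Q_def X_def ..
    then show ?thesis
      using Ring.ring_hom_mult[OF pullback_hom muR[OF that] const_in_R, of "cJ J"]
      by (simp add: Rat_G_const_def rhs[OF that] h_def)
  qed
  have "(\<Oplus>\<^bsub>Rat_G ?r\<^esub>J\<in>?S. mu \<Delta> x J \<otimes>\<^bsub>Rat_G ?r\<^esub> Rat_G_const ?r (p_star_exp \<Delta> \<xi> (x_face \<Delta> J)))
      = (\<Oplus>\<^bsub>Rat_G ?r\<^esub>J\<in>?S. plucker_pullback ?r (h J))"
  proof -
    interpret G: ring "Rat_G ?r :: 'n list qpoly fract set ring" by (rule ring_Rat_G)
    show ?thesis
      by (rule G.finsum_cong') (use summand Ring.ring_hom_closed[OF pullback_hom hR] in auto)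
  qed
  also have "\<dots> = plucker_pullback ?r (\<Sum>J\<in>?S. h J)"
    by (rule conjunct1[OF finsum_pullback[of ?S h, OF finS hR]])
  also have "\<dots> = plucker_pullback ?r (to_fract (Const c))"
  proof (rule pullback_eqI)
    define D where "D = (\<Prod>J\<in>?S. Q J)"
    define N where "N = (\<Sum>J\<in>?S. Const (cJ J) * (F J * (\<Prod>J'\<in>?S - {J}. Q J'))) - Const c * D"
    have D: "D \<in> ext_forms ?r (k * card ?S)" unfolding D_def by (rule ext_forms_prod) (rule FQ)
    have Dnv: "\<not> vanishes_on_grassmannian ?r D"
      unfolding D_def by (rule not_vanishes_prod[OF one_not_vanishing]) (use FQ in auto)
    have N: "N \<in> ext_forms ?r (k * card ?S)"
      unfolding N_def
    proof (intro ext_forms_diff ext_forms_sum ext_forms_scale D)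
      fix J assume J: "J \<in> ?S"
      have "(\<Prod>J'\<in>?S - {J}. Q J') \<in> ext_forms ?r (k * card (?S - {J}))" by (rule ext_forms_prod) (use FQ in auto)
      from ext_forms_mult[OF FQ(1)[OF J] this]
      have "F J * (\<Prod>J'\<in>?S - {J}. Q J') \<in> ext_forms ?r (k + k * card (?S - {J}))" .
      moreover have "k + k * card (?S - {J}) = k * card ?S"
        using J finS card_Suc_Diff1[OF finS J] by (metis mult_Suc_right)
      ultimately show "F J * (\<Prod>J'\<in>?S - {J}. Q J') \<in> ext_forms ?r (k * card ?S)" by simp
    qed
    have D_split: "D = Q J * (\<Prod>J'\<in>?S - {J}. Q J')" if "J \<in> ?S" for J
      unfolding D_def by (rule prod.remove[OF finS that])
    have "vanishes_on_grassmannian ?r (N * D)"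
      unfolding vanishes_iff_frames
    proof (intro allI impI)
      fix ws :: "(rat ^ 'n::{finite,linorder}) list" and b
      assume ws: "length ws = ?r \<and> distinct ws \<and> vec.independent (set ws)"
      let ?ev = "poly_hom id (\<lambda>S. b * wedge ws S)"
      show "?ev (N * D) = 0"
      proof (cases "?ev D = 0")
        case True then show ?thesis by (simp add: id_hom.hom_mult)
      next
        case False
        then have Qnz: "?ev (Q J) \<noteq> 0" if "J \<in> ?S" for J
          using D_split[OF that] by (auto simp: id_hom.hom_mult)
        have "c = (\<Sum>J\<in>?S. ?ev (F J) / ?ev (Q J) * cJ J)"
          unfolding c_def F_def Q_def X_def cJ_def
          by (rule pointwise_identity[OF k z(2,3) p(2,3)]) (use ws Qnz in \<open>auto simp: Q_def X_def\<close>)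
        then have "?ev D * c = (\<Sum>J\<in>?S. ?ev D * (?ev (F J) / ?ev (Q J) * cJ J))" by (simp add: sum_distrib_left)
        also have "\<dots> = (\<Sum>J\<in>?S. cJ J * (?ev (F J) * ?ev (\<Prod>J'\<in>?S - {J}. Q J')))"
          by (rule sum.cong[OF refl]) (use Qnz D_split in \<open>simp add: id_hom.hom_mult\<close>)
        finally have "?ev N = 0"
          unfolding N_def by (simp add: id_hom.hom_diff id_hom.hom_sum id_hom.hom_mult mult.commute)
        then show ?thesis by (simp add: id_hom.hom_mult)
      qed
    qed
    then have Nv: "vanishes_on_grassmannian ?r N" using not_vanishes_mult[OF N D] Dnv by blast
    have D0: "to_fract D \<noteq> 0" using Dnv by auto
    have "to_fract N / to_fract D = (\<Sum>J\<in>?S. h J) - to_fract (Const c)"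
    proof -
      have "to_fract (Const (cJ J) * (F J * (\<Prod>J'\<in>?S - {J}. Q J'))) / to_fract D = h J" if "J \<in> ?S" for J
      proof -
        have "to_fract (\<Prod>J'\<in>?S - {J}. Q J') \<noteq> 0" using D0 D_split[OF that] by auto
        then show ?thesis unfolding h_def D_split[OF that] using FQ(4)[OF that] by simp
      qed
      then have "(\<Sum>J\<in>?S. to_fract (Const (cJ J) * (F J * (\<Prod>J'\<in>?S - {J}. Q J'))) / to_fract D) = (\<Sum>J\<in>?S. h J)"
        by (rule sum.cong[OF refl])
      then show ?thesis
        unfolding N_def using D0 by (simp only: to_fract_diff to_fract_sum diff_divide_distrib sum_divide_distrib) simp
    qed
    then show "(\<Sum>J\<in>?S. h J) - to_fract (Const c) \<in> plucker_max_ideal ?r"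
      using plucker_max_idealI[OF N D Nv Dnv] by simp
  qed
  finally show ?thesis unfolding lhs Rat_G_const_def by simp
qed

end

theorem theorem2p1:
  fixes \<Delta> :: "'n::{finite,linorder} cone set"
    and k :: nat
    and x \<xi> :: "'n cone qpoly set"
  assumes "simplicial_fan \<Delta>" and "complete_fan \<Delta>"
    and "1 \<le> k" and "k \<le> CARD('n)"
    and "x \<in> HT_deg \<Delta> k"
    and "\<xi> \<in> HT_deg \<Delta> 1"
  shows "Rat_G_const (CARD('n) - k + 1) (p_star_exp \<Delta> \<xi> x) =
    (\<Oplus>\<^bsub>Rat_G (CARD('n) - k + 1)\<^esub>J\<in>simplices_of_card \<Delta> k.
       mu \<Delta> x J \<otimes>\<^bsub>Rat_G (CARD('n) - k + 1)\<^esub>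
       Rat_G_const (CARD('n) - k + 1) (p_star_exp \<Delta> \<xi> (x_face \<Delta> J)))"
proof -
  interpret complete_simplicial_fan_ordered \<Delta> by unfold_locales fact+
  show ?thesis by (rule localization_identity) fact+
qed

end
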